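(* Let $H$ be a graph such that every graph in $\mathrm{Spasm}(H)$ has treewidth at most two. Then, given a graph $G$, the number $\#\mathrm{Sub}(H,G)$ can be computed in time $f(H)\cdot|V(G)|^{\omega}$, where $f(H)$ is a function depending only on $H$ and $\omega$ is the matrix multiplication exponent.
   Context: All graphs are finite, simple and undirected. $\#\mathrm{Sub}(H,G)$ denotes the number of subgraphs of $G$ isomorphic to $H$. For a partition $\rho$ of $V(H)$, $H/\rho$ is the graph obtained by identifying the vertices of each block of $\rho$ into one vertex (parallel edges merged). $\mathrm{Spasm}(H)$ is the set of isomorphism classes of loop-free graphs $H/\rho$ where $\rho$ ranges over partitions of $V(H)$ into independent sets of $H$ (the homomorphic images of $H$). $\omega$ is the exponent such that two $n\times n$ matrices can be multiplied in time $O(n^\omega)$. *)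

theory Defs
  imports
    "Graph_Theory.Digraph_Isomorphism"
    "Jordan_Normal_Form.Matrix"
    "HOL-Library.Disjoint_Sets"
    Complex_Main
begin

section \<open>Graphs\<close>

text \<open>
  Finite simple undirected graphs are the finite, symmetric, loop-free digraphs without parallel
  arcs of \<^locale>\<open>pair_graph\<close>; an undirected edge \<open>uv\<close> is the pair of arcs \<open>(u, v)\<close>, \<open>(v, u)\<close>.
\<close>

definition graph_iso :: "'a pair_pre_digraph \<Rightarrow> 'b pair_pre_digraph \<Rightarrow> bool" where
  "graph_iso G H \<longleftrightarrow> digraph_iso (with_proj G) (with_proj H)"

definition num_sub :: "'a pair_pre_digraph \<Rightarrow> 'b pair_pre_digraph \<Rightarrow> nat" where
  "num_sub H G =
     card {S. pair_graph S \<and> subgraph (with_proj S) (with_proj G) \<and> graph_iso S H}"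

definition quotient_graph :: "'a pair_pre_digraph \<Rightarrow> 'a set set \<Rightarrow> 'a set pair_pre_digraph" where
  "quotient_graph H \<rho> =
     \<lparr>pverts = \<rho>, parcs = {(A, B). A \<in> \<rho> \<and> B \<in> \<rho> \<and> (\<exists>a\<in>A. \<exists>b\<in>B. (a, b) \<in> parcs H)}\<rparr>"

definition independent_set :: "'a pair_pre_digraph \<Rightarrow> 'a set \<Rightarrow> bool" where
  "independent_set H I \<longleftrightarrow> I \<subseteq> pverts H \<and> (\<forall>u\<in>I. \<forall>v\<in>I. (u, v) \<notin> parcs H)"

text \<open>
  The elements of the spasm are isomorphism classes, represented as sets of graphs
  on vertices of type \<^typ>\<open>'a set\<close>, the vertex type of the quotients. Independence of the blocks is
  exactly what makes a quotient loop-free.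
\<close>

definition spasm :: "'a pair_pre_digraph \<Rightarrow> 'a set pair_pre_digraph set set" where
  "spasm H =
     {{F. pair_graph F \<and> graph_iso F (quotient_graph H \<rho>)} | \<rho>.
        partition_on (pverts H) \<rho> \<and> (\<forall>B\<in>\<rho>. independent_set H B)}"


section \<open>Treewidth\<close>

text \<open>
  The constants \<^const>\<open>forest\<close> and \<^const>\<open>tree\<close> forbid all directed cycles, hence also the closed
  walk \<open>u, v, u\<close> along a single undirected edge. In a symmetric digraph, the cycles of the
  underlying undirected graph are the cycles of length at least three.
\<close>

definition undirected_tree :: "'a pair_pre_digraph \<Rightarrow> bool" where
  "undirected_tree T \<longleftrightarrow>
     pair_graph T \<and> connected (with_proj T) \<and>
     (\<nexists>p. pre_digraph.cycle (with_proj T) p \<and> 3 \<le> length p)"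

definition tree_decomposition ::
    "'a pair_pre_digraph \<Rightarrow> 'b pair_pre_digraph \<Rightarrow> ('b \<Rightarrow> 'a set) \<Rightarrow> bool" where
  "tree_decomposition G T bag \<longleftrightarrow>
     undirected_tree T \<and>
     (\<Union>t\<in>pverts T. bag t) = pverts G \<and>
     (\<forall>(u, v)\<in>parcs G. \<exists>t\<in>pverts T. u \<in> bag t \<and> v \<in> bag t) \<and>
     (\<forall>v\<in>pverts G. connected (with_proj T \<restriction> {t \<in> pverts T. v \<in> bag t}))"

text \<open>
  Every finite tree is isomorphic to one on natural numbers. The graph without vertices gets
  treewidth 0 here instead of the also customary \<open>-1\<close>.
\<close>

definition treewidth :: "'a pair_pre_digraph \<Rightarrow> nat" where
  "treewidth G =
     (LEAST k. \<exists>(T :: nat pair_pre_digraph) bag.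
        tree_decomposition G T bag \<and> (\<forall>t\<in>pverts T. card (bag t) \<le> k + 1))"


section \<open>Random access machine\<close>

text \<open>
  Running time is measured on a word RAM with words of \<open>O(log n)\<close> bits, programmed in a structured
  language over integer registers and finitely many arrays (arrays are indexed by integers; a
  program mentions only finitely many registers and arrays). Every instruction and every test
  costs one step. All numbers are restricted to absolute value at most \<open>W\<close>: an instruction that
  would put a larger number into a register has no execution. Without this restriction,
  unit-cost multiplication of huge integers would make matrix multiplication unrealistically
  cheap.
\<close>

datatype arith_op = Plus | Minus | Times | Quotient | Remainder

fun arith :: "arith_op \<Rightarrow> int \<Rightarrow> int \<Rightarrow> int" where
  "arith Plus x y = x + y"
| "arith Minus x y = x - y"
| "arith Times x y = x * y"
| "arith Quotient x y = x div y"
| "arith Remainder x y = x mod y"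

type_synonym register = nat
type_synonym array = nat

datatype prog =
    Skip
  | Const register int
  | Arith register arith_op register register
  | Load register array register
  | Store array register register
  | Seq prog prog
  | IfPos register prog prog
  | WhilePos register prog

record ram_state =
  regs :: "register \<Rightarrow> int"
  arrs :: "array \<Rightarrow> int \<Rightarrow> int"

text \<open>\<open>exec W P s k t\<close>: started in \<open>s\<close>, program \<open>P\<close> halts in \<open>t\<close> after exactly \<open>k\<close> steps.\<close>

inductive exec :: "int \<Rightarrow> prog \<Rightarrow> ram_state \<Rightarrow> nat \<Rightarrow> ram_state \<Rightarrow> bool" for W where
  Skip: "exec W Skip s 1 s"
| Const: "\<bar>c\<bar> \<le> W \<Longrightarrow> exec W (Const r c) s 1 (s\<lparr>regs := (regs s)(r := c)\<rparr>)"
| Arith: "v = arith f (regs s p) (regs s q) \<Longrightarrow> \<bar>v\<bar> \<le> W \<Longrightarrow>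
    exec W (Arith r f p q) s 1 (s\<lparr>regs := (regs s)(r := v)\<rparr>)"
| Load: "v = arrs s a (regs s p) \<Longrightarrow> \<bar>v\<bar> \<le> W \<Longrightarrow>
    exec W (Load r a p) s 1 (s\<lparr>regs := (regs s)(r := v)\<rparr>)"
| Store: "exec W (Store a p q) s 1
    (s\<lparr>arrs := (arrs s)(a := (arrs s a)(regs s p := regs s q))\<rparr>)"
| Seq: "exec W P s k s' \<Longrightarrow> exec W Q s' l t \<Longrightarrow> exec W (Seq P Q) s (k + l) t"
| IfTrue: "0 < regs s r \<Longrightarrow> exec W P s k t \<Longrightarrow> exec W (IfPos r P Q) s (k + 1) t"
| IfFalse: "\<not> 0 < regs s r \<Longrightarrow> exec W Q s k t \<Longrightarrow> exec W (IfPos r P Q) s (k + 1) t"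
| WhileTrue: "0 < regs s r \<Longrightarrow> exec W P s k s' \<Longrightarrow> exec W (WhilePos r P) s' l t \<Longrightarrow>
    exec W (WhilePos r P) s (k + l + 1) t"
| WhileFalse: "\<not> 0 < regs s r \<Longrightarrow> exec W (WhilePos r P) s 1 s"

definition runs_within ::
    "int \<Rightarrow> prog \<Rightarrow> ram_state \<Rightarrow> real \<Rightarrow> (ram_state \<Rightarrow> bool) \<Rightarrow> bool" where
  "runs_within W P s T Q \<longleftrightarrow> (\<exists>k t. exec W P s k t \<and> real k \<le> T \<and> Q t)"

definition word_bound :: "nat \<Rightarrow> nat \<Rightarrow> int" where
  "word_bound c n = (int n + 2) ^ c"

text \<open>Row-major layout of an \<open>n \<times> n\<close> matrix; all other cells are zero.\<close>

definition matrix_array :: "nat \<Rightarrow> int mat \<Rightarrow> int \<Rightarrow> int" where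
  "matrix_array n A p =
     (if 0 \<le> p \<and> p < int (n * n) then A $$ (nat p div n, nat p mod n) else 0)"

definition adjacency_matrix :: "nat \<Rightarrow> nat pair_pre_digraph \<Rightarrow> int mat" where
  "adjacency_matrix n G = mat n n (\<lambda>(i, j). if (i, j) \<in> parcs G then 1 else 0)"

definition matmul_input :: "nat \<Rightarrow> int mat \<Rightarrow> int mat \<Rightarrow> ram_state" where
  "matmul_input n A B =
     \<lparr>regs = (\<lambda>_. 0)(0 := int n),
      arrs = (\<lambda>_ _. 0)(0 := matrix_array n A, 1 := matrix_array n B)\<rparr>"

definition graph_input :: "nat \<Rightarrow> nat pair_pre_digraph \<Rightarrow> ram_state" where
  "graph_input n G =
     \<lparr>regs = (\<lambda>_. 0)(0 := int n),
      arrs = (\<lambda>_ _. 0)(0 := matrix_array n (adjacency_matrix n G))\<rparr>"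

text \<open>
  \<open>matmul_exponent \<omega>\<close>: two \<open>n \<times> n\<close> integer matrices whose entries have \<open>O(log n)\<close> bits can be
  multiplied in time \<open>O(n\<^sup>\<omega>)\<close>; the product is written to array 2. Only attained exponents are
  admitted, not an infimum that is possibly never attained.
\<close>

definition matmul_exponent :: "real \<Rightarrow> bool" where
  "matmul_exponent \<omega> \<longleftrightarrow>
     (\<forall>d. \<exists>P c C. \<forall>n. \<forall>A \<in> carrier_mat n n. \<forall>B \<in> carrier_mat n n.
        (\<forall>i<n. \<forall>j<n. \<bar>A $$ (i, j)\<bar> \<le> int n ^ d \<and> \<bar>B $$ (i, j)\<bar> \<le> int n ^ d) \<longrightarrow>
        runs_within (word_bound c n) P (matmul_input n A B) (C * real (max 1 n) powr \<omega>)
          (\<lambda>t. \<forall>i<n. \<forall>j<n. arrs t 2 (int (i * n + j)) = (A * B) $$ (i, j)))"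

text \<open>
  The input graph has vertices \<open>0, \<dots>, n - 1\<close> and is given by \<open>n\<close> and its adjacency matrix; the
  result is returned in register 0.
\<close>

definition computes_in_time ::
    "prog \<Rightarrow> (nat pair_pre_digraph \<Rightarrow> nat) \<Rightarrow> (nat \<Rightarrow> real) \<Rightarrow> bool" where
  "computes_in_time P \<phi> T \<longleftrightarrow>
     (\<exists>c. \<forall>n G. pair_graph G \<and> pverts G = {0..<n} \<longrightarrow>
        runs_within (word_bound c n) P (graph_input n G) (T n) (\<lambda>t. regs t 0 = int (\<phi> G)))"

end

theory Submission
  imports Defs
begin

text \<open>
  Subgraph counts are injective homomorphism counts divided by the number of automorphisms. By
  inclusion and exclusion over the pairs of vertices that a map identifies, the number of injective
  homomorphisms is an integer combination of homomorphism counts from quotients of \<open>H\<close>; quotients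
  with a dependent block contribute nothing because the host graph has no loops.

  Homomorphisms from a graph of treewidth at most two are counted by eliminating vertices. A leaf
  of a tree decomposition whose bag is not contained in the neighbouring bag has a vertex that
  lies in no other bag, and this vertex has at most two neighbours. Summing over its images is one
  multiplication of \<open>n \<times> n\<close> matrices and leaves a weighted network on the remaining vertices,
  whose entries are still bounded by a fixed power of \<open>n\<close>. All other work is \<open>O(n\<^sup>2)\<close>, and
  \<open>\<omega> \<ge> 2\<close> because a program needs \<open>n\<^sup>2\<close> stores to write a product without zero entries.
\<close>

section \<open>Executing programs\<close>

text \<open>A program provided by \<open>matmul_exponent\<close> is tied to one degree of the entry
  bound, and entries grow with every elimination. Hence computability of a matrix includes a bound
  \<open>n ^ d\<close>, and each call picks the program for its own degree. The number of calls
  depends on \<open>H\<close> only, so one program, one word exponent and one constant emerge in the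
  end. Width two is what keeps the weights binary: a bag of three vertices leaves a private vertex
  at most two partners \<open>a\<close> and \<open>b\<close>, so its elimination yields a function
  of two images, that is, a matrix. Since \<open>a\<close> and \<open>b\<close> share the bag of the
  eliminated vertex, the new weight on \<open>(a, b)\<close> is covered by the same tree, and no bag
  ever grows. Inclusion and exclusion run over sets of pairs. Different sets may generate the same
  partition; they stay separate summands, so that every coefficient is a sign. Collecting them would
  give the Moebius coefficients of the partition lattice.\<close>

lemma exec_mono_bound: "exec W P s k t \<Longrightarrow> W \<le> W' \<Longrightarrow> exec W' P s k t"
  by (induction rule: exec.induct) (blast intro: exec.intros order_trans)+

text \<open>One step changes at most one cell, so counting changed cells bounds the running time
  from below. This is the source of \<open>2 \<le> \<omega>\<close>.\<close>

lemma exec_stores_le: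
  assumes "exec W P s k t"
  shows "finite {x. arrs t a x \<noteq> arrs s a x} \<and> card {x. arrs t a x \<noteq> arrs s a x} \<le> k"
  using assms
proof (induction rule: exec.induct)
  case (Store b p q s)
  have "{x. arrs (s\<lparr>arrs := (arrs s)(b := (arrs s b)(regs s p := regs s q))\<rparr>) a x \<noteq> arrs s a x}
      \<subseteq> {regs s p}"
    by auto
  from card_mono[OF _ this] finite_subset[OF this] show ?case by simp
next
  case (Seq P s k s' Q l t)
  have sub: "{x. arrs t a x \<noteq> arrs s a x} \<subseteq>
      {x. arrs s' a x \<noteq> arrs s a x} \<union> {x. arrs t a x \<noteq> arrs s' a x}" by auto
  moreover have "card ({x. arrs s' a x \<noteq> arrs s a x} \<union> {x. arrs t a x \<noteq> arrs s' a x}) \<le> k + l"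
    using Seq.IH by (meson add_mono card_Un_le le_trans)
  ultimately show ?case using Seq.IH
    by (meson card_mono finite_Un finite_subset le_trans)
next
  case (WhileTrue s r P k s' l t)
  have sub: "{x. arrs t a x \<noteq> arrs s a x} \<subseteq>
      {x. arrs s' a x \<noteq> arrs s a x} \<union> {x. arrs t a x \<noteq> arrs s' a x}" by auto
  moreover have "card ({x. arrs s' a x \<noteq> arrs s a x} \<union> {x. arrs t a x \<noteq> arrs s' a x}) \<le> k + l"
    using WhileTrue.IH by (meson add_mono card_Un_le le_trans)
  ultimately show ?case using WhileTrue.IH
    by (metis (no_types, lifting) add.commute card_mono finite_Un finite_subset le_trans le_add2 plus_1_eq_Suc)
qed auto

section \<open>Relocation of programs to untouched registers and arrays\<close>

primrec prog_bound :: "prog \<Rightarrow> nat" where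
  "prog_bound Skip = 0"
| "prog_bound (Const r c) = Suc r"
| "prog_bound (Arith r f p q) = Suc (max r (max p q))"
| "prog_bound (Load r a p) = Suc (max r (max a p))"
| "prog_bound (Store a p q) = Suc (max a (max p q))"
| "prog_bound (Seq P Q) = max (prog_bound P) (prog_bound Q)"
| "prog_bound (IfPos r P Q) = max (Suc r) (max (prog_bound P) (prog_bound Q))"
| "prog_bound (WhilePos r P) = max (Suc r) (prog_bound P)"

text \<open>A program writes only to what it mentions. The garbage it leaves is thus confined to a
  range known in advance, and the next call can be placed beyond it.\<close>

lemma exec_frame:
  "exec W P s k t \<Longrightarrow> prog_bound P \<le> r \<Longrightarrow> regs t r = regs s r \<and> arrs t r = arrs s r"
  by (induction rule: exec.induct) auto

text \<open>
  A multiplication program must start with cleared registers and arrays but may leave garbage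
  anywhere. Hence every call runs its own copy of the program, relocated to a block of registers
  and arrays that no earlier program has touched.
\<close>

primrec shift_prog :: "nat \<Rightarrow> prog \<Rightarrow> prog" where
  "shift_prog b Skip = Skip"
| "shift_prog b (Const r c) = Const (b + r) c"
| "shift_prog b (Arith r f p q) = Arith (b + r) f (b + p) (b + q)"
| "shift_prog b (Load r a p) = Load (b + r) (b + a) (b + p)"
| "shift_prog b (Store a p q) = Store (b + a) (b + p) (b + q)"
| "shift_prog b (Seq P Q) = Seq (shift_prog b P) (shift_prog b Q)"
| "shift_prog b (IfPos r P Q) = IfPos (b + r) (shift_prog b P) (shift_prog b Q)"
| "shift_prog b (WhilePos r P) = WhilePos (b + r) (shift_prog b P)"

text \<open>Nothing is required of \<open>s'\<close> below \<open>b\<close>, where the surrounding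
  program keeps its data.\<close>

definition shifted_state :: "nat \<Rightarrow> ram_state \<Rightarrow> ram_state \<Rightarrow> bool" where
  "shifted_state b s s' \<longleftrightarrow> (\<forall>r. regs s' (b + r) = regs s r \<and> arrs s' (b + r) = arrs s r)"

definition agree_below :: "nat \<Rightarrow> ram_state \<Rightarrow> ram_state \<Rightarrow> bool" where
  "agree_below m s t \<longleftrightarrow> (\<forall>r<m. regs t r = regs s r \<and> arrs t r = arrs s r)"

lemma agree_belowI:
  "(\<And>r. r < m \<Longrightarrow> regs t r = regs s r) \<Longrightarrow> (\<And>r. r < m \<Longrightarrow> arrs t r = arrs s r) \<Longrightarrow> agree_below m s t"
  by (simp add: agree_below_def)

lemma agree_below_arrs: "agree_below m s t \<Longrightarrow> a < m \<Longrightarrow> arrs t a = arrs s a"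
  and agree_below_regs: "agree_below m s t \<Longrightarrow> r < m \<Longrightarrow> regs t r = regs s r"
  by (simp_all add: agree_below_def)

lemma agree_below_refl [simp]: "agree_below m s s"
  by (simp add: agree_below_def)

lemma agree_below_trans: "agree_below m s t \<Longrightarrow> agree_below m' t u \<Longrightarrow> m \<le> m' \<Longrightarrow> agree_below m s u"
  by (simp add: agree_below_def)

text \<open>Every name is raised by \<open>b\<close>, so the relocated run follows the original one
  in lockstep, with equal values, an equal number of steps and the same word bound, and it cannot
  reach anything below \<open>b\<close>.\<close>

lemma exec_shift_prog:
  "exec W P s k t \<Longrightarrow> shifted_state b s s' \<Longrightarrow>
    \<exists>t'. exec W (shift_prog b P) s' k t' \<and> shifted_state b t t' \<and> agree_below b s' t'"
proof (induction arbitrary: s' rule: exec.induct)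
  case (Skip s)
  then show ?case using agree_below_refl by (auto intro: exec.Skip simp del: One_nat_def)
next
  case (Const c r s)
  then show ?case
    by (intro exI[of _ "s'\<lparr>regs := (regs s')(b + r := c)\<rparr>"])
      (auto simp: shifted_state_def agree_below_def simp del: One_nat_def intro!: exec.intros)
next
  case (Arith v f s p q r)
  then show ?case
    by (intro exI[of _ "s'\<lparr>regs := (regs s')(b + r := v)\<rparr>"])
      (auto simp: shifted_state_def agree_below_def simp del: One_nat_def intro!: exec.intros)
next
  case (Load v s a p r)
  then show ?case
    by (intro exI[of _ "s'\<lparr>regs := (regs s')(b + r := v)\<rparr>"])
      (auto simp: shifted_state_def agree_below_def simp del: One_nat_def intro!: exec.intros)
next
  case (Store a p q s)
  have "exec W (shift_prog b (Store a p q)) s' 1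
      (s'\<lparr>arrs := (arrs s')(b + a := (arrs s' (b + a))(regs s' (b + p) := regs s' (b + q)))\<rparr>)"
    by (simp only: shift_prog.simps) (rule exec.Store)
  with Store show ?case
    by (intro exI conjI) (assumption, auto simp: shifted_state_def agree_below_def)
next
  case (Seq P s k s1 Q l t)
  then show ?case by (fastforce intro: exec.intros agree_below_trans)
next
  case (IfTrue s r P k t Q)
  then obtain t' where "exec W (shift_prog b P) s' k t'" "shifted_state b t t'" "agree_below b s' t'"
    by blast
  moreover have "0 < regs s' (b + r)" using IfTrue by (simp add: shifted_state_def)
  ultimately show ?case unfolding shift_prog.simps by (blast intro: exec.IfTrue)
next
  case (IfFalse s r Q k t P)
  then obtain t' where "exec W (shift_prog b Q) s' k t'" "shifted_state b t t'" "agree_below b s' t'"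
    by blast
  moreover have "\<not> 0 < regs s' (b + r)" using IfFalse by (simp add: shifted_state_def)
  ultimately show ?case unfolding shift_prog.simps by (blast intro: exec.IfFalse)
next
  case (WhileTrue s r P k s1 l t)
  then obtain s1' where 1: "exec W (shift_prog b P) s' k s1'" "shifted_state b s1 s1'" "agree_below b s' s1'"
    by blast
  with WhileTrue obtain t' where 2: "exec W (shift_prog b (WhilePos r P)) s1' l t'"
    "shifted_state b t t'" "agree_below b s1' t'"
    by blast
  have "0 < regs s' (b + r)" using WhileTrue by (simp add: shifted_state_def)
  with 1 2 show ?case unfolding shift_prog.simps by (blast intro: exec.WhileTrue agree_below_trans order_refl)
next
  case (WhileFalse s r P)
  then have "\<not> 0 < regs s' (b + r)" by (simp add: shifted_state_def)
  with WhileFalse show ?case unfolding shift_prog.simps by (blast intro: exec.WhileFalse agree_below_refl)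
qed

definition halts_within :: "int \<Rightarrow> prog \<Rightarrow> ram_state \<Rightarrow> nat \<Rightarrow> (ram_state \<Rightarrow> bool) \<Rightarrow> bool" where
  "halts_within W P s K Q \<longleftrightarrow> (\<exists>k\<le>K. \<exists>t. exec W P s k t \<and> Q t)"

lemma halts_within_mono:
  "halts_within W P s K Q \<Longrightarrow> K \<le> L \<Longrightarrow> (\<And>t. Q t \<Longrightarrow> R t) \<Longrightarrow> halts_within W P s L R"
  unfolding halts_within_def by (meson le_trans)

text \<open>The postcondition of the first part is itself a claim about the run of the second.
  Backward application of such rules verifies straight-line code by symbolic execution and adds up
  the costs.\<close>

lemma halts_within_Seq:
  assumes "halts_within W P s K (\<lambda>s'. halts_within W Q s' L R)"
  shows "halts_within W (Seq P Q) s (K + L) R"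
  using assms unfolding halts_within_def by (meson exec.Seq add_mono)

lemma halts_within_Const:
  "\<bar>c\<bar> \<le> W \<Longrightarrow> Q (s\<lparr>regs := (regs s)(r := c)\<rparr>) \<Longrightarrow> halts_within W (Const r c) s 1 Q"
  unfolding halts_within_def by (blast intro: exec.Const)

lemma halts_within_Arith:
  "\<bar>arith f (regs s p) (regs s q)\<bar> \<le> W \<Longrightarrow>
    Q (s\<lparr>regs := (regs s)(r := arith f (regs s p) (regs s q))\<rparr>) \<Longrightarrow>
    halts_within W (Arith r f p q) s 1 Q"
  unfolding halts_within_def by (blast intro: exec.Arith)

lemma halts_within_Load:
  "\<bar>arrs s a (regs s p)\<bar> \<le> W \<Longrightarrow> Q (s\<lparr>regs := (regs s)(r := arrs s a (regs s p))\<rparr>) \<Longrightarrow>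
    halts_within W (Load r a p) s 1 Q"
  unfolding halts_within_def by (blast intro: exec.Load)

lemma halts_within_Store:
  "Q (s\<lparr>arrs := (arrs s)(a := (arrs s a)(regs s p := regs s q))\<rparr>) \<Longrightarrow>
    halts_within W (Store a p q) s 1 Q"
  unfolding halts_within_def by (blast intro: exec.Store)

text \<open>The invariant is indexed by the number of passes still to come, which yields termination
  and cost together. Each pass pays for its test, and the failing test adds the final 1.\<close>

lemma halts_within_WhilePos:
  assumes inv: "I i s"
    and step: "\<And>i s. I (Suc i) s \<Longrightarrow> 0 < regs s r \<and> halts_within W P s K (I i)"
    and stop: "\<And>s. I 0 s \<Longrightarrow> \<not> 0 < regs s r"
  shows "halts_within W (WhilePos r P) s (i * (K + 1) + 1) (I 0)"
  using inv
proof (induction i arbitrary: s)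
  case 0
  show ?case unfolding halts_within_def using exec.WhileFalse[OF stop[OF 0]] 0 by auto
next
  case (Suc i)
  from step[OF Suc.prems] obtain k s' where 1: "0 < regs s r" "exec W P s k s'" "k \<le> K" "I i s'"
    unfolding halts_within_def by blast
  from Suc.IH[OF \<open>I i s'\<close>] obtain l t where
    "l \<le> i * (K + 1) + 1" "exec W (WhilePos r P) s' l t" "I 0 t"
    unfolding halts_within_def by blast
  moreover from calculation 1 have "exec W (WhilePos r P) s (k + l + 1) t"
    by (blast intro: exec.WhileTrue)
  moreover have "k + l + 1 \<le> Suc i * (K + 1) + 1"
    using \<open>k \<le> K\<close> \<open>l \<le> i * (K + 1) + 1\<close> by simp
  ultimately show ?case unfolding halts_within_def by blast
qed

section \<open>Computable scalars and matrices\<close>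

lemma word_bound_mono: "c \<le> d \<Longrightarrow> word_bound c n \<le> word_bound d n"
  unfolding word_bound_def by (rule power_increasing) auto

lemma word_bound_ge_1: "1 \<le> word_bound c n"
  unfolding word_bound_def by (rule one_le_power) simp

lemma int_power_le_word_bound: "int n ^ d \<le> word_bound d n"
  unfolding word_bound_def by (rule power_mono) auto

lemma square_le_word_bound: "2 \<le> c \<Longrightarrow> int n * int n \<le> word_bound c n"
  using int_power_le_word_bound[of n 2] word_bound_mono[of 2 c n] by (simp add: power2_eq_square)

lemma word_bound_mult: "word_bound c n * word_bound d n = word_bound (c + d) n"
  by (simp add: word_bound_def power_add)

text \<open>The base \<open>n + 2\<close> is at least 2 even for the empty host graph, so any
  constant of the program fits into a word of suitable exponent.\<close>

lemma nat_le_word_bound: "int k \<le> word_bound k n"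
proof -
  have "int k \<le> 2 ^ k" by (metis less_exp of_nat_less_iff of_nat_numeral of_nat_power order_less_imp_le)
  also have "\<dots> \<le> word_bound k n" unfolding word_bound_def by (rule power_mono) auto
  finally show ?thesis .
qed

lemma runs_within_mono:
  assumes "runs_within W P s T Q" "W \<le> W'" "T \<le> T'" "\<And>t. Q t \<Longrightarrow> R t"
  shows "runs_within W' P s T' R"
  using assms unfolding runs_within_def by (meson exec_mono_bound order_trans)

lemma runs_within_Seq:
  assumes "runs_within W P s T (\<lambda>s'. runs_within W Q s' U R)"
  shows "runs_within W (Seq P Q) s (T + U) R"
proof -
  from assms obtain k s' l t where "exec W P s k s'" "real k \<le> T" "exec W Q s' l t" "real l \<le> U" "R t"
    unfolding runs_within_def by blast
  then show ?thesis unfolding runs_within_def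
    by (intro exI[of _ "k + l"] exI[of _ t]) (auto intro: exec.Seq)
qed

section \<open>Program stages that can be chained within the time bound\<close>

definition graph_on :: "nat \<Rightarrow> nat pair_pre_digraph \<Rightarrow> bool" where
  "graph_on n G \<longleftrightarrow> pair_graph G \<and> pverts G = {0..<n}"

definition ready :: "nat \<Rightarrow> nat pair_pre_digraph \<Rightarrow> nat \<Rightarrow> ram_state \<Rightarrow> bool" where
  "ready n G m s \<longleftrightarrow> regs s 0 = int n \<and> arrs s 0 = matrix_array n (adjacency_matrix n G) \<and>
     (\<forall>r\<ge>m. regs s r = 0 \<and> arrs s r = (\<lambda>_. 0))"

type_synonym assertion = "nat \<Rightarrow> nat pair_pre_digraph \<Rightarrow> ram_state \<Rightarrow> bool"

text \<open>
  A stage from \<open>m\<close> to \<open>m'\<close> preserves everything below \<open>m\<close>, in particular the input, and keeps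
  everything from \<open>m'\<close> on clear for later stages.
\<close>

definition stage :: "real \<Rightarrow> nat \<Rightarrow> nat \<Rightarrow> assertion \<Rightarrow> prog \<Rightarrow> assertion \<Rightarrow> bool" where
  "stage \<omega> m m' A P B \<longleftrightarrow> 0 < m \<and> m \<le> m' \<and>
     (\<exists>c C. \<forall>n G s. graph_on n G \<longrightarrow> ready n G m s \<longrightarrow> A n G s \<longrightarrow>
        runs_within (word_bound c n) P s (C * real (max 1 n) powr \<omega>)
          (\<lambda>t. agree_below m s t \<and> ready n G m' t \<and> B n G t))"

lemma stage_mono:
  assumes "stage \<omega> m m' A P B"
    and "\<And>n G s. A' n G s \<Longrightarrow> A n G s" "\<And>n G s. B n G s \<Longrightarrow> B' n G s"
  shows "stage \<omega> m m' A' P B'"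
proof -
  from assms(1) obtain c C where *: "0 < m" "m \<le> m'" and
    run: "\<And>n G s. graph_on n G \<Longrightarrow> ready n G m s \<Longrightarrow> A n G s \<Longrightarrow>
      runs_within (word_bound c n) P s (C * real (max 1 n) powr \<omega>)
        (\<lambda>t. agree_below m s t \<and> ready n G m' t \<and> B n G t)"
    unfolding stage_def by blast
  show ?thesis unfolding stage_def
  proof (intro conjI * exI[of _ c] exI[of _ C] allI impI)
    fix n G s assume "graph_on n G" "ready n G m s" "A' n G s"
    then show "runs_within (word_bound c n) P s (C * real (max 1 n) powr \<omega>)
        (\<lambda>t. agree_below m s t \<and> ready n G m' t \<and> B' n G t)"
      using assms(2,3) by (intro runs_within_mono[OF run]) auto
  qed
qed

lemma stage_Seq:
  assumes "stage \<omega> m m' A P B" "stage \<omega> m' m'' B Q D"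
  shows "stage \<omega> m m'' A (Seq P Q) D"
proof -
  from assms(1) obtain c C where 1: "0 < m" "m \<le> m'" and
    run1: "\<And>n G s. graph_on n G \<Longrightarrow> ready n G m s \<Longrightarrow> A n G s \<Longrightarrow>
      runs_within (word_bound c n) P s (C * real (max 1 n) powr \<omega>)
        (\<lambda>t. agree_below m s t \<and> ready n G m' t \<and> B n G t)"
    unfolding stage_def by blast
  from assms(2) obtain c' C' where 2: "m' \<le> m''" and
    run2: "\<And>n G s. graph_on n G \<Longrightarrow> ready n G m' s \<Longrightarrow> B n G s \<Longrightarrow>
      runs_within (word_bound c' n) Q s (C' * real (max 1 n) powr \<omega>)
        (\<lambda>t. agree_below m' s t \<and> ready n G m'' t \<and> D n G t)"
    unfolding stage_def by blast
  show ?thesis unfolding stage_def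
  proof (intro conjI exI[of _ "max c c'"] exI[of _ "C + C'"] allI impI)
    fix n G s assume s: "graph_on n G" "ready n G m s" "A n G s"
    have "runs_within (word_bound (max c c') n) P s (C * real (max 1 n) powr \<omega>)
        (\<lambda>u. runs_within (word_bound (max c c') n) Q u (C' * real (max 1 n) powr \<omega>)
          (\<lambda>t. agree_below m s t \<and> ready n G m'' t \<and> D n G t))"
    proof (rule runs_within_mono[OF run1[OF s] word_bound_mono order_refl], simp)
      fix u assume "agree_below m s u \<and> ready n G m' u \<and> B n G u"
      then show "runs_within (word_bound (max c c') n) Q u (C' * real (max 1 n) powr \<omega>)
          (\<lambda>t. agree_below m s t \<and> ready n G m'' t \<and> D n G t)"
        using s(1) agree_below_trans[OF _ _ 1(2)]
        by (intro runs_within_mono[OF run2 word_bound_mono order_refl]) (blast | simp)+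
    qed
    from runs_within_Seq[OF this]
    show "runs_within (word_bound (max c c') n) (Seq P Q) s ((C + C') * real (max 1 n) powr \<omega>)
          (\<lambda>t. agree_below m s t \<and> ready n G m'' t \<and> D n G t)"
      by (simp add: distrib_right)
  qed (use 1 2 in auto)
qed

text \<open>The assertions \<open>D\<close> that survive are those that read only below
  \<open>m\<close>; typically they record results of earlier stages.\<close>

lemma stage_frame:
  assumes "stage \<omega> m m' A P B" and "\<And>n G s t. D n G s \<Longrightarrow> agree_below m s t \<Longrightarrow> D n G t"
  shows "stage \<omega> m m' (\<lambda>n G s. A n G s \<and> D n G s) P (\<lambda>n G s. B n G s \<and> D n G s)"
proof -
  from assms(1) obtain c C where *: "0 < m" "m \<le> m'" and
    run: "\<And>n G s. graph_on n G \<Longrightarrow> ready n G m s \<Longrightarrow> A n G s \<Longrightarrow>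
      runs_within (word_bound c n) P s (C * real (max 1 n) powr \<omega>)
        (\<lambda>t. agree_below m s t \<and> ready n G m' t \<and> B n G t)"
    unfolding stage_def by blast
  show ?thesis unfolding stage_def
  proof (intro conjI * exI[of _ c] exI[of _ C] allI impI)
    fix n G s assume "graph_on n G" "ready n G m s" "A n G s \<and> D n G s"
    then show "runs_within (word_bound c n) P s (C * real (max 1 n) powr \<omega>)
        (\<lambda>t. agree_below m s t \<and> ready n G m' t \<and> B n G t \<and> D n G t)"
      using assms(2) by (intro runs_within_mono[OF run]) auto
  qed
qed

text \<open>Quadratic work is absorbed here because \<omega> is at least 2. The factor 2 pays for
  the summand 1 in \<open>n * n + 1\<close>, and \<open>max 1 n\<close> covers \<open>n = 0\<close>,
  where steps are still spent.\<close>

lemma runs_within_if_halts: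
  assumes "halts_within W P s (K * (n * n + 1)) Q" "2 \<le> \<omega>"
  shows "runs_within W P s (2 * real K * real (max 1 n) powr \<omega>) Q"
proof -
  obtain k t where k: "k \<le> K * (n * n + 1)" and t: "exec W P s k t" "Q t"
    using assms(1) unfolding halts_within_def by blast
  have "real n * real n \<le> real (max 1 n) * real (max 1 n)" "1 * 1 \<le> real (max 1 n) * real (max 1 n)"
    by (rule mult_mono; simp)+
  then have "real n * real n + 1 \<le> 2 * (real (max 1 n) * real (max 1 n))" by linarith
  also have "real (max 1 n) * real (max 1 n) = real (max 1 n) powr 2"
    by (simp add: power2_eq_square)
  also have "real (max 1 n) powr 2 \<le> real (max 1 n) powr \<omega>"
    using assms(2) by (intro powr_mono) auto
  finally have "real n * real n + 1 \<le> 2 * real (max 1 n) powr \<omega>" by simp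
  from mult_left_mono[OF this, of "real K"]
  have "real K * (real n * real n + 1) \<le> 2 * real K * real (max 1 n) powr \<omega>" by simp
  moreover have "real k \<le> real K * (real n * real n + 1)"
    using k by (metis of_nat_1 of_nat_add of_nat_le_iff of_nat_mult)
  ultimately show ?thesis
    unfolding runs_within_def using t by (intro exI[of _ k] exI[of _ t]) linarith
qed

lemma stage_if_halts:
  assumes "2 \<le> \<omega>" "0 < m" "m \<le> m'"
    and "\<And>n G s. graph_on n G \<Longrightarrow> ready n G m s \<Longrightarrow> A n G s \<Longrightarrow>
      halts_within (word_bound c n) P s (K * (n * n + 1))
        (\<lambda>t. agree_below m s t \<and> ready n G m' t \<and> B n G t)"
  shows "stage \<omega> m m' A P B"
  unfolding stage_def
  by (intro conjI assms exI[of _ c] exI[of _ "2 * real K"] allI impI runs_within_if_halts)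

text \<open>Cells outside the matrix are left free, in contrast to \<open>matrix_array\<close>,
  which demands zeros there.\<close>

definition holds_matrix :: "nat \<Rightarrow> (nat \<Rightarrow> nat \<Rightarrow> int) \<Rightarrow> (int \<Rightarrow> int) \<Rightarrow> bool" where
  "holds_matrix n X arr \<longleftrightarrow> (\<forall>i<n. \<forall>j<n. arr (int (i * n + j)) = X i j)"

text \<open>Quantifying over every start \<open>m\<close> lets the computation be appended to any
  other one. The bound \<open>n ^ d\<close> has the form in which \<open>matmul_exponent\<close>
  expects its entries.\<close>

definition computable_matrix ::
    "real \<Rightarrow> (nat \<Rightarrow> nat pair_pre_digraph \<Rightarrow> nat \<Rightarrow> nat \<Rightarrow> int) \<Rightarrow> bool" where
  "computable_matrix \<omega> X \<longleftrightarrow>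
     (\<exists>d. \<forall>n G. graph_on n G \<longrightarrow> (\<forall>i<n. \<forall>j<n. \<bar>X n G i j\<bar> \<le> int n ^ d)) \<and>
     (\<forall>m>0. \<exists>m' a P. a < m' \<and>
        stage \<omega> m m' (\<lambda>_ _ _. True) P (\<lambda>n G t. holds_matrix n (X n G) (arrs t a)))"

text \<open>Here the bound is a \<open>word_bound\<close> instead of \<open>n ^ d\<close>: scalars
  include signs and constants, which for \<open>n \<le> 1\<close> may exceed every power of
  \<open>n\<close>.\<close>

definition computable_scalar :: "real \<Rightarrow> (nat \<Rightarrow> nat pair_pre_digraph \<Rightarrow> int) \<Rightarrow> bool" where
  "computable_scalar \<omega> x \<longleftrightarrow>
     (\<exists>d. \<forall>n G. graph_on n G \<longrightarrow> \<bar>x n G\<bar> \<le> word_bound d n) \<and>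
     (\<forall>m>0. \<exists>m' r P. r < m' \<and>
        stage \<omega> m m' (\<lambda>_ _ _. True) P (\<lambda>n G t. regs t r = x n G))"

section \<open>Filling a table entry by entry\<close>

lemma div_mod_less_square:
  fixes p n :: nat
  assumes "p < n * n"
  shows "p div n < n" "p mod n < n" "p div n * n + p mod n = p" "0 < n"
proof -
  show "0 < n" using assms by (cases n) simp_all
  then show "p mod n < n" by simp
  show "p div n < n" by (rule less_mult_imp_div_less) (rule assms)
  show "p div n * n + p mod n = p" by (rule div_mult_mod_eq)
qed

lemma index_less_square:
  fixes i j n :: nat
  assumes "i < n" "j < n"
  shows "i * n + j < n * n"
proof -
  have "i * n + j < Suc i * n" using assms by simp
  also have "Suc i * n \<le> n * n" using assms by (intro mult_le_mono1) simp
  finally show ?thesis .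
qed

lemma holds_matrix_array: "holds_matrix n X (matrix_array n (mat n n (\<lambda>(i, j). X i j)))"
  unfolding holds_matrix_def
proof (intro allI impI)
  fix i j assume ij: "i < n" "j < n"
  have "int (i * n + j) < int (n * n)" using index_less_square[OF ij] by (simp only: of_nat_less_iff)
  moreover have "(i * n + j) div n = i" "(i * n + j) mod n = j" using ij by simp_all
  ultimately show "matrix_array n (mat n n (\<lambda>(i, j). X i j)) (int (i * n + j)) = X i j"
    using ij by (simp add: matrix_array_def del: of_nat_add of_nat_mult)
qed

text \<open>
  The body \<open>V\<close> finds the position in register \<open>m + 2\<close>, row and column in \<open>m + 3\<close> and \<open>m + 4\<close>, and
  leaves the entry in \<open>m + 5\<close>.
\<close>

definition tabulate :: "nat \<Rightarrow> prog \<Rightarrow> array \<Rightarrow> prog" where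
  "tabulate m V c =
     Seq (Const (m + 1) 1) (Seq (Arith m Times 0 0) (WhilePos m
       (Seq (Arith (m + 2) Minus m (m + 1)) (Seq (Arith (m + 3) Quotient (m + 2) 0)
       (Seq (Arith (m + 4) Remainder (m + 2) 0) (Seq V
       (Seq (Store c (m + 2) (m + 5)) (Arith m Minus m (m + 1)))))))))"

text \<open>The entry code may overwrite only registers \<open>m + 5\<close> to
  \<open>m + 8\<close>, so the loop counter and the indices survive. It may rely on everything in
  \<open>s0\<close> except array \<open>c\<close>, which is partly filled when the code
  runs.\<close>

definition computes_entry ::
    "int \<Rightarrow> nat \<Rightarrow> nat \<Rightarrow> array \<Rightarrow> ram_state \<Rightarrow> prog \<Rightarrow> nat \<Rightarrow> (nat \<Rightarrow> nat \<Rightarrow> int) \<Rightarrow> bool" where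
  "computes_entry W n m c s0 V K f \<longleftrightarrow> (\<forall>i<n. \<forall>j<n. \<forall>s.
     regs s (m + 2) = int (i * n + j) \<and> regs s (m + 3) = int i \<and> regs s (m + 4) = int j \<and>
     (\<forall>r. r \<notin> {m..<m + 9} \<longrightarrow> regs s r = regs s0 r) \<and> (\<forall>a. a \<noteq> c \<longrightarrow> arrs s a = arrs s0 a) \<longrightarrow>
     halts_within W V s K (\<lambda>t. regs t (m + 5) = f i j \<and> arrs t = arrs s \<and>
       (\<forall>r. r \<notin> {m + 5..<m + 9} \<longrightarrow> regs t r = regs s r)))"

lemma tabulate:
  assumes V: "computes_entry W n m c s0 V K f"
    and m: "0 < m" and s0: "regs s0 0 = int n" "arrs s0 c = (\<lambda>_. 0)"
    and W: "1 \<le> W" "int n * int n \<le> W"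
  shows "halts_within W (tabulate m V c) s0 ((K + 8) * (n * n + 1))
    (\<lambda>t. (\<forall>r. r \<notin> {m..<m + 9} \<longrightarrow> regs t r = regs s0 r) \<and> (\<forall>a. a \<noteq> c \<longrightarrow> arrs t a = arrs s0 a) \<and>
      arrs t c = matrix_array n (mat n n (\<lambda>(i, j). f i j)))"
proof -
  \<comment> \<open>The table is filled from its last position downwards: with \<open>p\<close>
    passes left, exactly the positions from \<open>p\<close> on carry their entries. Counting down
    suits the test for positivity.\<close>
  define I where "I p s \<longleftrightarrow> p \<le> n * n \<and> regs s m = int p \<and> regs s (m + 1) = 1 \<and>
      (\<forall>r. r \<notin> {m..<m + 9} \<longrightarrow> regs s r = regs s0 r) \<and> (\<forall>a. a \<noteq> c \<longrightarrow> arrs s a = arrs s0 a) \<and>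
      arrs s c = (\<lambda>x. if int p \<le> x \<and> x < int (n * n) then f (nat x div n) (nat x mod n) else 0)"
    for p and s :: ram_state
  let ?body = "Seq (Arith (m + 2) Minus m (m + 1)) (Seq (Arith (m + 3) Quotient (m + 2) 0)
       (Seq (Arith (m + 4) Remainder (m + 2) 0) (Seq V
       (Seq (Store c (m + 2) (m + 5)) (Arith m Minus m (m + 1))))))"
  have step: "0 < regs s m \<and> halts_within W ?body s (1 + (1 + (1 + (K + (1 + 1))))) (I p)"
    if "I (Suc p) s" for p s
  proof
    from that have s: "Suc p \<le> n * n" "regs s m = int (Suc p)" "regs s (m + 1) = 1"
        "\<And>r. r \<notin> {m..<m + 9} \<Longrightarrow> regs s r = regs s0 r" "\<And>a. a \<noteq> c \<Longrightarrow> arrs s a = arrs s0 a"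
        "arrs s c = (\<lambda>x. if int (Suc p) \<le> x \<and> x < int (n * n) then f (nat x div n) (nat x mod n) else 0)"
      unfolding I_def by blast+
    then show "0 < regs s m" by simp
    have p: "p < n * n" using s(1) by simp
    note ij = div_mod_less_square[OF p]
    have n: "regs s 0 = int n" using s(4)[of 0] m s0 by simp
    have pn: "int p < int n * int n" using p by (metis of_nat_less_iff of_nat_mult)
    then have pW: "int p < W" using W(2) by linarith
    have "int (p div n) \<le> int p" "int (p mod n) \<le> int p" by simp_all
    then have iW: "int p div int n \<le> W" and jW: "int p mod int n \<le> W"
      using pW unfolding zdiv_int zmod_int by linarith+
    have nn: "0 \<le> int p div int n" "0 \<le> int p mod int n"
      using ij(4) by (auto simp: pos_imp_zdiv_nonneg_iff)
    define s1 where "s1 = s\<lparr>regs := (regs s)(m + 2 := int p)\<rparr>"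
    define s2 where "s2 = s1\<lparr>regs := (regs s1)(m + 3 := int (p div n))\<rparr>"
    define s3 where "s3 = s2\<lparr>regs := (regs s2)(m + 4 := int (p mod n))\<rparr>"
    have V': "halts_within W V s3 K (\<lambda>t. regs t (m + 5) = f (p div n) (p mod n) \<and> arrs t = arrs s3 \<and>
       (\<forall>r. r \<notin> {m + 5..<m + 9} \<longrightarrow> regs t r = regs s3 r))"
      by (rule V[unfolded computes_entry_def, rule_format])
        (use ij s in \<open>auto simp: s1_def s2_def s3_def\<close>)
    have last: "halts_within W (Seq (Store c (m + 2) (m + 5)) (Arith m Minus m (m + 1))) t (1 + 1) (I p)"
      if t: "regs t (m + 5) = f (p div n) (p mod n) \<and> arrs t = arrs s3 \<and>
       (\<forall>r. r \<notin> {m + 5..<m + 9} \<longrightarrow> regs t r = regs s3 r)" for t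
    proof -
      have t': "regs t (m + 2) = int p" "regs t m = int (Suc p)" "regs t (m + 1) = 1"
          "\<And>r. r \<notin> {m..<m + 9} \<Longrightarrow> regs t r = regs s0 r" "arrs t = arrs s"
        using t s by (auto simp: s1_def s2_def s3_def)
      show ?thesis
        using t conjunct1[OF t] t' s p pn pW
        by (intro halts_within_Seq halts_within_Store halts_within_Arith)
          (auto simp: I_def fun_eq_iff)
    qed
    have "halts_within W V s3 K
        (\<lambda>t. halts_within W (Seq (Store c (m + 2) (m + 5)) (Arith m Minus m (m + 1))) t (1 + 1) (I p))"
      by (rule halts_within_mono[OF V' order_refl last])
    then show "halts_within W ?body s (1 + (1 + (1 + (K + (1 + 1))))) (I p)"
      using s n pW iW jW nn ij(4) m
      by (intro halts_within_Seq halts_within_Arith)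
        (auto simp: zdiv_int zmod_int s1_def s2_def s3_def)
  qed
  have stop: "\<not> 0 < regs s m" if "I 0 s" for s
    using that by (simp add: I_def)
  define s2 where "s2 = s0\<lparr>regs := (regs s0)(m + 1 := 1, m := int n * int n)\<rparr>"
  have init: "I (n * n) s2"
    using s0 by (auto simp: I_def s2_def fun_eq_iff)
  \<comment> \<open>Two initial instructions, then \<open>n * n\<close> passes of
    \<open>K + 5\<close> steps and one test each, then the failing test:
    \<open>n * n * (K + 6) + 3\<close> steps, which \<open>(K + 8) * (n * n + 1)\<close>
    dominates.\<close>
  have "halts_within W (tabulate m V c) s0 (1 + (1 + (n * n * ((1 + (1 + (1 + (K + (1 + 1))))) + 1) + 1))) (I 0)"
    unfolding tabulate_def
  proof (intro halts_within_Seq halts_within_Arith halts_within_Const)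
    let ?s = "s0\<lparr>regs := (regs s0)(m + 1 := 1)\<rparr>"
    show "\<bar>arith Times (regs ?s 0) (regs ?s 0)\<bar> \<le> W" using s0 W m by simp
    have "?s\<lparr>regs := (regs ?s)(m := arith Times (regs ?s 0) (regs ?s 0))\<rparr> = s2"
      using m s0 by (simp add: s2_def)
    then show "halts_within W (WhilePos m ?body) (?s\<lparr>regs := (regs ?s)(m := arith Times (regs ?s 0) (regs ?s 0))\<rparr>)
       (n * n * ((1 + (1 + (1 + (K + (1 + 1))))) + 1) + 1) (I 0)"
      using halts_within_WhilePos[of I "n * n" s2 m W ?body, OF init step stop] by metis
  qed (use W in auto)
  then show ?thesis
  proof (rule halts_within_mono)
    fix t assume "I 0 t"
    then have t: "\<forall>r. r \<notin> {m..<m + 9} \<longrightarrow> regs t r = regs s0 r" "\<forall>a. a \<noteq> c \<longrightarrow> arrs t a = arrs s0 a"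
      "arrs t c = (\<lambda>x. if 0 \<le> x \<and> x < int (n * n) then f (nat x div n) (nat x mod n) else 0)"
      by (auto simp: I_def)
    have "nat x div n < n" "nat x mod n < n" if "0 \<le> x" "x < int (n * n)" for x
      using div_mod_less_square[of "nat x" n] that by (simp_all add: nat_less_iff)
    then have "arrs t c = matrix_array n (mat n n (\<lambda>(i, j). f i j))"
      unfolding t(3) by (auto simp: matrix_array_def fun_eq_iff)
    with t(1,2) show "(\<forall>r. r \<notin> {m..<m + 9} \<longrightarrow> regs t r = regs s0 r) \<and>
        (\<forall>a. a \<noteq> c \<longrightarrow> arrs t a = arrs s0 a) \<and>
        arrs t c = matrix_array n (mat n n (\<lambda>(i, j). f i j))" by blast
  qed (simp add: algebra_simps)
qed

text \<open>Registers \<open>m\<close> to \<open>m + 8\<close> become scratch and array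
  \<open>m + 9\<close> holds the table, so \<open>m + 10\<close> is the first clear index.\<close>

lemma stage_tabulate:
  assumes "2 \<le> \<omega>" "0 < m"
    and entry: "\<And>n G s W. graph_on n G \<Longrightarrow> ready n G m s \<Longrightarrow> A n G s \<Longrightarrow>
      word_bound c n \<le> W \<Longrightarrow> int n * int n \<le> W \<Longrightarrow> computes_entry W n m (m + 9) s V K (f n G)"
  shows "stage \<omega> m (m + 10) A (tabulate m V (m + 9)) (\<lambda>n G t. holds_matrix n (f n G) (arrs t (m + 9)))"
proof (rule stage_if_halts[OF assms(1,2), where c = "max c 2" and K = "K + 8"])
  fix n G s assume s: "graph_on n G" "ready n G m s" "A n G s"
  let ?W = "word_bound (max c 2) n"
  have W: "word_bound c n \<le> ?W" "int n * int n \<le> ?W" "1 \<le> ?W"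
    by (simp_all add: word_bound_mono square_le_word_bound word_bound_ge_1)
  have s': "regs s 0 = int n" "arrs s (m + 9) = (\<lambda>_. 0)"
    using s(2) by (simp_all add: ready_def)
  show "halts_within ?W (tabulate m V (m + 9)) s ((K + 8) * (n * n + 1))
      (\<lambda>t. agree_below m s t \<and> ready n G (m + 10) t \<and> holds_matrix n (f n G) (arrs t (m + 9)))"
  proof (rule halts_within_mono[OF tabulate[OF entry[OF s W(1,2)] assms(2) s' W(3,2)] order_refl])
    fix t :: ram_state assume t: "(\<forall>r. r \<notin> {m..<m + 9} \<longrightarrow> regs t r = regs s r) \<and>
         (\<forall>a. a \<noteq> m + 9 \<longrightarrow> arrs t a = arrs s a) \<and>
         arrs t (m + 9) = matrix_array n (mat n n (\<lambda>(i, j). f n G i j))"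
    then have "agree_below m s t" by (auto intro: agree_belowI)
    moreover have "ready n G (m + 10) t"
      using t s(2) assms(2) unfolding ready_def by (auto simp: Suc_le_eq)
    ultimately show "agree_below m s t \<and> ready n G (m + 10) t \<and> holds_matrix n (f n G) (arrs t (m + 9))"
      using t holds_matrix_array by simp
  qed
qed simp

text \<open>The four choices of \<open>p\<close> and \<open>q\<close> give a copy, the transpose,
  and the diagonal spread along rows or along columns.\<close>

definition select_entry :: "nat \<Rightarrow> array \<Rightarrow> bool \<Rightarrow> bool \<Rightarrow> prog" where
  "select_entry m a p q =
     Seq (Arith (m + 6) Times (if p then m + 3 else m + 4) 0)
       (Seq (Arith (m + 6) Plus (m + 6) (if q then m + 3 else m + 4)) (Load (m + 5) a (m + 6)))"

lemma index_le_bound: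
  fixes i j n :: nat
  assumes "i < n" "j < n" "int n * int n \<le> W"
  shows "int i * int n \<le> W" "int i * int n + int j \<le> W"
proof -
  have "int (i * n + j) < int (n * n)"
    using index_less_square[OF assms(1,2)] by (simp only: of_nat_less_iff)
  then show "int i * int n + int j \<le> W" using assms(3) by simp
  then show "int i * int n \<le> W" by simp
qed

lemma computes_entry_select:
  assumes "holds_matrix n X (arrs s a)" "a \<noteq> c" "regs s 0 = int n" "0 < m"
    and "\<And>i j. i < n \<Longrightarrow> j < n \<Longrightarrow> \<bar>X i j\<bar> \<le> W" "int n * int n \<le> W"
  shows "computes_entry W n m c s (select_entry m a p q) (1 + (1 + 1))
    (\<lambda>i j. X (if p then i else j) (if q then i else j))"
  unfolding computes_entry_def
proof (intro allI impI)
  fix i j and u :: ram_state assume ij: "i < n" "j < n"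
    and u: "regs u (m + 2) = int (i * n + j) \<and> regs u (m + 3) = int i \<and> regs u (m + 4) = int j \<and>
     (\<forall>r. r \<notin> {m..<m + 9} \<longrightarrow> regs u r = regs s r) \<and> (\<forall>a. a \<noteq> c \<longrightarrow> arrs u a = arrs s a)"
  define i' where "i' = (if p then i else j)"
  define j' where "j' = (if q then i else j)"
  have ij': "i' < n" "j' < n" using ij by (simp_all add: i'_def j'_def)
  have "arrs u a (int i' * int n + int j') = X i' j'"
    using assms(1,2) u ij' by (simp add: holds_matrix_def)
  moreover have "regs u 0 = int n" using u assms by simp
  moreover define ri rj where "ri = (if p then m + 3 else m + 4)" and "rj = (if q then m + 3 else m + 4)"
  moreover have "regs u ri = int i'" "regs u rj = int j'" "rj \<noteq> m + 6"
    using u by (simp_all add: i'_def j'_def ri_def rj_def)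
  ultimately show "halts_within W (select_entry m a p q) u (1 + (1 + 1))
      (\<lambda>t. regs t (m + 5) = X (if p then i else j) (if q then i else j) \<and> arrs t = arrs u \<and>
       (\<forall>r. r \<notin> {m + 5..<m + 9} \<longrightarrow> regs t r = regs u r))"
    unfolding select_entry_def i'_def[symmetric] j'_def[symmetric] ri_def[symmetric] rj_def[symmetric]
    using assms(4) assms(5)[OF ij'] index_le_bound[OF ij' assms(6)]
    by (intro halts_within_Seq halts_within_Arith halts_within_Load) simp_all
qed

lemma computable_matrix_bound:
  assumes "computable_matrix \<omega> X"
  obtains d where "\<forall>n G i j. graph_on n G \<longrightarrow> i < n \<longrightarrow> j < n \<longrightarrow> \<bar>X n G i j\<bar> \<le> int n ^ d"
proof -
  from assms have "\<exists>d. \<forall>n G. graph_on n G \<longrightarrow> (\<forall>i<n. \<forall>j<n. \<bar>X n G i j\<bar> \<le> int n ^ d)"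
    unfolding computable_matrix_def by (rule conjunct1)
  then obtain d where d: "\<forall>n G. graph_on n G \<longrightarrow> (\<forall>i<n. \<forall>j<n. \<bar>X n G i j\<bar> \<le> int n ^ d)" ..
  show thesis by (rule that[of d]) (use d in simp)
qed

lemma computable_matrix_stage:
  assumes "computable_matrix \<omega> X" "0 < m"
  obtains m' a P where "a < m'"
    "stage \<omega> m m' (\<lambda>_ _ _. True) P (\<lambda>n G t. holds_matrix n (X n G) (arrs t a))"
proof -
  from assms have "\<exists>m' a P. a < m' \<and>
      stage \<omega> m m' (\<lambda>_ _ _. True) P (\<lambda>n G t. holds_matrix n (X n G) (arrs t a))"
    unfolding computable_matrix_def by simp
  then show thesis using that by (elim exE conjE)
qed

lemma computable_matrix_select:
  assumes "computable_matrix \<omega> X" "2 \<le> \<omega>"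
  shows "computable_matrix \<omega> (\<lambda>n G i j. X n G (if p then i else j) (if q then i else j))"
proof -
  obtain d where "\<forall>n G i j. graph_on n G \<longrightarrow> i < n \<longrightarrow> j < n \<longrightarrow> \<bar>X n G i j\<bar> \<le> int n ^ d"
    using assms(1) by (rule computable_matrix_bound)
  note d = this[rule_format]
  show ?thesis unfolding computable_matrix_def
  proof (intro conjI allI impI)
    fix m :: nat assume "0 < m"
    with assms(1) obtain m' a P where P: "a < m'"
      "stage \<omega> m m' (\<lambda>_ _ _. True) P (\<lambda>n G t. holds_matrix n (X n G) (arrs t a))"
      by (rule computable_matrix_stage)
    then have m': "0 < m'" by simp
    have "stage \<omega> m' (m' + 10) (\<lambda>n G t. holds_matrix n (X n G) (arrs t a))
        (tabulate m' (select_entry m' a p q) (m' + 9))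
        (\<lambda>n G t. holds_matrix n (\<lambda>i j. X n G (if p then i else j) (if q then i else j)) (arrs t (m' + 9)))"
    proof (rule stage_tabulate[OF assms(2) m', where c = d])
      fix n G s W
      assume s: "graph_on n G" "ready n G m' s" "holds_matrix n (X n G) (arrs s a)"
        and W: "word_bound d n \<le> W" "int n * int n \<le> W"
      have "\<bar>X n G i j\<bar> \<le> W" if "i < n" "j < n" for i j
        using d[OF s(1) that] int_power_le_word_bound[of n d] W(1) by linarith
      then show "computes_entry W n m' (m' + 9) s (select_entry m' a p q) (1 + (1 + 1))
          (\<lambda>i j. X n G (if p then i else j) (if q then i else j))"
        using s m' P(1) W(2) by (intro computes_entry_select) (auto simp: ready_def)
    qed
    from stage_Seq[OF P(2) this] show "\<exists>m'' a P. a < m'' \<and>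
        stage \<omega> m m'' (\<lambda>_ _ _. True) P (\<lambda>n G t. holds_matrix n
          (\<lambda>i j. X n G (if p then i else j) (if q then i else j)) (arrs t a))"
      by (intro exI[of _ "m' + 10"] exI[of _ "m' + 9"]) auto
  qed (intro exI[of _ d], use d in simp)
qed

lemma computable_matrix_const:
  assumes "2 \<le> \<omega>"
  shows "computable_matrix \<omega> (\<lambda>n G i j. 1)"
  unfolding computable_matrix_def
proof (intro conjI allI impI)
  fix m :: nat assume m: "0 < m"
  have "stage \<omega> m (m + 10) (\<lambda>_ _ _. True) (tabulate m (Const (m + 5) 1) (m + 9))
      (\<lambda>n G t. holds_matrix n (\<lambda>i j. 1) (arrs t (m + 9)))"
  proof (rule stage_tabulate[OF assms m, where c = 0 and K = 1])
    fix n W and s :: ram_state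
    assume "word_bound 0 n \<le> W"
    then have "1 \<le> W" by (simp add: word_bound_def)
    then show "computes_entry W n m (m + 9) s (Const (m + 5) 1) 1 (\<lambda>i j. 1)"
      unfolding computes_entry_def by (auto intro!: halts_within_Const simp del: One_nat_def)
  qed
  then show "\<exists>m' a P. a < m' \<and> stage \<omega> m m' (\<lambda>_ _ _. True) P
      (\<lambda>n G t. holds_matrix n (\<lambda>i j. 1) (arrs t a))"
    by (intro exI[of _ "m + 10"] exI[of _ "m + 9"]) auto
qed (auto intro!: exI[of _ 0])

lemma computable_matrix_adjacency:
  assumes "2 \<le> \<omega>"
  shows "computable_matrix \<omega> (\<lambda>n G i j. if (i, j) \<in> parcs G then 1 else 0)"
  unfolding computable_matrix_def
proof (intro conjI allI impI)
  fix m :: nat assume m: "0 < m"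
  have "stage \<omega> m m (\<lambda>_ _ _. True) Skip
      (\<lambda>n G t. holds_matrix n (\<lambda>i j. if (i, j) \<in> parcs G then 1 else 0) (arrs t 0))"
  proof (rule stage_if_halts[OF assms m order_refl, where c = 0 and K = 1])
    fix n G s assume "ready n G m s"
    then have "agree_below m s s \<and> ready n G m s \<and>
        holds_matrix n (\<lambda>i j. if (i, j) \<in> parcs G then 1 else 0) (arrs s 0)"
      using holds_matrix_array[of n "\<lambda>i j. if (i, j) \<in> parcs G then 1 else 0"]
      by (simp add: ready_def adjacency_matrix_def)
    then show "halts_within (word_bound 0 n) Skip s (1 * (n * n + 1)) (\<lambda>t. agree_below m s t \<and>
        ready n G m t \<and> holds_matrix n (\<lambda>i j. if (i, j) \<in> parcs G then 1 else 0) (arrs t 0))"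
      unfolding halts_within_def by (intro exI[of _ 1] conjI exI[of _ s] exec.Skip) auto
  qed
  then show "\<exists>m' a P. a < m' \<and> stage \<omega> m m' (\<lambda>_ _ _. True) P
      (\<lambda>n G t. holds_matrix n (\<lambda>i j. if (i, j) \<in> parcs G then 1 else 0) (arrs t a))"
    using m by blast
qed (auto intro!: exI[of _ 0])

text \<open>The second computation starts above everything the first one used, so the first result
  persists by framing.\<close>

lemma stage_two_matrices:
  assumes "computable_matrix \<omega> X" "computable_matrix \<omega> Y" "0 < m"
  obtains m' a b P where "a < m'" "b < m'" "stage \<omega> m m' (\<lambda>_ _ _. True) P
    (\<lambda>n G t. holds_matrix n (X n G) (arrs t a) \<and> holds_matrix n (Y n G) (arrs t b))"
proof -
  obtain m' a P where P: "a < m'"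
    "stage \<omega> m m' (\<lambda>_ _ _. True) P (\<lambda>n G t. holds_matrix n (X n G) (arrs t a))"
    using assms(1,3) by (rule computable_matrix_stage)
  then have "0 < m'" by simp
  with assms(2) obtain m'' b Q where Q: "b < m''"
    "stage \<omega> m' m'' (\<lambda>_ _ _. True) Q (\<lambda>n G t. holds_matrix n (Y n G) (arrs t b))"
    by (rule computable_matrix_stage)
  have "stage \<omega> m' m'' (\<lambda>n G t. True \<and> holds_matrix n (X n G) (arrs t a)) Q
    (\<lambda>n G t. holds_matrix n (Y n G) (arrs t b) \<and> holds_matrix n (X n G) (arrs t a))"
    using P(1) by (intro stage_frame[OF Q(2)]) (simp add: agree_below_arrs)
  then have "stage \<omega> m' m'' (\<lambda>n G t. holds_matrix n (X n G) (arrs t a)) Q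
    (\<lambda>n G t. holds_matrix n (X n G) (arrs t a) \<and> holds_matrix n (Y n G) (arrs t b))"
    by (rule stage_mono) blast+
  from stage_Seq[OF P(2) this] have "stage \<omega> m m'' (\<lambda>_ _ _. True) (Seq P Q)
    (\<lambda>n G t. holds_matrix n (X n G) (arrs t a) \<and> holds_matrix n (Y n G) (arrs t b))" .
  moreover have "m' \<le> m''" using Q(2) unfolding stage_def by blast
  ultimately show thesis using that P(1) Q(1) by (meson less_le_trans)
qed

lemma computable_matrix_mult_entries:
  assumes "computable_matrix \<omega> X" "computable_matrix \<omega> Y" "2 \<le> \<omega>"
  shows "computable_matrix \<omega> (\<lambda>n G i j. X n G i j * Y n G i j)"
proof -
  obtain d where "\<forall>n G i j. graph_on n G \<longrightarrow> i < n \<longrightarrow> j < n \<longrightarrow> \<bar>X n G i j\<bar> \<le> int n ^ d"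
    using assms(1) by (rule computable_matrix_bound)
  note d = this[rule_format]
  obtain e where "\<forall>n G i j. graph_on n G \<longrightarrow> i < n \<longrightarrow> j < n \<longrightarrow> \<bar>Y n G i j\<bar> \<le> int n ^ e"
    using assms(2) by (rule computable_matrix_bound)
  note e = this[rule_format]
  have de: "\<bar>X n G i j * Y n G i j\<bar> \<le> int n ^ (d + e)" if "graph_on n G" "i < n" "j < n" for n G i j
    using mult_mono[OF d[OF that] e[OF that]] by (simp add: abs_mult power_add)
  show ?thesis unfolding computable_matrix_def
  proof (intro conjI allI impI)
    fix m :: nat assume "0 < m"
    then obtain m' a b P where P: "a < m'" "b < m'" "stage \<omega> m m' (\<lambda>_ _ _. True) P
        (\<lambda>n G t. holds_matrix n (X n G) (arrs t a) \<and> holds_matrix n (Y n G) (arrs t b))"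
      by (rule stage_two_matrices[OF assms(1,2)])
    then have m': "0 < m'" by simp
    let ?V = "Seq (Load (m' + 5) a (m' + 2)) (Seq (Load (m' + 6) b (m' + 2))
      (Arith (m' + 5) Times (m' + 5) (m' + 6)))"
    have "stage \<omega> m' (m' + 10)
        (\<lambda>n G t. holds_matrix n (X n G) (arrs t a) \<and> holds_matrix n (Y n G) (arrs t b))
        (tabulate m' ?V (m' + 9))
        (\<lambda>n G t. holds_matrix n (\<lambda>i j. X n G i j * Y n G i j) (arrs t (m' + 9)))"
    proof (rule stage_tabulate[OF assms(3) m', where c = "d + e" and K = "1 + (1 + 1)"])
      fix n G s W
      assume s: "graph_on n G" "ready n G m' s"
          "holds_matrix n (X n G) (arrs s a) \<and> holds_matrix n (Y n G) (arrs s b)"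
        and W: "word_bound (d + e) n \<le> W" "int n * int n \<le> W"
      have X: "\<bar>X n G i j\<bar> \<le> W" if "i < n" "j < n" for i j
        using d[OF s(1) that] int_power_le_word_bound[of n d] word_bound_mono[of d "d + e" n] W(1) by simp
      have Y: "\<bar>Y n G i j\<bar> \<le> W" if "i < n" "j < n" for i j
        using e[OF s(1) that] int_power_le_word_bound[of n e] word_bound_mono[of e "d + e" n] W(1) by simp
      have XY: "\<bar>X n G i j * Y n G i j\<bar> \<le> W" if "i < n" "j < n" for i j
        using de[OF s(1) that] int_power_le_word_bound[of n "d + e"] W(1) by linarith
      show "computes_entry W n m' (m' + 9) s ?V (1 + (1 + 1)) (\<lambda>i j. X n G i j * Y n G i j)"
        unfolding computes_entry_def
      proof (intro allI impI)
        fix i j and u :: ram_state assume ij: "i < n" "j < n"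
          and u: "regs u (m' + 2) = int (i * n + j) \<and> regs u (m' + 3) = int i \<and> regs u (m' + 4) = int j \<and>
           (\<forall>r. r \<notin> {m'..<m' + 9} \<longrightarrow> regs u r = regs s r) \<and>
           (\<forall>a. a \<noteq> m' + 9 \<longrightarrow> arrs u a = arrs s a)"
        have "arrs u a (int i * int n + int j) = X n G i j" "arrs u b (int i * int n + int j) = Y n G i j"
          using s(3) P(1,2) u ij by (simp_all add: holds_matrix_def)
        then show "halts_within W ?V u (1 + (1 + 1)) (\<lambda>t. regs t (m' + 5) = X n G i j * Y n G i j \<and>
           arrs t = arrs u \<and> (\<forall>r. r \<notin> {m' + 5..<m' + 9} \<longrightarrow> regs t r = regs u r))"
          using u X[OF ij] Y[OF ij] XY[OF ij]
          by (intro halts_within_Seq halts_within_Arith halts_within_Load) simp_all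
      qed
    qed
    from stage_Seq[OF P(3) this] show "\<exists>m'' a P. a < m'' \<and>
        stage \<omega> m m'' (\<lambda>_ _ _. True) P
          (\<lambda>n G t. holds_matrix n (\<lambda>i j. X n G i j * Y n G i j) (arrs t a))"
      by (intro exI[of _ "m' + 10"] exI[of _ "m' + 9"]) auto
  qed (intro exI[of _ "d + e"], use de in blast)
qed

section \<open>Matrix multiplication by relocated calls\<close>

lemma mat_mult_entry:
  assumes "i < n" "j < n"
  shows "(mat n n (\<lambda>(i, j). X i j) * mat n n (\<lambda>(i, j). Y i j)) $$ (i, j) = (\<Sum>k<n. X i k * Y k j)"
  using assms by (simp add: scalar_prod_def atLeast0LessThan)

text \<open>The operands are copied because the relocated program expects them in its arrays 0 and
  1, with zeros beyond the matrix and all else clear. Both copies use the scratch below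
  \<open>m + 9\<close>, so the block of the call stays clean. Adding the clear register
  \<open>m + 10\<close> serves as a move of \<open>n\<close>. Each copy costs
  \<open>3 + 8 = 11\<close> units of \<open>n * n + 1\<close>, and the move one step, hence
  23.\<close>

lemma matmul_prepare:
  assumes m: "0 < m" "a < m" "b < m" and s: "ready n G m s"
    and X: "holds_matrix n X (arrs s a)" "\<And>i j. i < n \<Longrightarrow> j < n \<Longrightarrow> \<bar>X i j\<bar> \<le> W"
    and Y: "holds_matrix n Y (arrs s b)" "\<And>i j. i < n \<Longrightarrow> j < n \<Longrightarrow> \<bar>Y i j\<bar> \<le> W"
    and W: "1 \<le> W" "int n * int n \<le> W"
  shows "halts_within W
    (Seq (tabulate m (select_entry m a True False) (m + 9))
      (Seq (tabulate m (select_entry m b True False) (m + 10))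
        (Arith (m + 9) Plus 0 (m + 10)))) s (23 * (n * n + 1))
    (\<lambda>t. agree_below m s t \<and>
      shifted_state (m + 9) (matmul_input n (mat n n (\<lambda>(i, j). X i j)) (mat n n (\<lambda>(i, j). Y i j))) t)"
    (is "halts_within W (Seq ?P (Seq ?Q ?R)) s _ ?post")
proof -
  let ?A = "matrix_array n (mat n n (\<lambda>(i, j). X i j))"
  let ?B = "matrix_array n (mat n n (\<lambda>(i, j). Y i j))"
  have s': "regs s 0 = int n" "\<And>r. m \<le> r \<Longrightarrow> regs s r = 0" "\<And>r. m \<le> r \<Longrightarrow> arrs s r = (\<lambda>_. 0)"
    using s by (simp_all add: ready_def)
  have "computes_entry W n m (m + 9) s (select_entry m a True False) (1 + (1 + 1)) X"
    using computes_entry_select[OF X(1) _ s'(1) m(1) X(2) W(2), of "m + 9" True False] m by simp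
  from tabulate[OF this m(1) s'(1) s'(3) W]
  have 1: "halts_within W ?P s (11 * (n * n + 1)) (\<lambda>t. (\<forall>r. r \<notin> {m..<m + 9} \<longrightarrow> regs t r = regs s r) \<and>
      (\<forall>a. a \<noteq> m + 9 \<longrightarrow> arrs t a = arrs s a) \<and> arrs t (m + 9) = ?A)"
    by simp
  have 2: "halts_within W (Seq ?Q ?R) u (11 * (n * n + 1) + 1) ?post"
    if u: "(\<forall>r. r \<notin> {m..<m + 9} \<longrightarrow> regs u r = regs s r) \<and>
      (\<forall>a. a \<noteq> m + 9 \<longrightarrow> arrs u a = arrs s a) \<and> arrs u (m + 9) = ?A" for u
  proof -
    have u': "regs u 0 = int n" "arrs u (m + 10) = (\<lambda>_. 0)"
      using u m s' by simp_all
    have "holds_matrix n Y (arrs u b)" using u m Y by simp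
    then have "computes_entry W n m (m + 10) u (select_entry m b True False) (1 + (1 + 1)) Y"
      using computes_entry_select[where X = Y and a = b and c = "m + 10" and p = True and q = False,
          OF _ _ u'(1) m(1) Y(2) W(2)] m by simp
    from tabulate[OF this m(1) u' W]
    have 3: "halts_within W ?Q u (11 * (n * n + 1)) (\<lambda>t. (\<forall>r. r \<notin> {m..<m + 9} \<longrightarrow> regs t r = regs u r) \<and>
      (\<forall>a. a \<noteq> m + 10 \<longrightarrow> arrs t a = arrs u a) \<and> arrs t (m + 10) = ?B)"
      by simp
    have 4: "halts_within W ?R v 1 ?post"
      if v: "(\<forall>r. r \<notin> {m..<m + 9} \<longrightarrow> regs v r = regs u r) \<and>
      (\<forall>a. a \<noteq> m + 10 \<longrightarrow> arrs v a = arrs u a) \<and> arrs v (m + 10) = ?B" for v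
    proof (rule halts_within_Arith)
      have v': "regs v 0 = int n" "regs v (m + 10) = 0" using v u m s' by simp_all
      moreover have "int n \<le> int n * int n" by (cases "n = 0") simp_all
      ultimately show "\<bar>arith Plus (regs v 0) (regs v (m + 10))\<bar> \<le> W" using W by simp
      let ?t = "v\<lparr>regs := (regs v)(m + 9 := arith Plus (regs v 0) (regs v (m + 10)))\<rparr>"
      have "agree_below m s ?t"
        using v u by (intro agree_belowI) simp_all
      moreover have "shifted_state (m + 9)
          (matmul_input n (mat n n (\<lambda>(i, j). X i j)) (mat n n (\<lambda>(i, j). Y i j))) ?t"
        unfolding shifted_state_def
      proof (intro allI conjI)
        fix r
        show "regs ?t (m + 9 + r) =
            regs (matmul_input n (mat n n (\<lambda>(i, j). X i j)) (mat n n (\<lambda>(i, j). Y i j))) r"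
          using v u v' s'(2)[of "m + 9 + r"] by (simp add: matmul_input_def)
        consider "r = 0" | "r = 1" | "r \<noteq> 0" "r \<noteq> 1" by blast
        then show "arrs ?t (m + 9 + r) =
            arrs (matmul_input n (mat n n (\<lambda>(i, j). X i j)) (mat n n (\<lambda>(i, j). Y i j))) r"
        proof cases
          case 3
          then have "arrs v (m + 9 + r) = arrs s (m + 9 + r)" using u v by simp
          then show ?thesis using 3 s'(3)[of "m + 9 + r"] by (simp add: matmul_input_def)
        qed (use u v in \<open>simp_all add: matmul_input_def add.commute[of 10 m]\<close>)
      qed
      ultimately show "?post ?t" ..
    qed
    show ?thesis by (rule halts_within_Seq, rule halts_within_mono[OF 3 order_refl 4])
  qed
  have "halts_within W (Seq ?P (Seq ?Q ?R)) s (11 * (n * n + 1) + (11 * (n * n + 1) + 1)) ?post"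
    by (rule halts_within_Seq, rule halts_within_mono[OF 1 order_refl 2])
  then show ?thesis by (rule halts_within_mono) simp_all
qed

text \<open>The original final state \<open>t\<close> is kept as a witness: its contents from
  \<open>prog_bound P\<close> on are those of the initial state, which tells where clear memory
  resumes after the relocated block.\<close>

lemma runs_within_shift_prog:
  assumes "runs_within W P s T Q" "shifted_state b s s'"
  shows "runs_within W (shift_prog b P) s' T (\<lambda>t'. agree_below b s' t' \<and>
    (\<exists>t. shifted_state b t t' \<and> Q t \<and> (\<forall>r\<ge>prog_bound P. regs t r = regs s r \<and> arrs t r = arrs s r)))"
proof -
  from assms(1) obtain k t where t: "exec W P s k t" "real k \<le> T" "Q t"
    unfolding runs_within_def by blast
  from exec_shift_prog[OF t(1) assms(2)] obtain t' where
    t': "exec W (shift_prog b P) s' k t'" "shifted_state b t t'" "agree_below b s' t'" by blast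
  have "\<exists>t. shifted_state b t t' \<and> Q t \<and>
      (\<forall>r\<ge>prog_bound P. regs t r = regs s r \<and> arrs t r = arrs s r)"
    using t'(2) t(3) exec_frame[OF t(1)] by (intro exI[of _ t]) simp
  with t(2) t'(1,3) show ?thesis unfolding runs_within_def
    by (intro exI[of _ k] exI[of _ t']) simp
qed

lemma ready_after_shift:
  assumes "ready n G m s" "agree_below m s s'" "agree_below (m + 9) s' t'" "0 < m"
    and "shifted_state (m + 9) t t'"
    and "\<And>r. M \<le> r \<Longrightarrow> regs t r = 0 \<and> arrs t r = (\<lambda>_. 0)"
  shows "ready n G (m + 9 + M) t'"
proof -
  have "agree_below m s t'" using agree_below_trans[OF assms(2,3)] by simp
  then have "regs t' 0 = int n" "arrs t' 0 = matrix_array n (adjacency_matrix n G)"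
    using assms(1,4) by (simp_all add: agree_below_def ready_def)
  moreover have "regs t' r = 0 \<and> arrs t' r = (\<lambda>_. 0)" if "m + 9 + M \<le> r" for r
  proof -
    obtain q where "r = m + 9 + M + q" using le_Suc_ex[OF \<open>m + 9 + M \<le> r\<close>] ..
    then have "r = m + 9 + (M + q)" by simp
    then show ?thesis using assms(5) assms(6)[of "M + q"] unfolding shifted_state_def by simp
  qed
  ultimately show ?thesis by (simp add: ready_def)
qed

lemma computable_matrix_matmul:
  assumes \<omega>: "matmul_exponent \<omega>" "2 \<le> \<omega>" and XY: "computable_matrix \<omega> X" "computable_matrix \<omega> Y"
  shows "computable_matrix \<omega> (\<lambda>n G i j. \<Sum>k<n. X n G i k * Y n G k j)"
proof -
  obtain d where "\<forall>n G i j. graph_on n G \<longrightarrow> i < n \<longrightarrow> j < n \<longrightarrow> \<bar>X n G i j\<bar> \<le> int n ^ d"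
    using XY(1) by (rule computable_matrix_bound)
  note d = this[rule_format]
  obtain e where "\<forall>n G i j. graph_on n G \<longrightarrow> i < n \<longrightarrow> j < n \<longrightarrow> \<bar>Y n G i j\<bar> \<le> int n ^ e"
    using XY(2) by (rule computable_matrix_bound)
  note e = this[rule_format]
  \<comment> \<open>The index \<open>i < n\<close> makes \<open>n\<close> positive, so powers of
    \<open>n\<close> grow with the exponent.\<close>
  have pow: "int n ^ d \<le> int n ^ (d + e)" "int n ^ e \<le> int n ^ (d + e)" if "i < n" for i n
    using that by (auto intro!: power_increasing)
  have bound: "\<bar>\<Sum>k<n. X n G i k * Y n G k j\<bar> \<le> int n ^ (1 + (d + e))"
    if G: "graph_on n G" "i < n" "j < n" for n G i j
  proof -
    have "\<bar>\<Sum>k<n. X n G i k * Y n G k j\<bar> \<le> (\<Sum>k<n. \<bar>X n G i k * Y n G k j\<bar>)"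
      by (rule sum_abs)
    also have "\<dots> \<le> of_nat (card {..<n}) * int n ^ (d + e)"
    proof (rule sum_bounded_above)
      fix k assume "k \<in> {..<n}"
      then show "\<bar>X n G i k * Y n G k j\<bar> \<le> int n ^ (d + e)"
        using mult_mono[OF d[OF G(1,2)] e[OF G(1) _ G(3)], of k k] by (simp add: abs_mult power_add)
    qed
    finally show ?thesis by simp
  qed
  \<comment> \<open>One program must accept both operands, so it is taken for the degree
    \<open>d + e\<close>, which bounds the entries of each.\<close>
  obtain P c C where P: "\<forall>n. \<forall>A \<in> carrier_mat n n. \<forall>B \<in> carrier_mat n n.
        (\<forall>i<n. \<forall>j<n. \<bar>A $$ (i, j)\<bar> \<le> int n ^ (d + e) \<and> \<bar>B $$ (i, j)\<bar> \<le> int n ^ (d + e)) \<longrightarrow>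
        runs_within (word_bound c n) P (matmul_input n A B) (C * real (max 1 n) powr \<omega>)
          (\<lambda>t. \<forall>i<n. \<forall>j<n. arrs t 2 (int (i * n + j)) = (A * B) $$ (i, j))"
    using spec[OF \<omega>(1)[unfolded matmul_exponent_def], of "d + e"] by (elim exE) (rule that)
  show ?thesis unfolding computable_matrix_def
  proof (intro conjI allI impI)
    fix l :: nat assume "0 < l"
    then obtain m a b Q where Q: "a < m" "b < m" "stage \<omega> l m (\<lambda>_ _ _. True) Q
        (\<lambda>n G t. holds_matrix n (X n G) (arrs t a) \<and> holds_matrix n (Y n G) (arrs t b))"
      by (rule stage_two_matrices[OF XY])
    then have m: "0 < m" by simp
    \<comment> \<open>The product lies in array 2 of the program, that is, in array
      \<open>m + 11\<close>. The maximum with 3 keeps this array below the next free index even if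
      \<open>P\<close> mentions fewer names, and it also covers the input arrays 0 and 1.\<close>
    let ?M = "max 3 (prog_bound P)"
    let ?prep = "Seq (tabulate m (select_entry m a True False) (m + 9))
      (Seq (tabulate m (select_entry m b True False) (m + 10)) (Arith (m + 9) Plus 0 (m + 10)))"
    let ?c = "max c (max 2 (d + e))"
    have "stage \<omega> m (m + 9 + ?M)
        (\<lambda>n G t. holds_matrix n (X n G) (arrs t a) \<and> holds_matrix n (Y n G) (arrs t b))
        (Seq ?prep (shift_prog (m + 9) P))
        (\<lambda>n G t. holds_matrix n (\<lambda>i j. \<Sum>k<n. X n G i k * Y n G k j) (arrs t (m + 11)))"
      unfolding stage_def
    proof (intro conjI exI[of _ ?c] exI[of _ "2 * real 23 + C"] allI impI m)
      fix n G s
      assume G: "graph_on n G" and s: "ready n G m s"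
        and hold: "holds_matrix n (X n G) (arrs s a) \<and> holds_matrix n (Y n G) (arrs s b)"
      let ?A = "mat n n (\<lambda>(i, j). X n G i j)" and ?B = "mat n n (\<lambda>(i, j). Y n G i j)"
      let ?W = "word_bound ?c n"
      let ?post = "\<lambda>t. agree_below m s t \<and> ready n G (m + 9 + ?M) t \<and>
          holds_matrix n (\<lambda>i j. \<Sum>k<n. X n G i k * Y n G k j) (arrs t (m + 11))"
      have W: "word_bound c n \<le> ?W" "int n * int n \<le> ?W" "1 \<le> ?W" "int n ^ (d + e) \<le> ?W"
        using order_trans[OF int_power_le_word_bound word_bound_mono, of "d + e" ?c n]
        by (simp_all add: word_bound_mono square_le_word_bound word_bound_ge_1)
      have X: "\<bar>X n G i j\<bar> \<le> int n ^ (d + e)" and Y: "\<bar>Y n G i j\<bar> \<le> int n ^ (d + e)"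
        if "i < n" "j < n" for i j
        using d[OF G that] e[OF G that] pow[OF that(1)] by linarith+
      have XW: "\<bar>X n G i j\<bar> \<le> ?W" and YW: "\<bar>Y n G i j\<bar> \<le> ?W" if "i < n" "j < n" for i j
        using X[OF that] Y[OF that] W(4) by linarith+
      have prep: "runs_within ?W ?prep s (2 * real 23 * real (max 1 n) powr \<omega>)
          (\<lambda>t. agree_below m s t \<and> shifted_state (m + 9) (matmul_input n ?A ?B) t)"
        by (rule runs_within_if_halts[OF matmul_prepare[OF m Q(1,2) s _ XW _ YW W(3,2)] \<omega>(2)])
          (use hold in simp_all)
      have mult: "runs_within ?W P (matmul_input n ?A ?B) (C * real (max 1 n) powr \<omega>)
          (\<lambda>t. \<forall>i<n. \<forall>j<n. arrs t 2 (int (i * n + j)) = (?A * ?B) $$ (i, j))"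
        by (rule runs_within_mono[OF P[rule_format] W(1) order_refl]) (use X Y in simp_all)
      have "runs_within ?W (shift_prog (m + 9) P) u (C * real (max 1 n) powr \<omega>) ?post"
        if u: "agree_below m s u" "shifted_state (m + 9) (matmul_input n ?A ?B) u" for u
      proof (rule runs_within_mono[OF runs_within_shift_prog[OF mult u(2)] order_refl order_refl])
        fix t' assume "agree_below (m + 9) u t' \<and> (\<exists>t. shifted_state (m + 9) t t' \<and>
            (\<forall>i<n. \<forall>j<n. arrs t 2 (int (i * n + j)) = (?A * ?B) $$ (i, j)) \<and>
            (\<forall>r\<ge>prog_bound P. regs t r = regs (matmul_input n ?A ?B) r \<and>
              arrs t r = arrs (matmul_input n ?A ?B) r))"
        then obtain t where t: "agree_below (m + 9) u t'" "shifted_state (m + 9) t t'"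
            "\<And>i j. i < n \<Longrightarrow> j < n \<Longrightarrow> arrs t 2 (int (i * n + j)) = (?A * ?B) $$ (i, j)"
            "\<And>r. prog_bound P \<le> r \<Longrightarrow> regs t r = regs (matmul_input n ?A ?B) r \<and>
              arrs t r = arrs (matmul_input n ?A ?B) r"
          by blast
        have "regs t r = 0 \<and> arrs t r = (\<lambda>_. 0)" if "?M \<le> r" for r
          using t(4)[of r] that by (simp add: matmul_input_def)
        then have "ready n G (m + 9 + ?M) t'"
          by (rule ready_after_shift[OF s u(1) t(1) m t(2)])
        moreover have "arrs t' (m + 9 + 2) = arrs t 2"
          using t(2) unfolding shifted_state_def by blast
        then have "arrs t' (m + 11) = arrs t 2" by (simp add: add.commute[of 11 m])
        then have "holds_matrix n (\<lambda>i j. \<Sum>k<n. X n G i k * Y n G k j) (arrs t' (m + 11))"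
          using t(3) mat_mult_entry[of _ n _ "X n G" "Y n G"] by (simp add: holds_matrix_def)
        ultimately show "?post t'"
          using agree_below_trans[OF u(1) t(1)] by simp
      qed
      then have "runs_within ?W ?prep s (2 * real 23 * real (max 1 n) powr \<omega>)
          (\<lambda>u. runs_within ?W (shift_prog (m + 9) P) u (C * real (max 1 n) powr \<omega>) ?post)"
        by (intro runs_within_mono[OF prep order_refl order_refl]) blast
      from runs_within_Seq[OF this]
      show "runs_within ?W (Seq ?prep (shift_prog (m + 9) P)) s
          ((2 * real 23 + C) * real (max 1 n) powr \<omega>) ?post"
        by (simp only: distrib_right)
    qed simp
    from stage_Seq[OF Q(3) this] show "\<exists>m' a P. a < m' \<and> stage \<omega> l m' (\<lambda>_ _ _. True) P
        (\<lambda>n G t. holds_matrix n (\<lambda>i j. \<Sum>k<n. X n G i k * Y n G k j) (arrs t a))"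
      by (intro exI[of _ "m + 9 + ?M"] exI[of _ "m + 11"]) auto
  qed (intro exI[of _ "1 + (d + e)"], use bound in blast)
qed

section \<open>Computable scalars and their integer combinations\<close>

lemma computable_scalar_bound:
  assumes "computable_scalar \<omega> x"
  obtains d where "\<forall>n G. graph_on n G \<longrightarrow> \<bar>x n G\<bar> \<le> word_bound d n"
  using conjunct1[OF assms[unfolded computable_scalar_def]] by (elim exE) (rule that)

lemma computable_scalar_stage:
  assumes "computable_scalar \<omega> x" "0 < m"
  obtains m' r P where "r < m'"
    "stage \<omega> m m' (\<lambda>_ _ _. True) P (\<lambda>n G t. regs t r = x n G)"
proof -
  from assms have "\<exists>m' r P. r < m' \<and> stage \<omega> m m' (\<lambda>_ _ _. True) P (\<lambda>n G t. regs t r = x n G)"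
    unfolding computable_scalar_def by simp
  then show thesis using that by (elim exE conjE)
qed

lemma computable_scalar_const:
  assumes "2 \<le> \<omega>"
  shows "computable_scalar \<omega> (\<lambda>n G. k)"
  unfolding computable_scalar_def
proof (intro conjI allI impI)
  have k: "\<bar>k\<bar> \<le> word_bound (nat \<bar>k\<bar>) n" for n
    using nat_le_word_bound[of "nat \<bar>k\<bar>" n] by simp
  then show "\<exists>d. \<forall>n G. graph_on n G \<longrightarrow> \<bar>k\<bar> \<le> word_bound d n" by blast
  fix m :: nat assume m: "0 < m"
  have "stage \<omega> m (m + 1) (\<lambda>_ _ _. True) (Const m k) (\<lambda>n G t. regs t m = k)"
  proof (rule stage_if_halts[OF assms m, where c = "nat \<bar>k\<bar>" and K = 1])
    fix n G s assume "ready n G m s"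
    then have "halts_within (word_bound (nat \<bar>k\<bar>) n) (Const m k) s 1
        (\<lambda>t. agree_below m s t \<and> ready n G (m + 1) t \<and> regs t m = k)"
      using m by (intro halts_within_Const k) (auto simp: ready_def agree_below_def)
    then show "halts_within (word_bound (nat \<bar>k\<bar>) n) (Const m k) s (1 * (n * n + 1))
        (\<lambda>t. agree_below m s t \<and> ready n G (m + 1) t \<and> regs t m = k)"
      by (rule halts_within_mono) simp_all
  qed simp
  then show "\<exists>m' r P. r < m' \<and> stage \<omega> m m' (\<lambda>_ _ _. True) P (\<lambda>n G t. regs t r = k)"
    by (intro exI[of _ "m + 1"] exI[of _ m]) auto
qed

lemma computable_scalar_arith:
  assumes \<omega>: "2 \<le> \<omega>" and xy: "computable_scalar \<omega> x" "computable_scalar \<omega> y"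
    and d: "\<And>n G. graph_on n G \<Longrightarrow> \<bar>arith f (x n G) (y n G)\<bar> \<le> word_bound d n"
  shows "computable_scalar \<omega> (\<lambda>n G. arith f (x n G) (y n G))"
  unfolding computable_scalar_def
proof (intro conjI allI impI)
  show "\<exists>d. \<forall>n G. graph_on n G \<longrightarrow> \<bar>arith f (x n G) (y n G)\<bar> \<le> word_bound d n"
    using d by blast
  fix l :: nat assume "0 < l"
  with xy(1) obtain m p P where P: "p < m"
    "stage \<omega> l m (\<lambda>_ _ _. True) P (\<lambda>n G t. regs t p = x n G)"
    by (rule computable_scalar_stage)
  then have "0 < m" by simp
  with xy(2) obtain m' q Q where Q: "q < m'"
    "stage \<omega> m m' (\<lambda>_ _ _. True) Q (\<lambda>n G t. regs t q = y n G)"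
    by (rule computable_scalar_stage)
  then have m': "0 < m'" by simp
  have pm': "p < m'" using P(1) Q(2) unfolding stage_def by linarith
  have "stage \<omega> m m' (\<lambda>n G t. True \<and> regs t p = x n G) Q (\<lambda>n G t. regs t q = y n G \<and> regs t p = x n G)"
    using P(1) by (intro stage_frame[OF Q(2)]) (simp add: agree_below_regs)
  then have 2: "stage \<omega> m m' (\<lambda>n G t. regs t p = x n G) Q (\<lambda>n G t. regs t q = y n G \<and> regs t p = x n G)"
    by simp
  have 3: "stage \<omega> m' (m' + 1) (\<lambda>n G t. regs t q = y n G \<and> regs t p = x n G) (Arith m' f p q)
      (\<lambda>n G t. regs t m' = arith f (x n G) (y n G))"
  proof (rule stage_if_halts[OF \<omega> m', where c = d and K = 1])
    fix n G s assume s: "graph_on n G" "ready n G m' s" "regs s q = y n G \<and> regs s p = x n G"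
    then have "halts_within (word_bound d n) (Arith m' f p q) s 1
        (\<lambda>t. agree_below m' s t \<and> ready n G (m' + 1) t \<and> regs t m' = arith f (x n G) (y n G))"
      using m' d[OF s(1)] by (intro halts_within_Arith) (auto simp: ready_def agree_below_def)
    then show "halts_within (word_bound d n) (Arith m' f p q) s (1 * (n * n + 1))
        (\<lambda>t. agree_below m' s t \<and> ready n G (m' + 1) t \<and> regs t m' = arith f (x n G) (y n G))"
      by (rule halts_within_mono) simp_all
  qed simp
  from stage_Seq[OF P(2) stage_Seq[OF 2 3]]
  show "\<exists>m' r P. r < m' \<and> stage \<omega> l m' (\<lambda>_ _ _. True) P (\<lambda>n G t. regs t r = arith f (x n G) (y n G))"
    by (intro exI[of _ "m' + 1"] exI[of _ m']) auto
qed

text \<open>The sum at most doubles the larger bound, and one further factor \<open>n + 2\<close>,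
  which is at least 2, absorbs the doubling.\<close>

lemma word_bound_add: "word_bound c n + word_bound d n \<le> word_bound (c + d + 1) n"
proof -
  have "word_bound c n \<le> word_bound (c + d) n" "word_bound d n \<le> word_bound (c + d) n"
    by (simp_all add: word_bound_mono)
  then have "word_bound c n + word_bound d n \<le> 2 * word_bound (c + d) n" by simp
  also have "\<dots> \<le> (int n + 2) * word_bound (c + d) n"
    using word_bound_ge_1[of "c + d" n] by (intro mult_right_mono) auto
  finally show ?thesis by (simp add: word_bound_def)
qed

lemma computable_scalar_add:
  assumes "2 \<le> \<omega>" "computable_scalar \<omega> x" "computable_scalar \<omega> y"
  shows "computable_scalar \<omega> (\<lambda>n G. x n G + y n G)"
proof -
  obtain c where c: "\<forall>n G. graph_on n G \<longrightarrow> \<bar>x n G\<bar> \<le> word_bound c n"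
    using assms(2) by (rule computable_scalar_bound)
  obtain d where d: "\<forall>n G. graph_on n G \<longrightarrow> \<bar>y n G\<bar> \<le> word_bound d n"
    using assms(3) by (rule computable_scalar_bound)
  have "\<bar>arith Plus (x n G) (y n G)\<bar> \<le> word_bound (c + d + 1) n" if "graph_on n G" for n G
    using c[rule_format, OF that] d[rule_format, OF that] word_bound_add[of c n d]
      abs_triangle_ineq[of "x n G" "y n G"] by simp
  from computable_scalar_arith[OF assms this] show ?thesis by simp
qed

lemma computable_scalar_mult:
  assumes "2 \<le> \<omega>" "computable_scalar \<omega> x" "computable_scalar \<omega> y"
  shows "computable_scalar \<omega> (\<lambda>n G. x n G * y n G)"
proof -
  obtain c where c: "\<forall>n G. graph_on n G \<longrightarrow> \<bar>x n G\<bar> \<le> word_bound c n"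
    using assms(2) by (rule computable_scalar_bound)
  obtain d where d: "\<forall>n G. graph_on n G \<longrightarrow> \<bar>y n G\<bar> \<le> word_bound d n"
    using assms(3) by (rule computable_scalar_bound)
  have "\<bar>arith Times (x n G) (y n G)\<bar> \<le> word_bound (c + d) n" if "graph_on n G" for n G
    using mult_mono[OF c[rule_format, OF that] d[rule_format, OF that]] word_bound_ge_1[of c n]
    by (simp add: abs_mult word_bound_mult)
  from computable_scalar_arith[OF assms this] show ?thesis by simp
qed

lemma computable_scalar_sum:
  assumes "2 \<le> \<omega>" "finite I" "\<And>i. i \<in> I \<Longrightarrow> computable_scalar \<omega> (x i)"
  shows "computable_scalar \<omega> (\<lambda>n G. \<Sum>i\<in>I. x i n G)"
  using assms(2,3)
  by (induction I rule: finite_induct)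
    (simp_all add: computable_scalar_const computable_scalar_add assms(1))

text \<open>Division rounds down; comparing \<open>x\<close> with \<open>x * k\<close> and dividing
  settles both signs. The quotient thus fits into any word that holds \<open>x\<close>.\<close>

lemma abs_div_le:
  fixes x k :: int
  assumes "0 < k"
  shows "\<bar>x div k\<bar> \<le> \<bar>x\<bar>"
proof (cases "0 \<le> x")
  case True
  then have "x \<le> x * k" using assms mult_left_mono[of 1 k x] by simp
  then have "x div k \<le> x" using assms zdiv_mono1[of x "x * k" k] by simp
  with True show ?thesis using assms by (simp add: pos_imp_zdiv_nonneg_iff)
next
  case False
  then have "x * k \<le> x" using assms mult_left_mono_neg[of 1 k x] by simp
  then have "x \<le> x div k" using assms zdiv_mono1[of "x * k" x k] by simp
  moreover have "x div k < 0" using False assms by (simp add: pos_imp_zdiv_neg_iff)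
  ultimately show ?thesis by simp
qed

lemma computable_scalar_div:
  assumes "2 \<le> \<omega>" "computable_scalar \<omega> x" "0 < k"
  shows "computable_scalar \<omega> (\<lambda>n G. x n G div k)"
proof -
  obtain c where c: "\<forall>n G. graph_on n G \<longrightarrow> \<bar>x n G\<bar> \<le> word_bound c n"
    using assms(2) by (rule computable_scalar_bound)
  have "\<bar>arith Quotient (x n G) k\<bar> \<le> word_bound c n" if "graph_on n G" for n G
    using c[rule_format, OF that] abs_div_le[OF assms(3), of "x n G"] by simp
  from computable_scalar_arith[OF assms(1) assms(2) computable_scalar_const[OF assms(1)] this]
  show ?thesis by simp
qed

text \<open>Register \<open>m + 2\<close> is the accumulator. It is still zero at the start, so
  adding it to register 0 moves \<open>n\<close> into the counter.\<close>

definition sum_diagonal :: "nat \<Rightarrow> array \<Rightarrow> prog" where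
  "sum_diagonal m a =
     Seq (Const (m + 1) 1) (Seq (Arith m Plus 0 (m + 2)) (WhilePos m
       (Seq (Arith m Minus m (m + 1)) (Seq (Arith (m + 3) Times m 0)
       (Seq (Arith (m + 3) Plus (m + 3) m) (Seq (Load (m + 4) a (m + 3))
       (Arith (m + 2) Plus (m + 2) (m + 4))))))))"

text \<open>Summation runs from the last index down, so the accumulator passes through the suffix
  sums. Entries may have either sign, hence each suffix sum needs its own bound. The cost is
  \<open>6 * n + 3\<close>.\<close>

lemma sum_diagonal:
  assumes X: "holds_matrix n X (arrs s a)"
    and W: "\<And>i. i < n \<Longrightarrow> \<bar>X i i\<bar> \<le> W" "\<And>k. k \<le> n \<Longrightarrow> \<bar>\<Sum>i\<in>{k..<n}. X i i\<bar> \<le> W"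
      "int n * int n \<le> W" "1 \<le> W"
    and m: "0 < m" and s: "regs s 0 = int n" "regs s (m + 2) = 0"
  shows "halts_within W (sum_diagonal m a) s (9 * (n * n + 1))
    (\<lambda>t. (\<forall>r. r \<notin> {m..<m + 5} \<longrightarrow> regs t r = regs s r) \<and> arrs t = arrs s \<and>
      regs t (m + 2) = (\<Sum>i<n. X i i))"
proof -
  define I where "I p u \<longleftrightarrow> p \<le> n \<and> regs u m = int p \<and> regs u (m + 1) = 1 \<and>
      (\<forall>r. r \<notin> {m..<m + 5} \<longrightarrow> regs u r = regs s r) \<and> arrs u = arrs s \<and>
      regs u (m + 2) = (\<Sum>i\<in>{p..<n}. X i i)" for p and u :: ram_state
  let ?body = "(Seq (Arith m Minus m (m + 1)) (Seq (Arith (m + 3) Times m 0)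
       (Seq (Arith (m + 3) Plus (m + 3) m) (Seq (Load (m + 4) a (m + 3))
       (Arith (m + 2) Plus (m + 2) (m + 4))))))"
  have nW: "int n \<le> W"
    using W(3) by (cases "n = 0") (auto intro: order_trans[of _ "int n * int n"])
  have step: "0 < regs u m \<and> halts_within W ?body u (1 + (1 + (1 + (1 + 1)))) (I p)"
    if "I (Suc p) u" for p u
  proof
    from that have u: "p < n" "regs u m = int (Suc p)" "regs u (m + 1) = 1"
        "\<And>r. r \<notin> {m..<m + 5} \<Longrightarrow> regs u r = regs s r" "arrs u = arrs s"
        "regs u (m + 2) = (\<Sum>i\<in>{Suc p..<n}. X i i)"
      unfolding I_def by simp_all
    then show "0 < regs u m" by simp
    have n: "regs u 0 = int n" using u(4)[of 0] m s by simp
    have "arrs s a (int p * int n + int p) = X p p"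
      using X u(1) by (simp add: holds_matrix_def)
    moreover have sum: "(\<Sum>i\<in>{p..<n}. X i i) = (\<Sum>i\<in>{Suc p..<n}. X i i) + X p p"
      using u(1) by (simp add: sum.atLeast_Suc_lessThan)
    moreover have "\<bar>\<Sum>i\<in>{p..<n}. X i i\<bar> \<le> W" using W(2)[of p] u(1) by simp
    ultimately show "halts_within W ?body u (1 + (1 + (1 + (1 + 1)))) (I p)"
      using u n m nW W(1)[OF u(1)] index_le_bound[OF u(1) u(1) W(3)]
      by (intro halts_within_Seq halts_within_Arith halts_within_Load) (simp_all add: I_def)
  qed
  have stop: "\<not> 0 < regs u m" if "I 0 u" for u
    using that by (simp add: I_def)
  define u where "u = s\<lparr>regs := (regs s)(m + 1 := 1, m := int n)\<rparr>"
  have init: "I n u"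
    using s by (simp add: I_def u_def)
  have "halts_within W (sum_diagonal m a) s (1 + (1 + (n * ((1 + (1 + (1 + (1 + 1)))) + 1) + 1))) (I 0)"
    unfolding sum_diagonal_def
  proof (intro halts_within_Seq halts_within_Arith halts_within_Const)
    let ?s = "s\<lparr>regs := (regs s)(m + 1 := 1)\<rparr>"
    show "\<bar>arith Plus (regs ?s 0) (regs ?s (m + 2))\<bar> \<le> W" using s nW m by simp
    have "?s\<lparr>regs := (regs ?s)(m := arith Plus (regs ?s 0) (regs ?s (m + 2)))\<rparr> = u"
      using m s by (simp add: u_def)
    then show "halts_within W (WhilePos m ?body) (?s\<lparr>regs := (regs ?s)(m := arith Plus (regs ?s 0) (regs ?s (m + 2)))\<rparr>)
       (n * ((1 + (1 + (1 + (1 + 1)))) + 1) + 1) (I 0)"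
      using halts_within_WhilePos[of I n u m W ?body, OF init step stop] by (simp only:)
  qed (use W in auto)
  then show ?thesis
  proof (rule halts_within_mono)
    define k where "k = n * n"
    have "n \<le> k" unfolding k_def by (cases n) simp_all
    then show "1 + (1 + (n * ((1 + (1 + (1 + (1 + 1)))) + 1) + 1)) \<le> 9 * (n * n + 1)"
      unfolding k_def[symmetric] by simp
  qed (simp add: I_def atLeast0LessThan)
qed

lemma computable_scalar_sum_diagonal:
  assumes "computable_matrix \<omega> X" "2 \<le> \<omega>"
  shows "computable_scalar \<omega> (\<lambda>n G. \<Sum>i<n. X n G i i)"
proof -
  obtain d where "\<forall>n G i j. graph_on n G \<longrightarrow> i < n \<longrightarrow> j < n \<longrightarrow> \<bar>X n G i j\<bar> \<le> int n ^ d"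
    using assms(1) by (rule computable_matrix_bound)
  note d = this[rule_format]
  have bound: "\<bar>\<Sum>i\<in>{k..<n}. X n G i i\<bar> \<le> word_bound (d + 2) n" if "graph_on n G" for n G k
  proof -
    have "\<bar>\<Sum>i\<in>{k..<n}. X n G i i\<bar> \<le> (\<Sum>i\<in>{k..<n}. \<bar>X n G i i\<bar>)"
      by (rule sum_abs)
    also have "\<dots> \<le> of_nat (card {k..<n}) * int n ^ d"
      by (rule sum_bounded_above) (use d[OF that] in simp)
    also have "\<dots> \<le> int n * int n ^ d"
      by (intro mult_right_mono) auto
    also have "\<dots> \<le> word_bound (d + 1) n"
      using int_power_le_word_bound[of n "d + 1"] by simp
    also have "\<dots> \<le> word_bound (d + 2) n" by (simp add: word_bound_mono)
    finally show ?thesis .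
  qed
  show ?thesis unfolding computable_scalar_def
  proof (intro conjI allI impI)
    show "\<exists>d. \<forall>n G. graph_on n G \<longrightarrow> \<bar>\<Sum>i<n. X n G i i\<bar> \<le> word_bound d n"
      using bound[where k = 0] unfolding atLeast0LessThan by blast
    fix l :: nat assume "0 < l"
    with assms(1) obtain m a P where P: "a < m"
      "stage \<omega> l m (\<lambda>_ _ _. True) P (\<lambda>n G t. holds_matrix n (X n G) (arrs t a))"
      by (rule computable_matrix_stage)
    then have m: "0 < m" by simp
    have "stage \<omega> m (m + 5) (\<lambda>n G t. holds_matrix n (X n G) (arrs t a)) (sum_diagonal m a)
        (\<lambda>n G t. regs t (m + 2) = (\<Sum>i<n. X n G i i))"
    proof (rule stage_if_halts[OF assms(2) m, where c = "d + 2" and K = 9])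
      fix n G s
      assume s: "graph_on n G" "ready n G m s" "holds_matrix n (X n G) (arrs s a)"
      let ?W = "word_bound (d + 2) n"
      have W: "int n * int n \<le> ?W" "1 \<le> ?W" "int n ^ d \<le> ?W"
        using order_trans[OF int_power_le_word_bound word_bound_mono, of d "d + 2" n]
        by (simp_all add: square_le_word_bound word_bound_ge_1)
      have "\<bar>X n G i i\<bar> \<le> ?W" if "i < n" for i
        using d[OF s(1) that that] W(3) by linarith
      then show "halts_within ?W (sum_diagonal m a) s (9 * (n * n + 1))
          (\<lambda>t. agree_below m s t \<and> ready n G (m + 5) t \<and> regs t (m + 2) = (\<Sum>i<n. X n G i i))"
        using s(2) m
        by (intro halts_within_mono[OF sum_diagonal[OF s(3) _ bound[OF s(1)] W(1,2) m] order_refl])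
          (auto simp: ready_def agree_below_def)
    qed simp
    from stage_Seq[OF P(2) this] show "\<exists>m' r P. r < m' \<and>
        stage \<omega> l m' (\<lambda>_ _ _. True) P (\<lambda>n G t. regs t r = (\<Sum>i<n. X n G i i))"
      by (intro exI[of _ "m + 5"] exI[of _ "m + 2"]) auto
  qed
qed

text \<open>Index 0 holds the input, so the computation starts with \<open>m = 1\<close>; only at
  the very end is register 0 overwritten.\<close>

lemma computes_in_time_if_computable_scalar:
  assumes "computable_scalar \<omega> x" "2 \<le> \<omega>" and "\<And>n G. graph_on n G \<Longrightarrow> x n G = int (\<phi> G)"
  shows "\<exists>P C. computes_in_time P \<phi> (\<lambda>n. C * real (max 1 n) powr \<omega>)"
proof -
  have "0 < (1 :: nat)" by simp
  with assms(1) obtain m r P where P: "r < m" "stage \<omega> 1 m (\<lambda>_ _ _. True) P (\<lambda>n G t. regs t r = x n G)"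
    by (rule computable_scalar_stage)
  obtain d where d: "\<forall>n G. graph_on n G \<longrightarrow> \<bar>x n G\<bar> \<le> word_bound d n"
    using assms(1) by (rule computable_scalar_bound)
  from P(2) obtain c C where run: "\<And>n G s. graph_on n G \<Longrightarrow> ready n G 1 s \<Longrightarrow>
      runs_within (word_bound c n) P s (C * real (max 1 n) powr \<omega>)
        (\<lambda>t. agree_below 1 s t \<and> ready n G m t \<and> regs t r = x n G)"
    unfolding stage_def by blast
  \<comment> \<open>Register \<open>m\<close> is clear after the stage, so the addition moves the
    result from \<open>r\<close> to register 0.\<close>
  have "computes_in_time (Seq P (Arith 0 Plus r m)) \<phi> (\<lambda>n. (C + 2 * real 1) * real (max 1 n) powr \<omega>)"
    unfolding computes_in_time_def
  proof (intro exI[of _ "max c d"] allI impI)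
    fix n :: nat and G assume "pair_graph G \<and> pverts G = {0..<n}"
    then have G: "graph_on n G" by (simp add: graph_on_def)
    let ?W = "word_bound (max c d) n"
    have W: "word_bound c n \<le> ?W" "word_bound d n \<le> ?W" by (simp_all add: word_bound_mono)
    have "ready n G 1 (graph_input n G)" by (auto simp: ready_def graph_input_def)
    note run = run[OF G this]
    have "runs_within ?W (Arith 0 Plus r m) t (2 * real 1 * real (max 1 n) powr \<omega>)
        (\<lambda>t. regs t 0 = int (\<phi> G))"
      if t: "ready n G m t" "regs t r = x n G" for t
    proof (rule runs_within_if_halts[OF halts_within_mono[OF halts_within_Arith] assms(2)])
      have "regs t m = 0" using t by (simp add: ready_def)
      then show "\<bar>arith Plus (regs t r) (regs t m)\<bar> \<le> ?W"
        and "regs (t\<lparr>regs := (regs t)(0 := arith Plus (regs t r) (regs t m))\<rparr>) 0 = int (\<phi> G)"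
        using t(2) d[rule_format, OF G] W(2) assms(3)[OF G] by simp_all
    qed simp_all
    then have "runs_within ?W P (graph_input n G) (C * real (max 1 n) powr \<omega>)
        (\<lambda>t. runs_within ?W (Arith 0 Plus r m) t (2 * real 1 * real (max 1 n) powr \<omega>)
          (\<lambda>t. regs t 0 = int (\<phi> G)))"
      by (intro runs_within_mono[OF run W(1) order_refl]) blast
    from runs_within_Seq[OF this]
    show "runs_within ?W (Seq P (Arith 0 Plus r m)) (graph_input n G)
        ((C + 2 * real 1) * real (max 1 n) powr \<omega>) (\<lambda>t. regs t 0 = int (\<phi> G))"
      by (simp only: distrib_right)
  qed
  then show ?thesis by blast
qed

lemma matmul_exponent_ge_2:
  assumes "matmul_exponent \<omega>"
  shows "2 \<le> \<omega>"
proof (rule ccontr)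
  assume "\<not> 2 \<le> \<omega>"
  then have \<omega>: "0 < 2 - \<omega>" by simp
  obtain P c C where P: "\<forall>n. \<forall>A \<in> carrier_mat n n. \<forall>B \<in> carrier_mat n n.
        (\<forall>i<n. \<forall>j<n. \<bar>A $$ (i, j)\<bar> \<le> int n ^ 0 \<and> \<bar>B $$ (i, j)\<bar> \<le> int n ^ 0) \<longrightarrow>
        runs_within (word_bound c n) P (matmul_input n A B) (C * real (max 1 n) powr \<omega>)
          (\<lambda>t. \<forall>i<n. \<forall>j<n. arrs t 2 (int (i * n + j)) = (A * B) $$ (i, j))"
    using spec[OF assms[unfolded matmul_exponent_def], of 0] by (elim exE) (rule that)
  have square_le: "real n * real n \<le> C * real n powr \<omega>" if n: "0 < n" for n
  proof -
    \<comment> \<open>All-ones matrices meet the entry bound of degree 0, and every entry of their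
      product is \<open>n\<close>, whereas array 2 starts with zeros.\<close>
    let ?A = "mat n n (\<lambda>(i, j). 1) :: int mat"
    have "runs_within (word_bound c n) P (matmul_input n ?A ?A) (C * real (max 1 n) powr \<omega>)
          (\<lambda>t. \<forall>i<n. \<forall>j<n. arrs t 2 (int (i * n + j)) = (?A * ?A) $$ (i, j))"
      by (rule P[rule_format]) simp_all
    then obtain k t where t: "exec (word_bound c n) P (matmul_input n ?A ?A) k t"
        "real k \<le> C * real (max 1 n) powr \<omega>"
        "\<forall>i<n. \<forall>j<n. arrs t 2 (int (i * n + j)) = (?A * ?A) $$ (i, j)"
      unfolding runs_within_def by (elim exE conjE) (rule that)
    let ?D = "{x. arrs t 2 x \<noteq> arrs (matmul_input n ?A ?A) 2 x}"
    have "int ` {..<n * n} \<subseteq> ?D"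
    proof
      fix x assume "x \<in> int ` {..<n * n}"
      then obtain p where p: "p < n * n" "x = int p" by auto
      note ij = div_mod_less_square[OF p(1)]
      have "arrs t 2 (int (p div n * n + p mod n)) = (?A * ?A) $$ (p div n, p mod n)"
        using t(3) ij by blast
      also have "\<dots> = int n"
        unfolding mat_mult_entry[OF ij(1,2), of "\<lambda>_ _. 1" "\<lambda>_ _. 1"] by simp
      finally have "arrs t 2 x \<noteq> 0" using n p(2) ij(3) by simp
      then show "x \<in> ?D" by (simp add: matmul_input_def)
    qed
    then have "n * n \<le> card ?D"
      using exec_stores_le[OF t(1), of 2] card_mono[of ?D "int ` {..<n * n}"]
      by (simp add: card_image)
    then have "n * n \<le> k" using exec_stores_le[OF t(1), of 2] by linarith
    then have "real n * real n \<le> real k" by (metis of_nat_le_iff of_nat_mult)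
    then show ?thesis using t(2) n by (simp add: max_def split: if_splits)
  qed
  \<comment> \<open>Chosen so that \<open>x powr (2 - \<omega>)\<close> equals
    \<open>\<bar>C\<bar> + 1\<close>; any size \<open>n\<close> above \<open>x\<close> then
    contradicts the quadratic lower bound.\<close>
  define x where "x = (\<bar>C\<bar> + 1) powr (1 / (2 - \<omega>))"
  define n where "n = Suc (nat \<lceil>x\<rceil>)"
  have "x \<le> real n" "0 < n" unfolding n_def by linarith+
  then have "x powr (2 - \<omega>) \<le> real n powr (2 - \<omega>)"
    using \<omega> by (intro powr_mono2) (auto simp: x_def)
  moreover have "x powr (2 - \<omega>) = \<bar>C\<bar> + 1"
    using \<omega> by (simp add: x_def powr_powr)
  ultimately have "C < real n powr (2 - \<omega>)" by linarith
  then have "C * real n powr \<omega> < real n powr (2 - \<omega>) * real n powr \<omega>"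
    using \<open>0 < n\<close> by (intro mult_strict_right_mono) auto
  also have "\<dots> = real n * real n"
    using \<open>0 < n\<close> by (simp add: powr_add[symmetric] power2_eq_square)
  finally show False using square_le[OF \<open>0 < n\<close>] by simp
qed

section \<open>Eliminating vertices of a weighted network\<close>

text \<open>The partition function of a spin model with \<open>n\<close> states per vertex. Every
  ordered pair, including \<open>u = v\<close>, has its own weight matrix, and the constant 1 means
  no interaction.\<close>

definition partition_sum ::
    "nat \<Rightarrow> 'v set \<Rightarrow> ('v \<Rightarrow> 'v \<Rightarrow> nat \<Rightarrow> nat \<Rightarrow> int) \<Rightarrow> int" where
  "partition_sum n V M = (\<Sum>\<phi>\<in>V \<rightarrow>\<^sub>E {..<n}. \<Prod>u\<in>V. \<Prod>v\<in>V. M u v (\<phi> u) (\<phi> v))"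

lemma sum_PiE_insert:
  assumes "w \<notin> V"
  shows "(\<Sum>\<phi>\<in>insert w V \<rightarrow>\<^sub>E S. F \<phi>) = (\<Sum>\<phi>\<in>V \<rightarrow>\<^sub>E S. \<Sum>k\<in>S. F (\<phi>(w := k)))"
proof -
  have "(\<Sum>\<phi>\<in>insert w V \<rightarrow>\<^sub>E S. F \<phi>) = (\<Sum>(k, \<phi>)\<in>S \<times> (V \<rightarrow>\<^sub>E S). F (\<phi>(w := k)))"
    unfolding PiE_insert_eq
    by (subst sum.reindex[OF inj_combinator[OF assms]]) (simp add: case_prod_unfold)
  also have "\<dots> = (\<Sum>k\<in>S. \<Sum>\<phi>\<in>V \<rightarrow>\<^sub>E S. F (\<phi>(w := k)))"
    by (simp add: sum.cartesian_product)
  also have "\<dots> = (\<Sum>\<phi>\<in>V \<rightarrow>\<^sub>E S. \<Sum>k\<in>S. F (\<phi>(w := k)))"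
    by (rule sum.swap)
  finally show ?thesis .
qed

text \<open>The terms are grouped into a factor depending on \<open>(i, k)\<close> and one depending
  on \<open>(k, j)\<close>, so the sum over \<open>k\<close> is an entry of a matrix product. The
  own weight of \<open>w\<close> goes into the first factor. For \<open>a = b\<close> the second
  factor is 1, since the weights between \<open>a\<close> and \<open>w\<close> must count once; only
  entries with \<open>i = j\<close> are then ever evaluated.\<close>

definition eliminated ::
    "'v \<Rightarrow> 'v \<Rightarrow> 'v \<Rightarrow> nat \<Rightarrow> ('v \<Rightarrow> 'v \<Rightarrow> nat \<Rightarrow> nat \<Rightarrow> int) \<Rightarrow> 'v \<Rightarrow> 'v \<Rightarrow> nat \<Rightarrow> nat \<Rightarrow> int" where
  "eliminated w a b n M u v i j = M u v i j * (if u = a \<and> v = b then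
     \<Sum>k<n. (M a w i k * (M w a k i * M w w k k)) * (if a = b then 1 else M b w j k * M w b k j)
     else 1)"

text \<open>For fixed images of \<open>V\<close>, only the factors that involve \<open>w\<close>
  vary with \<open>k\<close>, and those with partners other than \<open>a\<close> and
  \<open>b\<close> are 1. By distributivity the rest moves out of the sum.\<close>

lemma partition_sum_eliminate:
  assumes "finite V" "w \<notin> V" "a \<in> V" "b \<in> V"
    and one: "\<And>v i j. v \<in> V \<Longrightarrow> v \<notin> {a, b} \<Longrightarrow> M v w i j = 1 \<and> M w v i j = 1"
  shows "partition_sum n (insert w V) M = partition_sum n V (eliminated w a b n M)"
  unfolding partition_sum_def sum_PiE_insert[OF assms(2)]
proof (rule sum.cong[OF refl])
  fix \<phi> assume "\<phi> \<in> V \<rightarrow>\<^sub>E {..<n}"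
  let ?R = "\<Prod>u\<in>V. \<Prod>v\<in>V. M u v (\<phi> u) (\<phi> v)"
  let ?f = "\<lambda>v k. M v w (\<phi> v) k * M w v k (\<phi> v)"
  have split: "(\<Prod>u\<in>insert w V. \<Prod>v\<in>insert w V. M u v ((\<phi>(w := k)) u) ((\<phi>(w := k)) v)) =
      ?R * ((M a w (\<phi> a) k * (M w a k (\<phi> a) * M w w k k)) *
        (if a = b then 1 else M b w (\<phi> b) k * M w b k (\<phi> b)))" for k
  proof -
    have ne: "v \<noteq> w" if "v \<in> V" for v using that assms(2) by blast
    have "(\<Prod>u\<in>insert w V. \<Prod>v\<in>insert w V. M u v ((\<phi>(w := k)) u) ((\<phi>(w := k)) v)) =
        (M w w k k * (\<Prod>v\<in>V. M w v k (\<phi> v))) * (\<Prod>u\<in>V. M u w (\<phi> u) k * (\<Prod>v\<in>V. M u v (\<phi> u) (\<phi> v)))"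
      using assms(1,2) ne by (simp cong: prod.cong)
    also have "\<dots> = ?R * (M w w k k * (\<Prod>v\<in>V. ?f v k))"
      by (simp add: prod.distrib)
    also have "(\<Prod>v\<in>V. ?f v k) = (\<Prod>v\<in>{a, b}. ?f v k)"
      using assms one by (intro prod.mono_neutral_right) auto
    \<comment> \<open>For \<open>a = b\<close> the set \<open>{a, b}\<close> is a singleton and
      contributes one factor only.\<close>
    also have "\<dots> = ?f a k * (if a = b then 1 else ?f b k)"
      by auto
    finally show ?thesis by (simp add: mult_ac)
  qed
  let ?g = "\<Sum>k<n. (M a w (\<phi> a) k * (M w a k (\<phi> a) * M w w k k)) *
      (if a = b then 1 else M b w (\<phi> b) k * M w b k (\<phi> b))"
  have "(\<Prod>u\<in>V. \<Prod>v\<in>V. eliminated w a b n M u v (\<phi> u) (\<phi> v)) =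
      ?R * (\<Prod>u\<in>V. \<Prod>v\<in>V. if u = a \<and> v = b then ?g else 1)"
    unfolding eliminated_def
    by (subst prod.distrib[symmetric])+ (intro prod.cong refl, auto)
  also have "(\<Prod>u\<in>V. \<Prod>v\<in>V. if u = a \<and> v = b then ?g else 1) = (\<Prod>u\<in>V. if u = a then ?g else 1)"
    using assms by (intro prod.cong refl) (auto simp: prod.delta)
  also have "\<dots> = ?g" using assms by (simp add: prod.delta)
  finally show "(\<Sum>k<n. \<Prod>u\<in>insert w V. \<Prod>v\<in>insert w V. M u v ((\<phi>(w := k)) u) ((\<phi>(w := k)) v)) =
      (\<Prod>u\<in>V. \<Prod>v\<in>V. eliminated w a b n M u v (\<phi> u) (\<phi> v))"
    by (simp only: split sum_distrib_left)
qed

text \<open>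
  Summing out a vertex \<open>w\<close> whose neighbours are among \<open>a\<close> and \<open>b\<close> multiplies the weight of the
  pair \<open>(a, b)\<close> by an entry of a matrix product; \<open>a = b\<close> covers fewer than two neighbours.
\<close>

inductive eliminable :: "'v set \<Rightarrow> ('v \<times> 'v) set \<Rightarrow> bool" where
  single: "eliminable {w} E"
| eliminate: "w \<notin> V \<Longrightarrow> a \<in> V \<Longrightarrow> b \<in> V \<Longrightarrow>
    (\<And>v. v \<in> V \<Longrightarrow> (v, w) \<in> E \<or> (w, v) \<in> E \<Longrightarrow> v \<in> {a, b}) \<Longrightarrow>
    eliminable V (insert (a, b) E) \<Longrightarrow> eliminable (insert w V) E"

lemma eliminable_finite: "eliminable V E \<Longrightarrow> finite V"
  by (induction rule: eliminable.induct) simp_all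

text \<open>Induction along the elimination order, with \<open>M\<close> arbitrary because each
  elimination replaces the weights. \<open>E\<close> need only contain the pairs with a nontrivial
  weight; weights of single vertices are unrestricted, which covers the case that
  \<open>(a, b)\<close> is a loop. The last vertex leaves a sum over a diagonal.\<close>

lemma computable_scalar_partition_sum:
  assumes \<omega>: "matmul_exponent \<omega>" and "eliminable V E"
    and "\<And>u v. u \<in> V \<Longrightarrow> v \<in> V \<Longrightarrow> computable_matrix \<omega> (M u v)"
    and "\<And>u v n G i j. u \<in> V \<Longrightarrow> v \<in> V \<Longrightarrow> u \<noteq> v \<Longrightarrow> (u, v) \<notin> E \<Longrightarrow> M u v n G i j = 1"
  shows "computable_scalar \<omega> (\<lambda>n G. partition_sum n V (\<lambda>u v. M u v n G))"
  using assms(2-4)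
proof (induction V E arbitrary: M rule: eliminable.induct)
  case (single w E)
  have "partition_sum n {w} (\<lambda>u v. M u v n G) = (\<Sum>i<n. M w w n G i i)" for n G
  proof -
    have "partition_sum n {w} (\<lambda>u v. M u v n G) = (\<Sum>\<phi>\<in>{} \<rightarrow>\<^sub>E {..<n}. \<Sum>k<n. M w w n G k k)"
      unfolding partition_sum_def by (subst sum_PiE_insert) simp_all
    then show ?thesis by simp
  qed
  then show ?case
    using computable_scalar_sum_diagonal[OF single(1)[of w w] matmul_exponent_ge_2[OF \<omega>]] by simp
next
  case (eliminate w V a b E)
  note ge_2 = matmul_exponent_ge_2[OF \<omega>]
  \<comment> \<open>\<open>L\<close> and \<open>R\<close> are the two factors from
    \<open>eliminated\<close>, now as families over all inputs, so that each is built from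
    computable matrices by transposing, spreading a diagonal and multiplying entrywise.\<close>
  define L where "L n G i k = M a w n G i k * (M w a n G k i * M w w n G k k)" for n G i k
  define R where "R n G k j = (if a = b then 1 else M b w n G j k * M w b n G k j)" for n G k j
  have transpose: "computable_matrix \<omega> (\<lambda>n G i j. X n G j i)" if "computable_matrix \<omega> X" for X
    using computable_matrix_select[OF that ge_2, of False True] by simp
  have L: "computable_matrix \<omega> L"
  proof -
    have "computable_matrix \<omega> (M a w)" "computable_matrix \<omega> (M w a)" "computable_matrix \<omega> (M w w)"
      using eliminate.prems(1) eliminate.hyps(2) by simp_all
    note * = this
    have "computable_matrix \<omega> (\<lambda>n G i k. M w w n G k k)"
      using computable_matrix_select[OF *(3) ge_2, of False False] by simp
    from computable_matrix_mult_entries[OF *(1) computable_matrix_mult_entries[OF transpose[OF *(2)] this ge_2] ge_2]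
    show ?thesis unfolding L_def .
  qed
  have R: "computable_matrix \<omega> R"
  proof (cases "a = b")
    case True
    then show ?thesis unfolding R_def using computable_matrix_const[OF ge_2] by simp
  next
    case False
    have "computable_matrix \<omega> (\<lambda>n G k j. M b w n G j k * M w b n G k j)"
      using eliminate.prems(1) eliminate.hyps(3)
      by (intro computable_matrix_mult_entries[OF transpose _ ge_2]) simp_all
    then show ?thesis unfolding R_def using False by simp
  qed
  define M' where "M' u v n G i j = M u v n G i j * (if u = a \<and> v = b then \<Sum>k<n. L n G i k * R n G k j else 1)"
    for u v n G i j
  have M': "computable_matrix \<omega> (M' u v)" if "u \<in> V" "v \<in> V" for u v
  proof (cases "u = a \<and> v = b")
    case True
    then show ?thesis unfolding M'_def
      using computable_matrix_mult_entries[OF eliminate.prems(1) computable_matrix_matmul[OF \<omega> ge_2 L R] ge_2] that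
      by simp
  next
    case False
    then have "M' u v = M u v" by (intro ext) (auto simp: M'_def)
    then show ?thesis using eliminate.prems(1) that by simp
  qed
  have "M' u v n G i j = 1" if "u \<in> V" "v \<in> V" "u \<noteq> v" "(u, v) \<notin> insert (a, b) E" for u v n G i j
    using that eliminate.prems(2)[of u v n G i j] by (auto simp: M'_def)
  from eliminate.IH[OF M' this]
  have "computable_scalar \<omega> (\<lambda>n G. partition_sum n V (\<lambda>u v. M' u v n G))" .
  moreover have "partition_sum n (insert w V) (\<lambda>u v. M u v n G) = partition_sum n V (\<lambda>u v. M' u v n G)" for n G
  proof -
    have "partition_sum n (insert w V) (\<lambda>u v. M u v n G) =
        partition_sum n V (eliminated w a b n (\<lambda>u v. M u v n G))"
    proof (rule partition_sum_eliminate)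
      fix v i j assume v: "v \<in> V" "v \<notin> {a, b}"
      then have "(v, w) \<notin> E" "(w, v) \<notin> E" "v \<noteq> w" using eliminate.hyps by blast+
      then show "M v w n G i j = 1 \<and> M w v n G i j = 1"
        using v eliminate.prems(2) by simp
    qed (use eliminate.hyps eliminable_finite in blast)+
    also have "eliminated w a b n (\<lambda>u v. M u v n G) = (\<lambda>u v. M' u v n G)"
      by (intro ext) (simp add: eliminated_def M'_def L_def R_def)
    finally show ?thesis .
  qed
  ultimately show ?case by simp
qed

section \<open>Elimination along a tree decomposition\<close>

text \<open>Trees presented by attaching leaves one at a time; elimination inducts on this and works
  on the leaf attached last.\<close>

inductive grown_tree :: "'t set \<Rightarrow> ('t \<times> 't) set \<Rightarrow> bool" where
  single: "grown_tree {t} {}"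
| grow: "grown_tree N R \<Longrightarrow> t \<notin> N \<Longrightarrow> s \<in> N \<Longrightarrow> grown_tree (insert t N) (insert (t, s) (insert (s, t) R))"

lemma grown_tree_subset: "grown_tree N R \<Longrightarrow> R \<subseteq> N \<times> N"
  by (induction rule: grown_tree.induct) auto

text \<open>Connectivity inside \<open>A\<close>. Unlike the library notion it holds for the empty
  set, which may arise when a leaf is removed.\<close>

definition linked :: "('t \<times> 't) set \<Rightarrow> 't set \<Rightarrow> bool" where
  "linked R A \<longleftrightarrow> (\<forall>x\<in>A. \<forall>y\<in>A. (x, y) \<in> (R \<inter> A \<times> A)\<^sup>*)"

text \<open>A path through the leaf \<open>t\<close> enters and leaves it by \<open>s\<close>, so
  the visit can be cut out.\<close>

lemma linked_remove_leaf:
  assumes "linked R A" and leaf: "\<And>y. (t, y) \<in> R \<or> (y, t) \<in> R \<Longrightarrow> y = s" and "t \<noteq> s"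
  shows "linked R (A - {t})"
proof -
  let ?A = "A - {t}"
  \<comment> \<open>The path is followed with \<open>s\<close> standing in for \<open>t\<close>:
    whenever the original path is at \<open>t\<close>, the shortened one waits at
    \<open>s\<close>.\<close>
  have step: "(a, if b = t then s else b) \<in> (R \<inter> ?A \<times> ?A)\<^sup>*" if "a \<in> ?A" "(a, b) \<in> (R \<inter> A \<times> A)\<^sup>*" for a b
    using that(2)
  proof (induction rule: rtrancl_induct)
    case base
    then show ?case using that(1) by simp
  next
    case (step b c)
    consider "c = t" | "c \<noteq> t" "b = t" | "c \<noteq> t" "b \<noteq> t" by blast
    then show ?case
    proof cases
      case 1
      then show ?thesis using step leaf assms(3) by (auto split: if_splits)
    next
      case 2
      then show ?thesis using step leaf by auto
    next
      case 3
      then have "(b, c) \<in> R \<inter> ?A \<times> ?A" using step by blast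
      with 3 step.IH show ?thesis by (simp add: rtrancl.rtrancl_into_rtrancl)
    qed
  qed
  show ?thesis
    unfolding linked_def
  proof (intro ballI)
    fix x y assume "x \<in> ?A" "y \<in> ?A"
    moreover then have "(x, y) \<in> (R \<inter> A \<times> A)\<^sup>*" using assms(1) by (simp add: linked_def)
    ultimately show "(x, y) \<in> (R \<inter> ?A \<times> ?A)\<^sup>*" using step[of x y] by simp
  qed
qed

text \<open>The only exit from \<open>t\<close> leads to \<open>s\<close>, outside \<open>A\<close>,
  so a path inside \<open>A\<close> cannot leave \<open>t\<close>. Applied to the nodes whose bags
  contain \<open>w\<close>, this shows that \<open>w\<close> is private to the leaf.\<close>

lemma linked_isolated:
  assumes "linked R A" "t \<in> A" "s \<notin> A" and leaf: "\<And>y. (t, y) \<in> R \<Longrightarrow> y = s"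
  shows "A = {t}"
proof -
  have "y = t" if "y \<in> A" for y
  proof -
    have "(t, y) \<in> (R \<inter> A \<times> A)\<^sup>*" using assms(1,2) that by (simp add: linked_def)
    then show ?thesis using assms(3) leaf by (auto elim: converse_rtranclE)
  qed
  then show ?thesis using assms(2) by blast
qed

text \<open>Width at most two, freed from the graph axioms: elimination inserts
  \<open>(a, b)\<close> without \<open>(b, a)\<close>, possibly as a loop, and leaves pairs with
  eliminated vertices in \<open>E\<close>. Finiteness of bags is explicit because
  \<open>card\<close> of an infinite set is 0.\<close>

definition small_decomposition ::
    "'t set \<Rightarrow> ('t \<times> 't) set \<Rightarrow> ('t \<Rightarrow> 'v set) \<Rightarrow> 'v set \<Rightarrow> ('v \<times> 'v) set \<Rightarrow> bool" where
  "small_decomposition N R bag V E \<longleftrightarrow>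
     (\<forall>t\<in>N. finite (bag t) \<and> card (bag t) \<le> 3) \<and> V = (\<Union>t\<in>N. bag t) \<and>
     (\<forall>u\<in>V. \<forall>v\<in>V. u \<noteq> v \<longrightarrow> (u, v) \<in> E \<longrightarrow> (\<exists>t\<in>N. u \<in> bag t \<and> v \<in> bag t)) \<and>
     (\<forall>v\<in>V. linked R {t \<in> N. v \<in> bag t})"

text \<open>All partners of \<open>w\<close> lie in \<open>bag t\<close>, and so does the new pair
  \<open>(a, b)\<close>; deleting \<open>w\<close> from that bag therefore leaves a decomposition
  over the same tree. The induction hypothesis enters as a premise because two inductions, for the
  root bag and for a leaf bag, share this step.\<close>

lemma eliminate_private_vertex:
  assumes dec: "small_decomposition N R bag V E" and t: "t \<in> N" "w \<in> bag t"
    and only: "\<And>t'. t' \<in> N \<Longrightarrow> w \<in> bag t' \<Longrightarrow> t' = t"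
    and IH: "\<And>E'. V - {w} \<noteq> {} \<Longrightarrow>
      small_decomposition N R (bag(t := bag t - {w})) (V - {w}) E' \<Longrightarrow> eliminable (V - {w}) E'"
  shows "eliminable V E"
proof (cases "V - {w} = {}")
  case True
  then have "V = {w}" using dec t unfolding small_decomposition_def by blast
  then show ?thesis by (simp add: eliminable.single)
next
  case False
  let ?bag = "bag(t := bag t - {w})"
  note cover = dec[unfolded small_decomposition_def, THEN conjunct2, THEN conjunct2, THEN conjunct1, rule_format]
  have V: "V = (\<Union>t\<in>N. bag t)" and fin: "finite (bag t)" and "card (bag t) \<le> 3"
    using dec t by (simp_all add: small_decomposition_def)
  then have "card (bag t - {w}) \<le> 2" using t(2) by simp
  \<comment> \<open>Either the new pair is a loop, which needs no bag, or both ends lie in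
    \<open>bag t\<close>, which covers it.\<close>
  then obtain a b where ab: "a \<in> V - {w}" "b \<in> V - {w}" "bag t - {w} \<subseteq> {a, b}"
      "a = b \<or> {a, b} \<subseteq> bag t - {w}"
  proof -
    have sub: "bag t - {w} \<subseteq> V - {w}" using V t by blast
    obtain c where c: "c \<in> V - {w}" using False by blast
    have "card (bag t - {w}) = 0 \<or> card (bag t - {w}) = 1 \<or> card (bag t - {w}) = 2"
      using \<open>card (bag t - {w}) \<le> 2\<close> by linarith
    then consider "bag t - {w} = {}" | a where "bag t - {w} = {a}" | a b where "bag t - {w} = {a, b}"
      using fin by (auto simp: card_1_singleton_iff card_2_iff)
    then show thesis
    proof cases
      \<comment> \<open>Without partners any remaining vertex can carry the constant that results
        from summing out \<open>w\<close>.\<close>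
      case 1
      then show thesis using c by (intro that[of c c]) auto
    next
      case (2 a)
      then show thesis using sub by (intro that[of a a]) auto
    next
      case (3 a b)
      then show thesis using sub by (intro that[of a b]) auto
    qed
  qed
  have "small_decomposition N R ?bag (V - {w}) (insert (a, b) E)"
    unfolding small_decomposition_def
  proof (intro conjI ballI impI)
    fix t' assume "t' \<in> N"
    then have *: "finite (bag t')" "card (bag t') \<le> 3"
      using dec by (simp_all add: small_decomposition_def)
    moreover have "?bag t' \<subseteq> bag t'" by simp
    ultimately show "finite (?bag t')" "card (?bag t') \<le> 3"
      by (meson finite_subset, meson card_mono order_trans)
  next
    show "V - {w} = (\<Union>t'\<in>N. ?bag t')"
      unfolding V using only by (auto split: if_splits)
  next
    fix u v assume uv: "u \<in> V - {w}" "v \<in> V - {w}" "u \<noteq> v" "(u, v) \<in> insert (a, b) E"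
    show "\<exists>t'\<in>N. u \<in> ?bag t' \<and> v \<in> ?bag t'"
    proof (cases "(u, v) = (a, b)")
      case True
      then show ?thesis using ab uv t by auto
    next
      case False
      then obtain t' where "t' \<in> N" "u \<in> bag t'" "v \<in> bag t'"
        using uv cover[of u v] by blast
      then show ?thesis using uv by auto
    qed
  next
    fix v assume v: "v \<in> V - {w}"
    then have "{t' \<in> N. v \<in> ?bag t'} = {t' \<in> N. v \<in> bag t'}" by auto
    then show "linked R {t' \<in> N. v \<in> ?bag t'}"
      using v dec unfolding small_decomposition_def by simp
  qed
  from IH[OF False this] have elim: "eliminable (V - {w}) (insert (a, b) E)" .
  have "v \<in> {a, b}" if v: "v \<in> V - {w}" "(v, w) \<in> E \<or> (w, v) \<in> E" for v
  proof -
    have "w \<in> V" using V t by blast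
    then obtain t' where "t' \<in> N" "v \<in> bag t'" "w \<in> bag t'"
      using v cover[of v w] cover[of w v] by blast
    then show ?thesis using only ab(3) v by blast
  qed
  from eliminable.eliminate[OF _ ab(1,2) this elim] have "eliminable (insert w (V - {w})) E" by blast
  moreover have "insert w (V - {w}) = V" using V t by blast
  ultimately show ?thesis by simp
qed

text \<open>An inner induction on the bag size of the last leaf removes private vertices until the
  bag is contained in that of its neighbour; then the leaf is dropped and the outer induction takes
  over. In a one-node tree every vertex is private.\<close>

lemma eliminable_if_small_decomposition:
  assumes "grown_tree N R" "small_decomposition N R bag V E" "V \<noteq> {}"
  shows "eliminable V E"
  using assms
proof (induction N R arbitrary: bag V E rule: grown_tree.induct)
  case (single t)
  then show ?case
  proof (induction "card (bag t)" arbitrary: bag V E rule: less_induct)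
    case less
    then have V: "V = bag t" "finite (bag t)" by (simp_all add: small_decomposition_def)
    then obtain w where w: "w \<in> bag t" using less.prems by blast
    show ?case
    proof (rule eliminate_private_vertex[OF less.prems(1) _ w])
      fix E' assume *: "V - {w} \<noteq> {}" "small_decomposition {t} {} (bag(t := bag t - {w})) (V - {w}) E'"
      have "card (bag t - {w}) < card (bag t)" by (rule card_Diff1_less[OF V(2) w])
      then show "eliminable (V - {w}) E'" by (intro less.hyps[OF _ *(2,1)]) simp
    qed simp_all
  qed
next
  case (grow N R t s)
  let ?N = "insert t N" and ?R = "insert (t, s) (insert (s, t) R)"
  have leaf: "y = s" if "(t, y) \<in> ?R \<or> (y, t) \<in> ?R" for y
    using that grow.hyps grown_tree_subset[OF grow.hyps(1)] by blast
  have ts: "t \<noteq> s" using grow.hyps by blast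
  from grow.prems show ?case
  proof (induction "card (bag t)" arbitrary: bag V E rule: less_induct)
    case less
    note dec = less.prems(1)[unfolded small_decomposition_def]
    have fin: "finite (bag t)" using dec by simp
    show ?case
    proof (cases "bag t \<subseteq> bag s")
      case True
      have "small_decomposition N R bag V E"
        unfolding small_decomposition_def
      proof (intro conjI ballI impI)
        show "V = (\<Union>t\<in>N. bag t)" using dec True grow.hyps(3) by auto
      next
        fix u v assume "u \<in> V" "v \<in> V" "u \<noteq> v" "(u, v) \<in> E"
        then obtain t' where "t' \<in> ?N" "u \<in> bag t'" "v \<in> bag t'" using dec by blast
        then show "\<exists>t\<in>N. u \<in> bag t \<and> v \<in> bag t" using True grow.hyps(3) by blast
      next
        fix v assume "v \<in> V"
        then have "linked ?R {t' \<in> ?N. v \<in> bag t'}" using dec by blast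
        from linked_remove_leaf[OF this leaf ts]
        have "linked ?R ({t' \<in> ?N. v \<in> bag t'} - {t})" by blast
        moreover have "{t' \<in> ?N. v \<in> bag t'} - {t} = {t' \<in> N. v \<in> bag t'}"
          using grow.hyps(2) by blast
        moreover have "?R \<inter> A \<times> A = R \<inter> A \<times> A" if "A \<subseteq> N" for A
          using that grow.hyps(2) by blast
        ultimately show "linked R {t \<in> N. v \<in> bag t}" unfolding linked_def by simp
      qed (use dec in simp_all)
      then show ?thesis using less.prems(2) by (rule grow.IH)
    next
      case False
      then obtain w where w: "w \<in> bag t" "w \<notin> bag s" by blast
      show ?thesis
      proof (rule eliminate_private_vertex[OF less.prems(1) _ w(1)])
        have "w \<in> V" using dec w by blast
        then have "linked ?R {t' \<in> ?N. w \<in> bag t'}" using dec by blast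
        then have "{t' \<in> ?N. w \<in> bag t'} = {t}"
        proof (rule linked_isolated)
          show "t \<in> {t' \<in> ?N. w \<in> bag t'}" "s \<notin> {t' \<in> ?N. w \<in> bag t'}" using w by simp_all
          show "y = s" if "(t, y) \<in> ?R" for y using leaf that by blast
        qed
        then show "t' = t" if "t' \<in> ?N" "w \<in> bag t'" for t'
          using that by blast
      next
        fix E' assume *: "V - {w} \<noteq> {}" "small_decomposition ?N ?R (bag(t := bag t - {w})) (V - {w}) E'"
        have "card (bag t - {w}) < card (bag t)" by (rule card_Diff1_less[OF fin w(1)])
        then show "eliminable (V - {w}) E'" by (intro less.hyps[OF _ *(2,1)]) simp
      qed simp
    qed
  qed
qed

section \<open>Connected graphs without cycles grow leaf by leaf\<close>

definition has_cycle :: "('t \<times> 't) set \<Rightarrow> bool" where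
  "has_cycle R \<longleftrightarrow> (\<exists>xs. distinct xs \<and> 3 \<le> length xs \<and>
     successively (\<lambda>x y. (x, y) \<in> R) xs \<and> (last xs, hd xs) \<in> R)"

text \<open>The first vertex of a longest path is a leaf: a second neighbour off the path would
  prolong it, and one further along the path would close a cycle.\<close>

lemma ex_leaf:
  assumes "finite N" "R \<subseteq> N \<times> N" "sym R" "irrefl R" "\<not> has_cycle R" "(x, y) \<in> R"
  obtains t s where "(t, s) \<in> R" "\<And>z. (t, z) \<in> R \<Longrightarrow> z = s"
proof -
  define path where "path xs \<longleftrightarrow> distinct xs \<and> set xs \<subseteq> N \<and> successively (\<lambda>x y. (x, y) \<in> R) xs" for xs
  have "path [x, y]" using assms(2,4,6) by (auto simp: path_def irrefl_def)
  moreover have "length xs < Suc (card N)" if "path xs" for xs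
    using that assms(1) unfolding path_def by (metis card_mono distinct_card less_Suc_eq_le)
  ultimately obtain xs where xs: "path xs" and longest: "\<And>ys. path ys \<Longrightarrow> length ys \<le> length xs"
    using ex_has_greatest_nat[of path "[x, y]" length] by blast
  \<comment> \<open>Comparison with the path \<open>[x, y]\<close> guarantees a second vertex, the
    neighbour \<open>s\<close>.\<close>
  have "2 \<le> length xs" using longest[OF \<open>path [x, y]\<close>] by simp
  then obtain t s rest where rest: "xs = t # s # rest"
    by (metis Suc_le_length_iff numeral_2_eq_2)
  have "(t, s) \<in> R" using xs rest by (simp add: path_def)
  moreover have "z = s" if z: "(t, z) \<in> R" for z
  proof (rule ccontr)
    assume "z \<noteq> s"
    have "(z, t) \<in> R" "z \<in> N" using z assms(2,3) by (auto dest: symD)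
    have "z \<in> set xs"
    proof (rule ccontr)
      assume "z \<notin> set xs"
      then have "path (z # xs)"
        using xs rest \<open>(z, t) \<in> R\<close> \<open>z \<in> N\<close> by (simp add: path_def)
      from longest[OF this] show False by simp
    qed
    moreover have "z \<noteq> t" using z assms(4) by (auto simp: irrefl_def)
    ultimately have "z \<in> set rest" using rest \<open>z \<noteq> s\<close> by simp
    then obtain ps qs where "rest = ps @ z # qs" by (meson split_list)
    then have "xs = (t # s # ps @ [z]) @ qs" using rest by simp
    then have "distinct (t # s # ps @ [z])" "successively (\<lambda>x y. (x, y) \<in> R) (t # s # ps @ [z])"
      using xs unfolding path_def by (simp_all only: distinct_append successively_append_iff)
    then have "has_cycle R"
      unfolding has_cycle_def using \<open>(z, t) \<in> R\<close> by (intro exI[of _ "t # s # ps @ [z]"]) simp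
    then show False using assms(5) by blast
  qed
  ultimately show thesis by (rule that)
qed

text \<open>Removing a leaf keeps the rest linked and free of cycles, so induction on the number of
  nodes builds the growth order backwards.\<close>

lemma grown_tree_if_no_cycle:
  assumes "finite N" "N \<noteq> {}" "R \<subseteq> N \<times> N" "sym R" "irrefl R" "linked R N" "\<not> has_cycle R"
  shows "grown_tree N R"
  using assms
proof (induction "card N" arbitrary: N R rule: less_induct)
  case less
  show ?case
  proof (cases "\<exists>x. N = {x}")
    case True
    then obtain x where "N = {x}" by blast
    moreover then have "R = {}" using less.prems(3,5) by (auto simp: irrefl_def)
    ultimately show ?thesis by (simp add: grown_tree.single)
  next
    case False
    then obtain x y where xy: "x \<in> N" "y \<in> N" "x \<noteq> y" using less.prems(2) by blast
    then have "(x, y) \<in> (R \<inter> N \<times> N)\<^sup>*" using less.prems(6) by (simp add: linked_def)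
    then obtain z where "(x, z) \<in> R" using xy(3) by (auto elim: converse_rtranclE)
    then obtain t s where ts: "(t, s) \<in> R" and nbr: "\<And>z. (t, z) \<in> R \<Longrightarrow> z = s"
      using ex_leaf[OF less.prems(1,3,4,5,7)] by blast
    have tsN: "t \<in> N" "s \<in> N" "t \<noteq> s" "(s, t) \<in> R"
      using ts less.prems(3-5) by (auto simp: irrefl_def dest: symD)
    have leaf: "z = s" if "(t, z) \<in> R \<or> (z, t) \<in> R" for z
      using that nbr less.prems(4) by (auto dest: symD)
    let ?N = "N - {t}" let ?R = "R \<inter> ?N \<times> ?N"
    have "grown_tree ?N ?R"
    proof (rule less.hyps)
      show "card ?N < card N" using less.prems(1) tsN(1) by (rule card_Diff1_less)
      show "?N \<noteq> {}" using tsN by blast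
      have "linked R ?N" using linked_remove_leaf[OF less.prems(6) leaf tsN(3)] by blast
      then show "linked ?R ?N" unfolding linked_def by (simp add: inf.assoc)
      show "\<not> has_cycle ?R"
      proof
        assume "has_cycle ?R"
        then obtain xs where "distinct xs" "3 \<le> length xs"
          "successively (\<lambda>x y. (x, y) \<in> ?R) xs" "(last xs, hd xs) \<in> ?R"
          unfolding has_cycle_def by blast
        moreover have "successively (\<lambda>x y. (x, y) \<in> R) xs"
          using calculation(3) by (rule successively_mono) simp
        ultimately show False using less.prems(7) unfolding has_cycle_def by blast
      qed
    qed (use less.prems in \<open>auto simp: sym_def irrefl_def\<close>)
    from grown_tree.grow[OF this, of t s] tsN
    have "grown_tree (insert t ?N) (insert (t, s) (insert (s, t) ?R))" by blast
    moreover have "insert t ?N = N" using tsN by blast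
    moreover have "insert (t, s) (insert (s, t) ?R) = R"
      using ts tsN leaf less.prems(3) by blast
    ultimately show ?thesis by simp
  qed
qed

section \<open>From the library notions of connectivity, cycle and treewidth\<close>

lemma pair_graph_facts:
  assumes "pair_graph G"
  shows "finite (pverts G)" "finite (parcs G)" "parcs G \<subseteq> pverts G \<times> pverts G" "sym (parcs G)" "irrefl (parcs G)"
proof -
  interpret pair_graph G by (rule assms)
  show "finite (pverts G)" "finite (parcs G)" by (rule pair_finite_verts, rule pair_finite_arcs)
  show "parcs G \<subseteq> pverts G \<times> pverts G" using wellformed' by auto
  show "sym (parcs G)" using pair_sym_arcs by (simp add: symmetric_def)
  show "irrefl (parcs G)" using pair_no_loops[of "(a, a)" for a] by (auto simp: irrefl_def)
qed

lemma connected_rtrancl: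
  assumes "Digraph_Component.connected G" "u \<in> verts G" "v \<in> verts G"
  shows "(u, v) \<in> (\<Union>e\<in>arcs G. {(tail G e, head G e), (head G e, tail G e)})\<^sup>*"
proof -
  have "u \<rightarrow>\<^sup>*\<^bsub>with_proj (mk_symmetric G)\<^esub> v"
    using assms unfolding Digraph_Component.connected_def strongly_connected_def
    by (simp add: mk_symmetric_def)
  from reachable_rtranclI[OF this] show ?thesis by (simp add: mk_symmetric_def)
qed

lemma linked_if_connected:
  assumes "sym (parcs T)" "Digraph_Component.connected (with_proj T \<restriction> A)"
  shows "linked (parcs T) A"
  unfolding linked_def
proof (intro ballI)
  fix x y assume "x \<in> A" "y \<in> A"
  let ?G = "with_proj T \<restriction> A"
  have "(x, y) \<in> (\<Union>e\<in>arcs ?G. {(tail ?G e, head ?G e), (head ?G e, tail ?G e)})\<^sup>*"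
    using connected_rtrancl[OF assms(2)] \<open>x \<in> A\<close> \<open>y \<in> A\<close> by simp
  also have "\<dots> \<subseteq> (parcs T \<inter> A \<times> A)\<^sup>*"
    using assms(1) by (intro rtrancl_mono) (auto dest: symD)
  finally show "(x, y) \<in> (parcs T \<inter> A \<times> A)\<^sup>*" .
qed

lemma pcas_zip: "pcas u (zip (u # ys) (ys @ [w])) w"
  by (induction ys arbitrary: u) simp_all

lemma pawalk_verts_zip: "pawalk_verts u (zip (u # ys) (ys @ [w])) = u # ys @ [w]"
  by (induction ys arbitrary: u) simp_all

lemma set_zip_path:
  "successively (\<lambda>x y. (x, y) \<in> R) (u # ys) \<Longrightarrow> (last (u # ys), w) \<in> R \<Longrightarrow>
    set (zip (u # ys) (ys @ [w])) \<subseteq> R"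
  by (induction ys arbitrary: u) auto

lemma grown_tree_if_undirected_tree:
  assumes "undirected_tree T"
  shows "grown_tree (pverts T) (parcs T)"
proof (rule grown_tree_if_no_cycle)
  have T: "pair_graph T" "Digraph_Component.connected (with_proj T)"
    "\<nexists>p. pre_digraph.cycle (with_proj T) p \<and> 3 \<le> length p"
    using assms unfolding undirected_tree_def by blast+
  note facts = pair_graph_facts[OF T(1)]
  show "finite (pverts T)" "parcs T \<subseteq> pverts T \<times> pverts T" "sym (parcs T)" "irrefl (parcs T)"
    using facts by blast+
  show "pverts T \<noteq> {}"
    using T(2) unfolding Digraph_Component.connected_def strongly_connected_def
    by (simp add: mk_symmetric_def)
  show "linked (parcs T) (pverts T)"
  proof -
    have "(\<Union>e\<in>parcs T. {(fst e, snd e), (snd e, fst e)}) \<subseteq> parcs T \<inter> pverts T \<times> pverts T"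
      using facts(3,4) by (auto dest: symD)
    from rtrancl_mono[OF this] connected_rtrancl[OF T(2)] show ?thesis
      unfolding linked_def by (auto simp del: UN_simps)
  qed
  show "\<not> has_cycle (parcs T)"
  proof
    assume "has_cycle (parcs T)"
    then obtain xs where xs: "distinct xs" "3 \<le> length xs"
      "successively (\<lambda>x y. (x, y) \<in> parcs T) xs" "(last xs, hd xs) \<in> parcs T"
      unfolding has_cycle_def by blast
    then obtain u ys where u: "xs = u # ys" by (cases xs) auto
    \<comment> \<open>The library describes cycles as lists of arcs: each vertex is paired with its
      successor, and the last one with \<open>u\<close>.\<close>
    let ?p = "zip (u # ys) (ys @ [u])"
    have "u \<in> pverts T" using xs(4) u facts(3) by auto
    moreover have "set ?p \<subseteq> parcs T" using xs u by (intro set_zip_path) simp_all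
    moreover have "distinct (ys @ [u])" using xs(1) u by simp
    moreover have "?p \<noteq> []" by (cases ys) simp_all
    ultimately have "pre_digraph.cycle (with_proj T) ?p"
      unfolding pre_digraph.cycle_def pre_digraph.awalk_def cas_with_proj_eq awalk_verts_with_proj_eq
      using pcas_zip[of u ys u] pawalk_verts_zip[of u ys u]
      by (intro exI[of _ u]) simp
    moreover have "3 \<le> length ?p" using xs(2) u by simp
    ultimately show False using T(3) by blast
  qed
qed

lemma ex_decomposition_treewidth:
  assumes "pair_graph F"
  obtains T :: "nat pair_pre_digraph" and bag where "tree_decomposition F T bag"
    "\<forall>t\<in>pverts T. card (bag t) \<le> treewidth F + 1"
proof -
  \<comment> \<open>\<open>LEAST\<close> has a meaning only if some width is attained; a single node
    whose bag contains all vertices provides one.\<close>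
  let ?T = "\<lparr>pverts = {0}, parcs = {}\<rparr> :: nat pair_pre_digraph"
  have T: "pair_graph ?T"
    by unfold_locales (auto simp: symmetric_def sym_def)
  have conn: "Digraph_Component.connected (with_proj ?T)"
    unfolding Digraph_Component.connected_def strongly_connected_def
    by (simp add: mk_symmetric_def reachable_def)
  have restrict: "with_proj ?T \<restriction> {0} = with_proj ?T"
    by (simp add: induce_subgraph_def with_proj_def)
  have "tree_decomposition F ?T (\<lambda>_. pverts F)"
    unfolding tree_decomposition_def undirected_tree_def
  proof (intro conjI T conn notI)
    assume "\<exists>p. pre_digraph.cycle (with_proj ?T) p \<and> 3 \<le> length p"
    then show False by (auto simp: pre_digraph.cycle_def pre_digraph.awalk_def)
  next
    show "\<forall>(u, v)\<in>parcs F. \<exists>t\<in>pverts ?T. u \<in> pverts F \<and> v \<in> pverts F"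
      using pair_graph_facts(3)[OF assms] by auto
  next
    show "\<forall>v\<in>pverts F. Digraph_Component.connected (with_proj ?T \<restriction> {t \<in> pverts ?T. v \<in> pverts F})"
    proof
      fix v assume "v \<in> pverts F"
      then have "{t \<in> pverts ?T. v \<in> pverts F} = {0}" by auto
      then show "Digraph_Component.connected (with_proj ?T \<restriction> {t \<in> pverts ?T. v \<in> pverts F})"
        using conn by (simp only: restrict)
    qed
  qed simp
  then have "\<exists>(T :: nat pair_pre_digraph) bag. tree_decomposition F T bag \<and>
      (\<forall>t\<in>pverts T. card (bag t) \<le> card (pverts F) + 1)"
    by (intro exI[of _ ?T] exI[of _ "\<lambda>_. pverts F"]) simp
  then have "\<exists>(T :: nat pair_pre_digraph) bag. tree_decomposition F T bag \<and>
      (\<forall>t\<in>pverts T. card (bag t) \<le> treewidth F + 1)"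
    unfolding treewidth_def by (rule LeastI)
  then show thesis using that by blast
qed

lemma eliminable_if_treewidth_le_2:
  assumes F: "pair_graph F" "treewidth F \<le> 2" "pverts F \<noteq> {}"
  shows "eliminable (pverts F) (parcs F)"
proof -
  obtain T :: "nat pair_pre_digraph" and bag where dec: "tree_decomposition F T bag"
    and card: "\<forall>t\<in>pverts T. card (bag t) \<le> treewidth F + 1"
    by (rule ex_decomposition_treewidth[OF F(1)])
  have T: "undirected_tree T" "(\<Union>t\<in>pverts T. bag t) = pverts F"
    "\<forall>(u, v)\<in>parcs F. \<exists>t\<in>pverts T. u \<in> bag t \<and> v \<in> bag t"
    "\<forall>v\<in>pverts F. Digraph_Component.connected (with_proj T \<restriction> {t \<in> pverts T. v \<in> bag t})"
    using dec unfolding tree_decomposition_def by blast+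
  have "sym (parcs T)"
    using T(1) unfolding undirected_tree_def by (blast intro: pair_graph_facts(4))
  then have "small_decomposition (pverts T) (parcs T) bag (pverts F) (parcs F)"
    unfolding small_decomposition_def
  proof (intro conjI ballI impI)
    fix t assume t: "t \<in> pverts T"
    show "finite (bag t)"
      by (rule finite_subset[OF _ pair_graph_facts(1)[OF F(1)]]) (use t T(2) in blast)
    show "card (bag t) \<le> 3" using card F(2) t by fastforce
  qed (use T linked_if_connected in blast)+
  from eliminable_if_small_decomposition[OF grown_tree_if_undirected_tree[OF T(1)] this F(3)]
  show ?thesis .
qed

section \<open>Counting homomorphisms\<close>

definition homs :: "'a pair_pre_digraph \<Rightarrow> 'b pair_pre_digraph \<Rightarrow> ('a \<Rightarrow> 'b) set" where
  "homs H G = {\<phi> \<in> pverts H \<rightarrow>\<^sub>E pverts G. \<forall>(u, v)\<in>parcs H. (\<phi> u, \<phi> v) \<in> parcs G}"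

lemma finite_homs: "finite (pverts H) \<Longrightarrow> finite (pverts G) \<Longrightarrow> finite (homs H G)"
  unfolding homs_def by (rule finite_subset[OF _ finite_PiE]) auto

definition hom_count :: "'a pair_pre_digraph \<Rightarrow> nat \<Rightarrow> nat pair_pre_digraph \<Rightarrow> int" where
  "hom_count F n G = partition_sum n (pverts F)
     (\<lambda>u v i j. if (u, v) \<in> parcs F then if (i, j) \<in> parcs G then 1 else 0 else 1)"

lemma prod_of_bool:
  "finite A \<Longrightarrow> (\<Prod>x\<in>A. if P x then 1 else 0 :: int) = (if \<forall>x\<in>A. P x then 1 else 0)"
  by (induction A rule: finite_induct) auto

lemma sum_of_bool_card:
  "finite A \<Longrightarrow> (\<Sum>x\<in>A. if P x then 1 else 0 :: int) = int (card {x \<in> A. P x})"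
  by (simp add: sum.If_cases Int_def)

lemma hom_count_eq:
  assumes "pair_graph F" "graph_on n G"
  shows "hom_count F n G = int (card (homs F G))"
proof -
  note F = pair_graph_facts[OF assms(1)]
  have "hom_count F n G = (\<Sum>\<phi>\<in>pverts F \<rightarrow>\<^sub>E {..<n}.
      if \<forall>u\<in>pverts F. \<forall>v\<in>pverts F. (u, v) \<in> parcs F \<longrightarrow> (\<phi> u, \<phi> v) \<in> parcs G then 1 else 0)"
    unfolding hom_count_def partition_sum_def
  proof (rule sum.cong[OF refl])
    fix \<phi>
    have "(\<Prod>u\<in>pverts F. \<Prod>v\<in>pverts F.
          if (u, v) \<in> parcs F then if (\<phi> u, \<phi> v) \<in> parcs G then 1 else 0 else 1) =
        (\<Prod>u\<in>pverts F. \<Prod>v\<in>pverts F.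
          if (u, v) \<in> parcs F \<longrightarrow> (\<phi> u, \<phi> v) \<in> parcs G then 1 else 0 :: int)"
      by (intro prod.cong refl) simp
    then show "(\<Prod>u\<in>pverts F. \<Prod>v\<in>pverts F.
          if (u, v) \<in> parcs F then if (\<phi> u, \<phi> v) \<in> parcs G then 1 else 0 else 1) =
        (if \<forall>u\<in>pverts F. \<forall>v\<in>pverts F. (u, v) \<in> parcs F \<longrightarrow> (\<phi> u, \<phi> v) \<in> parcs G
         then 1 else 0 :: int)"
      by (simp only: prod_of_bool[OF F(1)])
  qed
  also have "\<dots> = int (card {\<phi> \<in> pverts F \<rightarrow>\<^sub>E {..<n}.
      \<forall>u\<in>pverts F. \<forall>v\<in>pverts F. (u, v) \<in> parcs F \<longrightarrow> (\<phi> u, \<phi> v) \<in> parcs G})"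
    by (rule sum_of_bool_card) (simp add: finite_PiE F(1))
  also have "{\<phi> \<in> pverts F \<rightarrow>\<^sub>E {..<n}.
      \<forall>u\<in>pverts F. \<forall>v\<in>pverts F. (u, v) \<in> parcs F \<longrightarrow> (\<phi> u, \<phi> v) \<in> parcs G} = homs F G"
    using F(3) assms(2) by (auto simp: homs_def graph_on_def atLeast0LessThan)
  finally show ?thesis .
qed

lemma computable_scalar_hom_count:
  assumes \<omega>: "matmul_exponent \<omega>" and F: "pair_graph F" "treewidth F \<le> 2"
  shows "computable_scalar \<omega> (hom_count F)"
proof (cases "pverts F = {}")
  \<comment> \<open>The empty map is the only homomorphism; elimination itself starts from at least
    one vertex.\<close>
  case True
  then have "hom_count F = (\<lambda>n G. 1)"
    by (intro ext) (simp add: hom_count_def partition_sum_def)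
  then show ?thesis using computable_scalar_const[OF matmul_exponent_ge_2[OF \<omega>], of 1] by simp
next
  case False
  define M :: "'a \<Rightarrow> 'a \<Rightarrow> nat \<Rightarrow> nat pair_pre_digraph \<Rightarrow> nat \<Rightarrow> nat \<Rightarrow> int" where
    "M u v n G i j = (if (u, v) \<in> parcs F then if (i, j) \<in> parcs G then 1 else 0 else 1)" for u v n G i j
  have "computable_matrix \<omega> (M u v)" for u v
    unfolding M_def using computable_matrix_const[OF matmul_exponent_ge_2[OF \<omega>]]
      computable_matrix_adjacency[OF matmul_exponent_ge_2[OF \<omega>]]
    by (cases "(u, v) \<in> parcs F") simp_all
  from computable_scalar_partition_sum[OF \<omega> eliminable_if_treewidth_le_2[OF F False] this]
  have "computable_scalar \<omega> (\<lambda>n G. partition_sum n (pverts F) (\<lambda>u v. M u v n G))"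
    by (simp add: M_def)
  then show ?thesis unfolding hom_count_def M_def .
qed

section \<open>Injective homomorphisms by inclusion and exclusion\<close>

text \<open>Ordered pairs list each identification twice. This is harmless, since the factors in the
  product below are 0 or 1 and hence idempotent.\<close>

definition distinct_pairs :: "'a set \<Rightarrow> ('a \<times> 'a) set" where
  "distinct_pairs V = {(u, v) \<in> V \<times> V. u \<noteq> v}"

lemma finite_distinct_pairs: "finite V \<Longrightarrow> finite (distinct_pairs V)"
  unfolding distinct_pairs_def by (rule finite_subset[of _ "V \<times> V"]) auto

definition constant_along :: "('a \<times> 'a) set \<Rightarrow> ('a \<Rightarrow> 'b) \<Rightarrow> bool" where
  "constant_along S \<phi> \<longleftrightarrow> (\<forall>(u, v)\<in>S. \<phi> u = \<phi> v)"

text \<open>Injectivity is the product of the factors \<open>1 - [\<phi> u = \<phi> v]\<close> over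
  all pairs; multiplying out gives one signed term for each set of pairs.\<close>

lemma inj_on_inclusion_exclusion:
  assumes "finite V"
  shows "(if inj_on \<phi> V then 1 else 0 :: int) =
    (\<Sum>S\<in>Pow (distinct_pairs V). (-1) ^ card S * (if constant_along S \<phi> then 1 else 0))"
proof -
  let ?D = "distinct_pairs V"
  let ?e = "\<lambda>(u, v). if \<phi> u = \<phi> v then 1 else 0 :: int"
  note fin = finite_distinct_pairs[OF assms]
  have "(if inj_on \<phi> V then 1 else 0 :: int) = (\<Prod>p\<in>?D. if \<phi> (fst p) \<noteq> \<phi> (snd p) then 1 else 0)"
    unfolding prod_of_bool[OF fin] by (auto simp: distinct_pairs_def inj_on_def)
  also have "\<dots> = (\<Prod>p\<in>?D. - ?e p + 1)"
    by (intro prod.cong refl) auto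
  also have "\<dots> = (\<Sum>S\<in>Pow ?D. (\<Prod>p\<in>S. - ?e p) * (\<Prod>p\<in>?D - S. 1))"
    by (rule prod_add[OF fin])
  also have "\<dots> = (\<Sum>S\<in>Pow ?D. (-1) ^ card S * (if constant_along S \<phi> then 1 else 0))"
  proof (rule sum.cong[OF refl])
    fix S assume "S \<in> Pow ?D"
    then have "finite S" using fin by (auto intro: finite_subset)
    have "(\<Prod>p\<in>S. - ?e p) = (\<Prod>p\<in>S. - 1 * ?e p)" by simp
    also have "\<dots> = (-1) ^ card S * (\<Prod>p\<in>S. ?e p)"
      unfolding prod.distrib by simp
    also have "(\<Prod>p\<in>S. ?e p) = (\<Prod>p\<in>S. if \<phi> (fst p) = \<phi> (snd p) then 1 else 0)"
      by (intro prod.cong refl) (simp add: case_prod_unfold)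
    also have "\<dots> = (if constant_along S \<phi> then 1 else 0)"
      unfolding prod_of_bool[OF \<open>finite S\<close>] by (simp add: constant_along_def case_prod_unfold)
    finally show "(\<Prod>p\<in>S. - ?e p) * (\<Prod>p\<in>?D - S. 1) =
        (-1) ^ card S * (if constant_along S \<phi> then 1 else 0)" by simp
  qed
  finally show ?thesis .
qed

text \<open>For \<open>S\<close> within \<open>V\<close>, the least equivalence relation on
  \<open>V\<close> that contains \<open>S\<close>. The intersection is needed since the reflexive
  closure ranges over the whole type.\<close>

definition closure_on :: "'a set \<Rightarrow> ('a \<times> 'a) set \<Rightarrow> ('a \<times> 'a) set" where
  "closure_on V S = (S \<union> S\<inverse>)\<^sup>* \<inter> V \<times> V"

lemma equiv_closure_on: "equiv V (closure_on V S)"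
proof (rule equivI)
  have "sym ((S \<union> S\<inverse>)\<^sup>*)" by (rule sym_rtrancl) (auto simp: sym_def)
  then show "sym (closure_on V S)" by (auto simp: closure_on_def sym_def)
  show "trans (closure_on V S)" by (auto simp: closure_on_def trans_def)
qed (auto simp: closure_on_def refl_on_def)

text \<open>Having equal values is itself an equivalence relation, so it passes from
  \<open>S\<close> to the relation generated by \<open>S\<close>.\<close>

lemma constant_along_closure:
  assumes "S \<subseteq> V \<times> V"
  shows "constant_along S \<phi> \<longleftrightarrow> (\<forall>(u, v)\<in>closure_on V S. \<phi> u = \<phi> v)"
proof
  assume const: "constant_along S \<phi>"
  have "\<phi> u = \<phi> v" if "(u, v) \<in> (S \<union> S\<inverse>)\<^sup>*" for u v
    using that by (induction rule: rtrancl_induct) (use const in \<open>auto simp: constant_along_def\<close>)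
  then show "\<forall>(u, v)\<in>closure_on V S. \<phi> u = \<phi> v" by (auto simp: closure_on_def)
next
  assume "\<forall>(u, v)\<in>closure_on V S. \<phi> u = \<phi> v"
  moreover have "S \<subseteq> closure_on V S" using assms by (auto simp: closure_on_def)
  ultimately show "constant_along S \<phi>" by (auto simp: constant_along_def)
qed

lemma pair_graph_quotient:
  assumes H: "pair_graph H" and \<rho>: "partition_on (pverts H) \<rho>" "\<forall>B\<in>\<rho>. independent_set H B"
  shows "pair_graph (quotient_graph H \<rho>)"
proof
  note facts = pair_graph_facts[OF H]
  have fin: "finite \<rho>" using finite_elements[OF facts(1) \<rho>(1)] .
  then show "finite (pverts (quotient_graph H \<rho>))" by (simp add: quotient_graph_def)
  show "finite (parcs (quotient_graph H \<rho>))"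
    by (rule finite_subset[of _ "\<rho> \<times> \<rho>"]) (use fin in \<open>auto simp: quotient_graph_def\<close>)
  show "symmetric (with_proj (quotient_graph H \<rho>))"
    using facts(4) by (auto simp: symmetric_def quotient_graph_def sym_def)
  show "fst e \<noteq> snd e" if "e \<in> parcs (quotient_graph H \<rho>)" for e
    using that \<rho>(2) by (auto simp: quotient_graph_def independent_set_def)
qed (auto simp: quotient_graph_def)

text \<open>A homomorphism that is constant on the classes factors uniquely through the quotient.\<close>

lemma card_homs_quotient:
  assumes r: "equiv (pverts H) r" and H: "parcs H \<subseteq> pverts H \<times> pverts H"
  shows "card {\<phi> \<in> homs H G. \<forall>(u, v)\<in>r. \<phi> u = \<phi> v} =
    card (homs (quotient_graph H (pverts H // r)) G)"
proof -
  let ?V = "pverts H" and ?Q = "quotient_graph H (pverts H // r)"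
  define lift where "lift \<psi> = (\<lambda>v\<in>?V. \<psi> (r `` {v}))" for \<psi> :: "'a set \<Rightarrow> 'b"
  have Q: "pverts ?Q = ?V // r" by (simp add: quotient_graph_def)
  have cls: "r `` {v} \<in> ?V // r" "v \<in> r `` {v}" if "v \<in> ?V" for v
    using quotientI[OF that] equiv_class_self[OF r that] by blast+
  have rV: "u \<in> ?V" "v \<in> ?V" "r `` {u} = r `` {v}" if "(u, v) \<in> r" for u v
    using that equiv_class_eq[OF r that] equivE[OF r] by blast+
  have "bij_betw lift (homs ?Q G) {\<phi> \<in> homs H G. \<forall>(u, v)\<in>r. \<phi> u = \<phi> v}"
    unfolding bij_betw_def
  proof
    show "inj_on lift (homs ?Q G)"
    proof (rule inj_onI)
      fix \<psi> \<psi>' assume \<psi>: "\<psi> \<in> homs ?Q G" "\<psi>' \<in> homs ?Q G" "lift \<psi> = lift \<psi>'"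
      show "\<psi> = \<psi>'"
      proof (rule PiE_ext)
        show "\<psi> \<in> (?V // r) \<rightarrow>\<^sub>E pverts G" "\<psi>' \<in> (?V // r) \<rightarrow>\<^sub>E pverts G"
          using \<psi>(1,2) unfolding homs_def Q by blast+
        fix B assume "B \<in> ?V // r"
        then obtain v where v: "v \<in> ?V" "B = r `` {v}" by (auto elim: quotientE)
        from \<psi>(3) have "lift \<psi> v = lift \<psi>' v" by simp
        then show "\<psi> B = \<psi>' B" using v by (simp add: lift_def)
      qed
    qed
    show "lift ` homs ?Q G = {\<phi> \<in> homs H G. \<forall>(u, v)\<in>r. \<phi> u = \<phi> v}"
    proof (intro equalityI subsetI)
      fix \<phi> assume "\<phi> \<in> lift ` homs ?Q G"
      then obtain \<psi> where \<psi>: "\<phi> = lift \<psi>" "\<psi> \<in> (?V // r) \<rightarrow>\<^sub>E pverts G"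
        "\<And>A B. (A, B) \<in> parcs ?Q \<Longrightarrow> (\<psi> A, \<psi> B) \<in> parcs G"
        unfolding homs_def Q by blast
      have "\<phi> \<in> ?V \<rightarrow>\<^sub>E pverts G" unfolding \<psi>(1) lift_def using \<psi>(2) cls(1) by auto
      moreover have "(\<phi> u, \<phi> v) \<in> parcs G" if uv: "(u, v) \<in> parcs H" for u v
      proof -
        have "u \<in> ?V" "v \<in> ?V" using uv H by auto
        moreover then have "(r `` {u}, r `` {v}) \<in> parcs ?Q"
          using uv cls unfolding quotient_graph_def by auto
        ultimately show ?thesis using \<psi>(1,3) by (simp add: lift_def)
      qed
      moreover have "\<phi> u = \<phi> v" if "(u, v) \<in> r" for u v
        using rV[OF that] by (simp add: \<psi>(1) lift_def)
      ultimately show "\<phi> \<in> {\<phi> \<in> homs H G. \<forall>(u, v)\<in>r. \<phi> u = \<phi> v}"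
        unfolding homs_def by auto
    next
      fix \<phi> assume "\<phi> \<in> {\<phi> \<in> homs H G. \<forall>(u, v)\<in>r. \<phi> u = \<phi> v}"
      then have \<phi>: "\<phi> \<in> ?V \<rightarrow>\<^sub>E pverts G" "\<And>u v. (u, v) \<in> parcs H \<Longrightarrow> (\<phi> u, \<phi> v) \<in> parcs G"
        "\<And>u v. (u, v) \<in> r \<Longrightarrow> \<phi> u = \<phi> v"
        unfolding homs_def by auto
      define \<psi> where "\<psi> = (\<lambda>B\<in>?V // r. \<phi> (SOME v. v \<in> B))"
      have \<psi>: "\<psi> B = \<phi> v" if "B \<in> ?V // r" "v \<in> B" for B v
      proof -
        have "(SOME v. v \<in> B) \<in> B" using that(2) by (rule someI)
        then have "((SOME v. v \<in> B), v) \<in> r"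
          using that r quotient_eq_iff by (metis (no_types, lifting))
        then show ?thesis using \<phi>(3) that(1) by (simp add: \<psi>_def)
      qed
      have "\<psi> \<in> (?V // r) \<rightarrow>\<^sub>E pverts G"
      proof (rule PiE_I)
        fix B assume B: "B \<in> ?V // r"
        then obtain v where v: "v \<in> ?V" "B = r `` {v}" by (auto elim: quotientE)
        then have "\<psi> B = \<phi> v" using \<psi>[OF B] cls(2) by simp
        then show "\<psi> B \<in> pverts G" using \<phi>(1) v(1) by auto
      qed (simp add: \<psi>_def)
      moreover have "(\<psi> A, \<psi> B) \<in> parcs G" if AB: "(A, B) \<in> parcs ?Q" for A B
      proof -
        from AB obtain a b where "A \<in> ?V // r" "B \<in> ?V // r" "a \<in> A" "b \<in> B" "(a, b) \<in> parcs H"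
          by (auto simp: quotient_graph_def)
        then show ?thesis using \<psi> \<phi>(2) by simp
      qed
      ultimately have "\<psi> \<in> homs ?Q G" unfolding homs_def Q by auto
      moreover have "lift \<psi> = \<phi>"
      proof
        fix v show "lift \<psi> v = \<phi> v"
        proof (cases "v \<in> ?V")
          case True
          then show ?thesis using \<psi> cls by (simp add: lift_def)
        next
          case False
          then show ?thesis using PiE_arb[OF \<phi>(1)] by (simp add: lift_def)
        qed
      qed
      ultimately show "\<phi> \<in> lift ` homs ?Q G" by blast
    qed
  qed
  then show ?thesis by (simp add: bij_betw_same_card)
qed

lemma card_injective_homs:
  assumes H: "pair_graph H" and G: "pair_graph G"
  shows "int (card {\<phi> \<in> homs H G. inj_on \<phi> (pverts H)}) =
    (\<Sum>S\<in>Pow (distinct_pairs (pverts H)). (-1) ^ card S *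
      (if \<forall>B\<in>pverts H // closure_on (pverts H) S. independent_set H B
       then int (card (homs (quotient_graph H (pverts H // closure_on (pverts H) S)) G)) else 0))"
proof -
  let ?V = "pverts H"
  note facts = pair_graph_facts[OF H]
  have fin: "finite (homs H G)"
    using finite_homs facts(1) pair_graph_facts(1)[OF G] by blast
  have "int (card {\<phi> \<in> homs H G. inj_on \<phi> ?V}) = (\<Sum>\<phi>\<in>homs H G. if inj_on \<phi> ?V then 1 else 0)"
    using sum_of_bool_card[OF fin] by simp
  also have "\<dots> = (\<Sum>\<phi>\<in>homs H G. \<Sum>S\<in>Pow (distinct_pairs ?V).
      (-1) ^ card S * (if constant_along S \<phi> then 1 else 0))"
    unfolding inj_on_inclusion_exclusion[OF facts(1)] ..
  also have "\<dots> = (\<Sum>S\<in>Pow (distinct_pairs ?V). (-1) ^ card S *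
      (\<Sum>\<phi>\<in>homs H G. if constant_along S \<phi> then 1 else 0))"
    unfolding sum_distrib_left by (rule sum.swap)
  also have "\<dots> = (\<Sum>S\<in>Pow (distinct_pairs ?V). (-1) ^ card S *
      int (card {\<phi> \<in> homs H G. constant_along S \<phi>}))"
    unfolding sum_of_bool_card[OF fin] ..
  also have "\<dots> = (\<Sum>S\<in>Pow (distinct_pairs ?V). (-1) ^ card S *
      (if \<forall>B\<in>?V // closure_on ?V S. independent_set H B
       then int (card (homs (quotient_graph H (?V // closure_on ?V S)) G)) else 0))"
  proof (intro sum.cong refl arg_cong2[of _ _ _ _ times])
    fix S assume "S \<in> Pow (distinct_pairs ?V)"
    then have S: "S \<subseteq> ?V \<times> ?V" by (auto simp: distinct_pairs_def)
    let ?r = "closure_on ?V S"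
    have r: "equiv ?V ?r" by (rule equiv_closure_on)
    have eq: "{\<phi> \<in> homs H G. constant_along S \<phi>} = {\<phi> \<in> homs H G. \<forall>(u, v)\<in>?r. \<phi> u = \<phi> v}"
      unfolding constant_along_closure[OF S] ..
    show "int (card {\<phi> \<in> homs H G. constant_along S \<phi>}) =
        (if \<forall>B\<in>?V // ?r. independent_set H B
         then int (card (homs (quotient_graph H (?V // ?r)) G)) else 0)"
    proof (cases "\<forall>B\<in>?V // ?r. independent_set H B")
      case True
      then show ?thesis unfolding eq card_homs_quotient[OF r facts(3)] by simp
    next
      case False
      then obtain B where B: "B \<in> ?V // ?r" "\<not> independent_set H B" by blast
      then have "B \<subseteq> ?V" using r by (meson in_quotient_imp_subset)
      then obtain u v where uv: "u \<in> B" "v \<in> B" "(u, v) \<in> parcs H"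
        using B(2) unfolding independent_set_def by blast
      then have "(u, v) \<in> ?r" using quotient_eq_iff[OF r B(1) B(1)] by blast
      have "{\<phi> \<in> homs H G. \<forall>(u, v)\<in>?r. \<phi> u = \<phi> v} = {}"
      proof (rule ccontr)
        assume "{\<phi> \<in> homs H G. \<forall>(u, v)\<in>?r. \<phi> u = \<phi> v} \<noteq> {}"
        then obtain \<phi> where \<phi>: "\<phi> \<in> homs H G" "\<forall>(u, v)\<in>?r. \<phi> u = \<phi> v" by blast
        from \<phi>(2) \<open>(u, v) \<in> ?r\<close> have "\<phi> u = \<phi> v" by blast
        moreover have "(\<phi> u, \<phi> v) \<in> parcs G" using \<phi>(1) uv(3) unfolding homs_def by blast
        ultimately show False using pair_graph_facts(5)[OF G] by (simp add: irrefl_def)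
      qed
      then have "card {\<phi> \<in> homs H G. constant_along S \<phi>} = 0" unfolding eq by (simp only: card.empty)
      then show ?thesis unfolding if_not_P[OF False] by simp
    qed
  qed
  finally show ?thesis .
qed

section \<open>Subgraphs and injective homomorphisms\<close>

definition image_graph :: "('a \<Rightarrow> 'b) \<Rightarrow> 'a pair_pre_digraph \<Rightarrow> 'b pair_pre_digraph" where
  "image_graph \<phi> H = \<lparr>pverts = \<phi> ` pverts H, parcs = map_prod \<phi> \<phi> ` parcs H\<rparr>"

lemma image_graph_compose: "image_graph (\<phi> \<circ> \<psi>) H = image_graph \<phi> (image_graph \<psi> H)"
  by (simp add: image_graph_def image_comp map_prod_compose)

lemma image_graph_cong:
  assumes "parcs H \<subseteq> pverts H \<times> pverts H" "\<And>v. v \<in> pverts H \<Longrightarrow> \<phi> v = \<psi> v"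
  shows "image_graph \<phi> H = image_graph \<psi> H"
  using assms unfolding image_graph_def by (auto intro!: image_cong)

lemma image_graph_id: "image_graph (\<lambda>v. v) H = H"
  by (simp add: image_graph_def map_prod.id[unfolded id_def])

lemma image_graph_inverse:
  assumes "parcs H \<subseteq> pverts H \<times> pverts H" "inj_on \<phi> (pverts H)"
  shows "image_graph (the_inv_into (pverts H) \<phi>) (image_graph \<phi> H) = H"
proof -
  have "image_graph (the_inv_into (pverts H) \<phi> \<circ> \<phi>) H = image_graph (\<lambda>v. v) H"
    using assms by (intro image_graph_cong) (simp_all add: the_inv_into_f_f)
  then show ?thesis by (simp add: image_graph_compose image_graph_id)
qed

lemma pair_graph_image_graph:
  assumes "pair_graph H" "inj_on \<phi> (pverts H)"
  shows "pair_graph (image_graph \<phi> H)"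
proof
  note facts = pair_graph_facts[OF assms(1)]
  show "finite (pverts (image_graph \<phi> H))" "finite (parcs (image_graph \<phi> H))"
    using facts(1,2) by (simp_all add: image_graph_def)
  show "symmetric (with_proj (image_graph \<phi> H))"
    using facts(4) by (force simp: symmetric_def image_graph_def sym_def)
  show "fst e \<in> pverts (image_graph \<phi> H)" "snd e \<in> pverts (image_graph \<phi> H)"
    if "e \<in> parcs (image_graph \<phi> H)" for e
    using that facts(3) by (auto simp: image_graph_def)
  show "fst e \<noteq> snd e" if "e \<in> parcs (image_graph \<phi> H)" for e
  proof -
    from that obtain u v where "(u, v) \<in> parcs H" "e = (\<phi> u, \<phi> v)" by (auto simp: image_graph_def)
    moreover then have "u \<in> pverts H" "v \<in> pverts H" "u \<noteq> v" using facts(3,5) by (auto simp: irrefl_def)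
    ultimately show ?thesis using assms(2) by (auto dest: inj_onD)
  qed
qed

text \<open>A library isomorphism also carries maps for arcs, heads and tails. Arcs are pairs of
  vertices here, so the vertex map determines all of them.\<close>

lemma graph_iso_iff_image_graph:
  assumes "pair_graph S"
  shows "graph_iso S H \<longleftrightarrow> (\<exists>\<phi>. inj_on \<phi> (pverts S) \<and> H = image_graph \<phi> S)"
proof
  interpret S: pair_graph S by (rule assms)
  assume "graph_iso S H"
  then obtain f where f: "pre_digraph.digraph_isomorphism (with_proj S) f" "with_proj H = app_iso f (with_proj S)"
    unfolding graph_iso_def digraph_iso_def by blast
  let ?\<phi> = "iso_verts f"
  \<comment> \<open>Comparing the components of both digraphs forces the projections, and then the
    arc map must act on both ends of an arc.\<close>
  have tail: "iso_tail f = fst" and head: "iso_head f = snd"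
    and verts: "pverts H = ?\<phi> ` pverts S" and arcs: "parcs H = iso_arcs f ` parcs S"
    using arg_cong[OF f(2), of tail] arg_cong[OF f(2), of head]
      arg_cong[OF f(2), of verts] arg_cong[OF f(2), of arcs] by simp_all
  have "iso_arcs f a = map_prod ?\<phi> ?\<phi> a" if "a \<in> parcs S" for a
    using f(1) that unfolding pre_digraph.digraph_isomorphism_def tail head
    by (simp add: prod_eq_iff)
  then have "H = image_graph ?\<phi> S"
    unfolding image_graph_def using verts arcs by (intro pair_pre_digraph.equality) auto
  moreover have "inj_on ?\<phi> (pverts S)"
    using f(1) by (simp add: pre_digraph.digraph_isomorphism_def)
  ultimately show "\<exists>\<phi>. inj_on \<phi> (pverts S) \<and> H = image_graph \<phi> S" by blast
next
  interpret S: pair_graph S by (rule assms)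
  assume "\<exists>\<phi>. inj_on \<phi> (pverts S) \<and> H = image_graph \<phi> S"
  then obtain \<phi> where \<phi>: "inj_on \<phi> (pverts S)" "H = image_graph \<phi> S" by blast
  let ?f = "\<lparr>iso_verts = \<phi>, iso_arcs = map_prod \<phi> \<phi>, iso_head = snd, iso_tail = fst\<rparr>"
  have "inj_on (map_prod \<phi> \<phi>) (parcs S)"
    using map_prod_inj_on[OF \<phi>(1) \<phi>(1)] by (rule inj_on_subset) (rule pair_graph_facts(3)[OF assms])
  then have "pre_digraph.digraph_isomorphism (with_proj S) ?f"
    using \<phi>(1) S.wf_digraph by (simp add: pre_digraph.digraph_isomorphism_def)
  moreover have "with_proj H = app_iso ?f (with_proj S)"
    by (simp add: \<phi>(2) app_iso_def with_proj_def image_graph_def)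
  ultimately show "graph_iso S H" unfolding graph_iso_def digraph_iso_def by blast
qed

text \<open>Requiring the image to equal \<open>S\<close>, not just to be isomorphic to it, makes
  these sets disjoint for different \<open>S\<close>. Extensionality makes them countable as sets of
  maps on \<open>pverts H\<close>.\<close>

definition isos :: "'a pair_pre_digraph \<Rightarrow> 'b pair_pre_digraph \<Rightarrow> ('a \<Rightarrow> 'b) set" where
  "isos H S = {\<phi> \<in> extensional (pverts H). inj_on \<phi> (pverts H) \<and> image_graph \<phi> H = S}"

lemma isos_verts: "\<phi> \<in> isos H S \<Longrightarrow> \<phi> ` pverts H = pverts S"
  by (auto simp: isos_def image_graph_def)

text \<open>Composition with the fixed \<open>\<phi>\<close> carries the automorphisms of
  \<open>H\<close> bijectively onto the isomorphisms to \<open>S\<close>.\<close>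

lemma card_isos:
  assumes H: "parcs H \<subseteq> pverts H \<times> pverts H" and \<phi>: "\<phi> \<in> isos H S"
  shows "card (isos H S) = card (isos H H)"
proof -
  let ?V = "pverts H"
  let ?inv = "the_inv_into ?V \<phi>"
  have inj: "inj_on \<phi> ?V" and S: "S = image_graph \<phi> H" using \<phi> by (auto simp: isos_def)
  have "bij_betw (compose ?V \<phi>) (isos H H) (isos H S)"
    unfolding bij_betw_def
  proof
    show "inj_on (compose ?V \<phi>) (isos H H)"
    proof (rule inj_onI)
      fix \<alpha> \<beta> assume *: "\<alpha> \<in> isos H H" "\<beta> \<in> isos H H" "compose ?V \<phi> \<alpha> = compose ?V \<phi> \<beta>"
      show "\<alpha> = \<beta>"
      proof (rule extensionalityI)
        show "\<alpha> \<in> extensional ?V" "\<beta> \<in> extensional ?V" using * by (simp_all add: isos_def)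
        fix v assume v: "v \<in> ?V"
        then have "\<phi> (\<alpha> v) = \<phi> (\<beta> v)" using fun_cong[OF *(3), of v] by (simp add: compose_def)
        moreover have "\<alpha> v \<in> ?V" "\<beta> v \<in> ?V" using isos_verts[OF *(1)] isos_verts[OF *(2)] v by blast+
        ultimately show "\<alpha> v = \<beta> v" using inj by (simp add: inj_on_eq_iff)
      qed
    qed
    show "compose ?V \<phi> ` isos H H = isos H S"
    proof (intro equalityI subsetI)
      fix \<psi> assume "\<psi> \<in> compose ?V \<phi> ` isos H H"
      then obtain \<alpha> where \<alpha>: "\<alpha> \<in> isos H H" "\<psi> = compose ?V \<phi> \<alpha>" by blast
      have "image_graph \<psi> H = image_graph (\<phi> \<circ> \<alpha>) H"
        by (rule image_graph_cong[OF H]) (simp add: \<alpha>(2) compose_def)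
      also have "\<dots> = S" using \<alpha>(1) unfolding image_graph_compose S by (simp add: isos_def)
      finally have "image_graph \<psi> H = S" .
      moreover have "inj_on \<psi> ?V"
      proof -
        have "inj_on (\<phi> \<circ> \<alpha>) ?V"
          using \<alpha>(1) isos_verts[OF \<alpha>(1)] inj by (intro comp_inj_on) (simp_all add: isos_def)
        then show ?thesis unfolding \<alpha>(2) by (simp add: inj_on_def compose_def)
      qed
      ultimately show "\<psi> \<in> isos H S" by (simp add: isos_def \<alpha>(2) compose_extensional)
    next
      fix \<psi> assume \<psi>: "\<psi> \<in> isos H S"
      have "\<psi> ` ?V = \<phi> ` ?V" using isos_verts[OF \<psi>] isos_verts[OF \<phi>] by simp
      then have mem: "\<psi> v \<in> \<phi> ` ?V" if "v \<in> ?V" for v using that by blast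
      \<comment> \<open>The automorphism that \<open>\<phi>\<close> sends to \<open>\<psi>\<close>:
        first apply \<open>\<psi>\<close>, then undo \<open>\<phi>\<close>.\<close>
      define \<alpha> where "\<alpha> = compose ?V ?inv \<psi>"
      have "image_graph \<alpha> H = image_graph (?inv \<circ> \<psi>) H"
        by (rule image_graph_cong[OF H]) (simp add: \<alpha>_def compose_def)
      also have "\<dots> = image_graph ?inv (image_graph \<phi> H)"
        using \<psi> S by (simp add: image_graph_compose isos_def)
      also have "\<dots> = H" by (rule image_graph_inverse[OF H inj])
      finally have "image_graph \<alpha> H = H" .
      moreover have "inj_on \<alpha> ?V"
      proof (rule inj_onI)
        fix u v assume uv: "u \<in> ?V" "v \<in> ?V" "\<alpha> u = \<alpha> v"
        then have "\<phi> (?inv (\<psi> u)) = \<phi> (?inv (\<psi> v))" by (simp add: \<alpha>_def compose_def)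
        then have "\<psi> u = \<psi> v" using f_the_inv_into_f[OF inj] mem uv(1,2) by simp
        then show "u = v" using \<psi> uv(1,2) by (auto simp: isos_def dest: inj_onD)
      qed
      ultimately have "\<alpha> \<in> isos H H" by (simp add: isos_def \<alpha>_def compose_extensional)
      moreover have "compose ?V \<phi> \<alpha> = \<psi>"
      proof (rule extensionalityI)
        show "\<psi> \<in> extensional ?V" using \<psi> by (simp add: isos_def)
        show "compose ?V \<phi> \<alpha> v = \<psi> v" if "v \<in> ?V" for v
          using that f_the_inv_into_f[OF inj mem[OF that]] by (simp add: compose_def \<alpha>_def)
      qed (rule compose_extensional)
      ultimately show "\<psi> \<in> compose ?V \<phi> ` isos H H" by blast
    qed
  qed
  then show ?thesis by (simp add: bij_betw_same_card)
qed

lemma card_isos_pos: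
  assumes "pair_graph H"
  shows "0 < card (isos H H)"
proof -
  note facts = pair_graph_facts[OF assms]
  have "(\<lambda>v\<in>pverts H. v) \<in> isos H H"
    using image_graph_cong[OF facts(3), of "\<lambda>v\<in>pverts H. v" "\<lambda>v. v"]
    by (simp add: isos_def image_graph_id inj_on_def)
  moreover have "isos H H \<subseteq> pverts H \<rightarrow>\<^sub>E pverts H"
  proof
    fix \<alpha> assume \<alpha>: "\<alpha> \<in> isos H H"
    show "\<alpha> \<in> pverts H \<rightarrow>\<^sub>E pverts H"
      unfolding PiE_def using \<alpha> isos_verts[OF \<alpha>] by (auto simp: isos_def)
  qed
  then have "finite (isos H H)" using facts(1) by (meson finite_PiE finite_subset)
  ultimately show ?thesis by (auto simp: card_gt_0_iff)
qed

text \<open>Injective homomorphisms are grouped by their image graph. The images are exactly the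
  copies of \<open>H\<close> in \<open>G\<close>, and each group has as many members as
  \<open>H\<close> has automorphisms.\<close>

lemma card_injective_homs_eq_num_sub:
  assumes H: "pair_graph H" and G: "pair_graph G"
  shows "card {\<phi> \<in> homs H G. inj_on \<phi> (pverts H)} = num_sub H G * card (isos H H)"
proof -
  define Subs where "Subs = {S. pair_graph S \<and> subgraph (with_proj S) (with_proj G) \<and> graph_iso S H}"
  note facts = pair_graph_facts[OF H]
  interpret G: pair_graph G by (rule G)
  let ?I = "{\<phi> \<in> homs H G. inj_on \<phi> (pverts H)}"
  have ex: "isos H S \<noteq> {}" if "S \<in> Subs" for S
  proof -
    have "pair_graph S" "graph_iso S H" using that by (simp_all add: Subs_def)
    then obtain \<phi> where \<phi>: "inj_on \<phi> (pverts S)" "H = image_graph \<phi> S"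
      using graph_iso_iff_image_graph by blast
    let ?\<psi> = "restrict (the_inv_into (pverts S) \<phi>) (pverts H)"
    have "image_graph ?\<psi> H = image_graph (the_inv_into (pverts S) \<phi>) H"
      by (rule image_graph_cong[OF facts(3)]) simp
    also have "\<dots> = S"
      unfolding \<phi>(2) by (rule image_graph_inverse[OF pair_graph_facts(3)[OF \<open>pair_graph S\<close>] \<phi>(1)])
    finally have "image_graph ?\<psi> H = S" .
    moreover have "inj_on ?\<psi> (pverts H)"
      using inj_on_the_inv_into[OF \<phi>(1)] by (simp add: \<phi>(2) image_graph_def)
    ultimately have "?\<psi> \<in> isos H S" unfolding isos_def by simp
    then show ?thesis by blast
  qed
  have union: "?I = (\<Union>S\<in>Subs. isos H S)"
  proof (intro equalityI subsetI)
    fix \<phi> assume \<phi>: "\<phi> \<in> ?I"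
    let ?S = "image_graph \<phi> H"
    have S: "pair_graph ?S" by (rule pair_graph_image_graph[OF H]) (use \<phi> in simp)
    interpret S: pair_graph ?S by (rule S)
    have "subgraph (with_proj ?S) (with_proj G)"
      unfolding subgraph_def
      using \<phi> S.wf_digraph G.wf_digraph by (auto simp: homs_def image_graph_def)
    moreover have "graph_iso ?S H"
      unfolding graph_iso_iff_image_graph[OF S]
    proof (intro exI conjI)
      show "inj_on (the_inv_into (pverts H) \<phi>) (pverts ?S)"
        using \<phi> by (simp add: image_graph_def inj_on_the_inv_into)
      show "H = image_graph (the_inv_into (pverts H) \<phi>) ?S"
        by (rule image_graph_inverse[OF facts(3), symmetric]) (use \<phi> in simp)
    qed
    ultimately have "?S \<in> Subs" using S by (simp add: Subs_def)
    moreover have "\<phi> \<in> isos H ?S" using \<phi> by (simp add: isos_def homs_def PiE_def)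
    ultimately show "\<phi> \<in> (\<Union>S\<in>Subs. isos H S)" by blast
  next
    fix \<phi> assume "\<phi> \<in> (\<Union>S\<in>Subs. isos H S)"
    then obtain S where S: "S \<in> Subs" "\<phi> \<in> isos H S" by blast
    have sub: "pverts S \<subseteq> pverts G" "parcs S \<subseteq> parcs G"
      using S(1) by (simp_all add: Subs_def subgraph_def)
    have "\<phi> \<in> pverts H \<rightarrow>\<^sub>E pverts G"
      unfolding PiE_def using isos_verts[OF S(2)] S(2) sub(1) by (auto simp: isos_def)
    moreover have "(\<phi> u, \<phi> v) \<in> parcs G" if "(u, v) \<in> parcs H" for u v
    proof -
      have "parcs S = map_prod \<phi> \<phi> ` parcs H" using S(2) by (auto simp: isos_def image_graph_def)
      then show ?thesis using that sub(2) by force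
    qed
    ultimately show "\<phi> \<in> ?I" using S(2) by (auto simp: homs_def isos_def)
  qed
  have finI: "finite ?I"
    using finite_homs[OF facts(1) pair_graph_facts(1)[OF G]] by simp
  \<comment> \<open>Every copy is the image of some injective homomorphism, so finiteness of the
    copies follows from that of the maps.\<close>
  have "Subs \<subseteq> (\<lambda>\<phi>. image_graph \<phi> H) ` ?I"
  proof
    fix S assume "S \<in> Subs"
    then obtain \<phi> where "\<phi> \<in> isos H S" using ex by blast
    then show "S \<in> (\<lambda>\<phi>. image_graph \<phi> H) ` ?I"
      using union \<open>S \<in> Subs\<close> by (auto simp: isos_def)
  qed
  then have fin: "finite Subs" using finI by (meson finite_imageI finite_subset)
  have "card ?I = (\<Sum>S\<in>Subs. card (isos H S))"
    unfolding union
  proof (rule card_UN_disjoint[OF fin])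
    show "\<forall>S\<in>Subs. finite (isos H S)" using finI unfolding union by (meson UN_upper finite_subset)
    show "\<forall>S\<in>Subs. \<forall>S'\<in>Subs. S \<noteq> S' \<longrightarrow> isos H S \<inter> isos H S' = {}" by (auto simp: isos_def)
  qed
  also have "\<dots> = (\<Sum>S\<in>Subs. card (isos H H))"
    using ex card_isos[OF facts(3)] by (intro sum.cong refl) blast
  also have "\<dots> = num_sub H G * card (isos H H)" by (simp add: num_sub_def Subs_def)
  finally show ?thesis .
qed

text \<open>The quotient belongs to its own isomorphism class by the identity map, so the hypothesis
  on the spasm applies to it directly.\<close>

lemma treewidth_quotient_le:
  assumes H: "pair_graph H" and tw: "\<forall>X\<in>spasm H. \<forall>F\<in>X. treewidth F \<le> k"
    and \<rho>: "partition_on (pverts H) \<rho>" "\<forall>B\<in>\<rho>. independent_set H B"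
  shows "treewidth (quotient_graph H \<rho>) \<le> k"
proof -
  let ?Q = "quotient_graph H \<rho>"
  have Q: "pair_graph ?Q" by (rule pair_graph_quotient[OF H \<rho>])
  have "graph_iso ?Q ?Q"
    unfolding graph_iso_iff_image_graph[OF Q] using image_graph_id[of ?Q] inj_on_id2 by metis
  then have mem: "?Q \<in> {F. pair_graph F \<and> graph_iso F ?Q}" using Q by simp
  have "{F. pair_graph F \<and> graph_iso F ?Q} \<in> spasm H"
    unfolding spasm_def using \<rho> by blast
  from bspec[OF bspec[OF tw this] mem] show ?thesis .
qed

lemma num_sub_computable:
  assumes \<omega>: "matmul_exponent \<omega>" and H: "pair_graph H"
    and tw: "\<forall>X\<in>spasm H. \<forall>F\<in>X. treewidth F \<le> 2"
  shows "\<exists>P C. computes_in_time P (num_sub H) (\<lambda>n. C * real (max 1 n) powr \<omega>)"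
proof -
  let ?V = "pverts H"
  let ?Q = "\<lambda>S. quotient_graph H (?V // closure_on ?V S)"
  let ?indep = "\<lambda>S. \<forall>B\<in>?V // closure_on ?V S. independent_set H B"
  note ge_2 = matmul_exponent_ge_2[OF \<omega>]
  have part: "partition_on ?V (?V // closure_on ?V S)" for S
    by (rule partition_on_quotient[OF equiv_closure_on])
  have summand: "computable_scalar \<omega> (\<lambda>n G. (-1) ^ card S * (if ?indep S then hom_count (?Q S) n G else 0))" for S
  proof (cases "?indep S")
    case True
    have "computable_scalar \<omega> (hom_count (?Q S))"
      by (rule computable_scalar_hom_count[OF \<omega> pair_graph_quotient[OF H part True]
          treewidth_quotient_le[OF H tw part True]])
    from computable_scalar_mult[OF ge_2 computable_scalar_const[OF ge_2] this] show ?thesis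
      using True by simp
  next
    case False
    show ?thesis unfolding if_not_P[OF False] using computable_scalar_const[OF ge_2, of 0] by simp
  qed
  have "computable_scalar \<omega> (\<lambda>n G. (\<Sum>S\<in>Pow (distinct_pairs ?V).
      (-1) ^ card S * (if ?indep S then hom_count (?Q S) n G else 0)) div int (card (isos H H)))"
    using finite_distinct_pairs[OF pair_graph_facts(1)[OF H]] card_isos_pos[OF H]
    by (intro computable_scalar_div computable_scalar_sum summand ge_2) simp_all
  then show ?thesis
  proof (rule computes_in_time_if_computable_scalar[OF _ ge_2])
    fix n G assume G: "graph_on n G"
    then have "pair_graph G" by (simp add: graph_on_def)
    have "(\<Sum>S\<in>Pow (distinct_pairs ?V). (-1) ^ card S * (if ?indep S then hom_count (?Q S) n G else 0)) =
        int (card {\<phi> \<in> homs H G. inj_on \<phi> ?V})"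
      unfolding card_injective_homs[OF H \<open>pair_graph G\<close>]
      using hom_count_eq[OF pair_graph_quotient[OF H part] G] by (intro sum.cong refl) simp
    also have "\<dots> = int (num_sub H G) * int (card (isos H H))"
      unfolding card_injective_homs_eq_num_sub[OF H \<open>pair_graph G\<close>] by simp
    \<comment> \<open>The sum is a multiple of the number of automorphisms, which is positive, so
      the integer division of the program is exact.\<close>
    finally show "(\<Sum>S\<in>Pow (distinct_pairs ?V). (-1) ^ card S *
        (if ?indep S then hom_count (?Q S) n G else 0)) div int (card (isos H H)) = int (num_sub H G)"
      using card_isos_pos[OF H] by simp
  qed
qed

theorem theorem1p3:
  fixes \<omega> :: real
  assumes "matmul_exponent \<omega>"
  shows "\<exists>f :: 'a pair_pre_digraph \<Rightarrow> real. \<forall>H :: 'a pair_pre_digraph.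
    pair_graph H \<and> (\<forall>X \<in> spasm H. \<forall>F \<in> X. treewidth F \<le> 2) \<longrightarrow>
    (\<exists>P. computes_in_time P (num_sub H) (\<lambda>n. f H * real (max 1 n) powr \<omega>))"
\<comment> \<open>The constant is found for each \<open>H\<close> separately; choice collects these
  constants into \<open>f\<close>.\<close>
proof (rule choice, intro allI)
  fix H :: "'a pair_pre_digraph"
  show "\<exists>C. pair_graph H \<and> (\<forall>X\<in>spasm H. \<forall>F\<in>X. treewidth F \<le> 2) \<longrightarrow>
      (\<exists>P. computes_in_time P (num_sub H) (\<lambda>n. C * real (max 1 n) powr \<omega>))"
    using num_sub_computable[OF assms, of H] by blast
qed

end
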